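(* Let $k$ be a field of characteristic $\neq 2$, $n$ a positive integer, $\xi$ a generator of the group $U_n(k)$ of order $\nu(n)$ and $t \in \{0, 1, \ldots, \nu(n) - 1\}$. Then $U_t(\mathbb{Z}_n)$ and $\widetilde{U_t}(\mathbb{Z}_n)$ are subgroups of the group of units $U(\mathbb{Z}_n)$, and there exists an isomorphism of groups $$\mathrm{Aut}_{\rm Hopf}(H_{4n, \xi^{t}}) \simeq k^{*}\times \widetilde{U_t}(\mathbb{Z}_n)$$ if $n$ and $\nu(n)$ are both even, and an isomorphism of groups $$\mathrm{Aut}_{\rm Hopf}(H_{4n, \xi^{t}}) \simeq k^{*} \times U_t(\mathbb{Z}_n)$$ otherwise.
   Context: $U_n(k) = \{\omega \in k \mid \omega^n = 1\}$ is the cyclic group of $n$-th roots of unity in $k$ and $\nu(n) = |U_n(k)|$. $k^*$ is the multiplicative group of $k$; $U(\mathbb{Z}_n)$ is the group of units of $\mathbb{Z}_n = \mathbb{Z}/n\mathbb{Z}$ and $\hat{s}$ denotes the class of an integer $s$. For $t = 0, 1, \ldots, \nu(n)-1$ define $$U_t(\mathbb{Z}_n) = \{\hat{s} \in U(\mathbb{Z}_n) : \nu(n) \mid t(s-1)\},$$ $$V_t(\mathbb{Z}_n) = \{\hat{l} \in U(\mathbb{Z}_n) : 2t(l-1) = \nu(n) q \text{ for some odd integer } q\},$$ $$\widetilde{U_t}(\mathbb{Z}_n) = U_t(\mathbb{Z}_n) \cup V_t(\mathbb{Z}_n).$$ For $\omega \in U_n(k)$, $H_{4n, \omega}$ is the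 $4n$-dimensional Hopf algebra over $k$ generated by $g, x, c$ subject to the relations $g^2 = c^n = 1$, $x^2 = 0$, $xg = -gx$, $cg = gc$, $cx = \omega\, xc$, with $\Delta(g) = g \otimes g$, $\Delta(c) = c \otimes c$, $\Delta(x) = x \otimes 1 + g \otimes x$, $\varepsilon(c) = \varepsilon(g) = 1$, $\varepsilon(x) = 0$, $S(c) = c^{n-1}$, $S(g) = g$, $S(x) = -gx$. $\mathrm{Aut}_{\rm Hopf}$ denotes the group of Hopf algebra automorphisms. *)

theory Defs
  imports "HOL-Algebra.Algebra" "HOL-Library.Poly_Mapping"
begin

section \<open>Algebras over a field\<close>

text \<open>The ground field is a type 'k of class field. A (not necessarily commutative) 'k-algebra is
  described by a record of type ('k, 'a) module, whose ring part is the underlying ring.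
  The locale algebra of the library is not used, since it requires commutativity.\<close>

definition base_algebra :: "('k::field, 'k) module" where
  "base_algebra = \<lparr>carrier = UNIV, monoid.mult = (*), one = 1, ring.zero = 0, ring.add = (+), module.smult = (*)\<rparr>"

text \<open>The monoid algebra of M: formal linear combinations of elements of the carrier of M.\<close>

definition monoid_algebra :: "('m, 'z) monoid_scheme \<Rightarrow> ('k::field, 'm \<Rightarrow>\<^sub>0 'k) module" where
  "monoid_algebra M =
    \<lparr>carrier = {p. Poly_Mapping.keys p \<subseteq> carrier M},
     monoid.mult = (\<lambda>p q. \<Sum>a\<in>Poly_Mapping.keys p. \<Sum>b\<in>Poly_Mapping.keys q.
       Poly_Mapping.single (a \<otimes>\<^bsub>M\<^esub> b) (Poly_Mapping.lookup p a * Poly_Mapping.lookup q b)),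
     one = Poly_Mapping.single \<one>\<^bsub>M\<^esub> 1,
     ring.zero = 0,
     ring.add = (+),
     module.smult = (\<lambda>s. Poly_Mapping.map ((*) s))\<rparr>"

definition linear_extension ::
  "('k::field, 'b, 'z) module_scheme \<Rightarrow> ('m \<Rightarrow> 'b) \<Rightarrow> ('m \<Rightarrow>\<^sub>0 'k) \<Rightarrow> 'b" where
  "linear_extension B f p =
    (\<Oplus>\<^bsub>B\<^esub>m\<in>Poly_Mapping.keys p. Poly_Mapping.lookup p m \<odot>\<^bsub>B\<^esub> f m)"

text \<open>The map induced on a quotient by a map h that is constant on cosets,
  as in the homomorphism theorems of the library.\<close>

definition induced_map :: "('a \<Rightarrow> 'b) \<Rightarrow> 'a set \<Rightarrow> 'b" where
  "induced_map h S = the_elem (h ` S)"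

definition quotient_algebra ::
  "('k, 'a, 'z) module_scheme \<Rightarrow> 'a set \<Rightarrow> ('k, 'a set) module" where
  "quotient_algebra A I =
    \<lparr>carrier = carrier (A Quot I), monoid.mult = monoid.mult (A Quot I), one = one (A Quot I),
     ring.zero = ring.zero (A Quot I), ring.add = ring.add (A Quot I),
     module.smult = (\<lambda>s. induced_map (\<lambda>a. I +>\<^bsub>A\<^esub> (s \<odot>\<^bsub>A\<^esub> a)))\<rparr>"

definition opposite_algebra ::
  "('k, 'a, 'z) module_scheme \<Rightarrow> ('k, 'a) module" where
  "opposite_algebra A =
    \<lparr>carrier = carrier A, monoid.mult = (\<lambda>a b. b \<otimes>\<^bsub>A\<^esub> a), one = \<one>\<^bsub>A\<^esub>,
     ring.zero = \<zero>\<^bsub>A\<^esub>, ring.add = ring.add A, module.smult = module.smult A\<rparr>"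


section \<open>Tensor products\<close>

text \<open>The tensor product of A and B is the free vector space on the set carrier A \<times> carrier B
  modulo the span of the bilinearity relations. This span is invariant under the multiplication
  (a, b) (a', b') = (a a', b b'), so that it is the same as the ideal generated by these relations in
  the monoid algebra of the product of the multiplicative monoids. Dividing by that ideal
  yields the tensor product together with its usual algebra structure.\<close>

definition bilinear_relations ::
  "('k::field, 'a, 'y) module_scheme \<Rightarrow> ('k, 'b, 'z) module_scheme \<Rightarrow> ('a \<times> 'b \<Rightarrow>\<^sub>0 'k) set" where
  "bilinear_relations A B =
    {Poly_Mapping.single (a \<oplus>\<^bsub>A\<^esub> a', b) 1
       - Poly_Mapping.single (a, b) 1 - Poly_Mapping.single (a', b) 1 |
       a a' b. a \<in> carrier A \<and> a' \<in> carrier A \<and> b \<in> carrier B} \<union>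
    {Poly_Mapping.single (a, b \<oplus>\<^bsub>B\<^esub> b') 1
       - Poly_Mapping.single (a, b) 1 - Poly_Mapping.single (a, b') 1 |
       a b b'. a \<in> carrier A \<and> b \<in> carrier B \<and> b' \<in> carrier B} \<union>
    {Poly_Mapping.single (s \<odot>\<^bsub>A\<^esub> a, b) 1 - Poly_Mapping.single (a, b) s |
       s a b. a \<in> carrier A \<and> b \<in> carrier B} \<union>
    {Poly_Mapping.single (a, s \<odot>\<^bsub>B\<^esub> b) 1 - Poly_Mapping.single (a, b) s |
       s a b. a \<in> carrier A \<and> b \<in> carrier B}"

definition tensor_ideal ::
  "('k::field, 'a, 'y) module_scheme \<Rightarrow> ('k, 'b, 'z) module_scheme \<Rightarrow> ('a \<times> 'b \<Rightarrow>\<^sub>0 'k) set" where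
  "tensor_ideal A B =
    genideal (monoid_algebra (A \<times>\<times> B) :: ('k, 'a \<times> 'b \<Rightarrow>\<^sub>0 'k) module) (bilinear_relations A B)"

definition tensor_algebra ::
  "('k::field, 'a, 'y) module_scheme \<Rightarrow> ('k, 'b, 'z) module_scheme \<Rightarrow>
   ('k, ('a \<times> 'b \<Rightarrow>\<^sub>0 'k) set) module" where
  "tensor_algebra A B = quotient_algebra (monoid_algebra (A \<times>\<times> B)) (tensor_ideal A B)"

definition pure_tensor ::
  "('k::field, 'a, 'y) module_scheme \<Rightarrow> ('k, 'b, 'z) module_scheme \<Rightarrow> 'a \<Rightarrow> 'b \<Rightarrow>
   ('a \<times> 'b \<Rightarrow>\<^sub>0 'k) set" where
  "pure_tensor A B a b =
    tensor_ideal A B +>\<^bsub>(monoid_algebra (A \<times>\<times> B) :: ('k, 'a \<times> 'b \<Rightarrow>\<^sub>0 'k) module)\<^esub>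
      Poly_Mapping.single (a, b) 1"

text \<open>The tensor product of two linear maps f and f' with values in B and B'.\<close>

definition tensor_map ::
  "('k::field, 'b, 'y) module_scheme \<Rightarrow> ('k, 'c, 'z) module_scheme \<Rightarrow> ('a \<Rightarrow> 'b) \<Rightarrow> ('d \<Rightarrow> 'c) \<Rightarrow>
   ('a \<times> 'd \<Rightarrow>\<^sub>0 'k) set \<Rightarrow> ('b \<times> 'c \<Rightarrow>\<^sub>0 'k) set" where
  "tensor_map B B' f f' =
    induced_map (linear_extension (tensor_algebra B B') (\<lambda>(a, a'). pure_tensor B B' (f a) (f' a')))"


section \<open>Hopf algebras and their automorphisms\<close>

record (overloaded) ('k::zero, 'a) hopf_algebra = "('k, 'a) module" +
  counit :: "'a \<Rightarrow> 'k"
  comult :: "'a \<Rightarrow> ('a \<times> 'a \<Rightarrow>\<^sub>0 'k) set"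
  antipode :: "'a \<Rightarrow> 'a"

text \<open>As for groups in the library, an automorphism is normalised to be undefined
  outside the carrier.\<close>

definition hopf_auto :: "('k::field, 'a, 'z) hopf_algebra_scheme \<Rightarrow> ('a \<Rightarrow> 'a) set" where
  "hopf_auto H = {\<phi> \<in> ring_hom H H \<inter> Bij (carrier H).
     (\<forall>s. \<forall>a\<in>carrier H. \<phi> (s \<odot>\<^bsub>H\<^esub> a) = s \<odot>\<^bsub>H\<^esub> \<phi> a) \<and>
     (\<forall>a\<in>carrier H. counit H (\<phi> a) = counit H a) \<and>
     (\<forall>a\<in>carrier H. comult H (\<phi> a) = tensor_map H H \<phi> \<phi> (comult H a)) \<and>
     (\<forall>a\<in>carrier H. antipode H (\<phi> a) = \<phi> (antipode H a))}"

definition HopfAutGroup :: "('k::field, 'a, 'z) hopf_algebra_scheme \<Rightarrow> ('a \<Rightarrow> 'a) monoid" where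
  "HopfAutGroup H = BijGroup (carrier H) \<lparr>carrier := hopf_auto H\<rparr>"


section \<open>The Hopf algebras given by generators g, x, c\<close>

datatype gen = GenG | GenX | GenC

definition word_monoid :: "gen list monoid" where
  "word_monoid = \<lparr>carrier = UNIV, monoid.mult = (@), one = []\<rparr>"

definition free_algebra :: "('k::field, gen list \<Rightarrow>\<^sub>0 'k) module" where
  "free_algebra = monoid_algebra word_monoid"

text \<open>The algebra homomorphism from the free algebra to B with given values on the generators.\<close>

definition free_hom ::
  "('k::field, 'b, 'z) module_scheme \<Rightarrow> (gen \<Rightarrow> 'b) \<Rightarrow> (gen list \<Rightarrow>\<^sub>0 'k) \<Rightarrow> 'b" where
  "free_hom B f = linear_extension B (\<lambda>w. foldr (\<lambda>u b. f u \<otimes>\<^bsub>B\<^esub> b) w \<one>\<^bsub>B\<^esub>)"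

abbreviation word :: "gen list \<Rightarrow> (gen list \<Rightarrow>\<^sub>0 'k::field)" where
  "word w \<equiv> Poly_Mapping.single w 1"

definition H4n_relations :: "nat \<Rightarrow> 'k::field \<Rightarrow> (gen list \<Rightarrow>\<^sub>0 'k) set" where
  "H4n_relations n \<omega> =
    {word [GenG, GenG] - word [],
     word (replicate n GenC) - word [],
     word [GenX, GenX],
     word [GenX, GenG] + word [GenG, GenX],
     word [GenC, GenG] - word [GenG, GenC],
     word [GenC, GenX] - Poly_Mapping.single [GenX, GenC] \<omega>}"

definition H4n_ideal :: "nat \<Rightarrow> 'k::field \<Rightarrow> (gen list \<Rightarrow>\<^sub>0 'k) set" where
  "H4n_ideal n \<omega> = genideal (free_algebra :: ('k, gen list \<Rightarrow>\<^sub>0 'k) module) (H4n_relations n \<omega>)"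

definition H4n_algebra :: "nat \<Rightarrow> 'k::field \<Rightarrow> ('k, (gen list \<Rightarrow>\<^sub>0 'k) set) module" where
  "H4n_algebra n \<omega> = quotient_algebra free_algebra (H4n_ideal n \<omega>)"

definition H4n_class :: "nat \<Rightarrow> 'k::field \<Rightarrow> (gen list \<Rightarrow>\<^sub>0 'k) \<Rightarrow> (gen list \<Rightarrow>\<^sub>0 'k) set" where
  "H4n_class n \<omega> p = H4n_ideal n \<omega> +>\<^bsub>(free_algebra :: ('k, gen list \<Rightarrow>\<^sub>0 'k) module)\<^esub> p"

primrec gen_counit :: "gen \<Rightarrow> 'k::field" where
  "gen_counit GenG = 1"
| "gen_counit GenX = 0"
| "gen_counit GenC = 1"

definition gen_comult ::
  "nat \<Rightarrow> 'k::field \<Rightarrow> gen \<Rightarrow> ((gen list \<Rightarrow>\<^sub>0 'k) set \<times> (gen list \<Rightarrow>\<^sub>0 'k) set \<Rightarrow>\<^sub>0 'k) set" where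
  "gen_comult n \<omega> u =
    (let A = H4n_algebra n \<omega>;
         T = tensor_algebra A A;
         cl = (\<lambda>w. H4n_class n \<omega> (word w))
     in case u of
          GenG \<Rightarrow> pure_tensor A A (cl [GenG]) (cl [GenG])
        | GenX \<Rightarrow> pure_tensor A A (cl [GenX]) (cl []) \<oplus>\<^bsub>T\<^esub> pure_tensor A A (cl [GenG]) (cl [GenX])
        | GenC \<Rightarrow> pure_tensor A A (cl [GenC]) (cl [GenC]))"

primrec gen_antipode :: "nat \<Rightarrow> 'k::field \<Rightarrow> gen \<Rightarrow> (gen list \<Rightarrow>\<^sub>0 'k) set" where
  "gen_antipode n \<omega> GenG = H4n_class n \<omega> (word [GenG])"
| "gen_antipode n \<omega> GenX = H4n_class n \<omega> (- word [GenG, GenX])"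
| "gen_antipode n \<omega> GenC = H4n_class n \<omega> (word (replicate (n - 1) GenC))"

text \<open>Comultiplication and counit extend to algebra homomorphisms, the antipode
  to an algebra antihomomorphism.\<close>

definition H4n :: "nat \<Rightarrow> 'k::field \<Rightarrow> ('k, (gen list \<Rightarrow>\<^sub>0 'k) set) hopf_algebra" where
  "H4n n \<omega> =
    (let A = H4n_algebra n \<omega>
     in \<lparr>carrier = carrier A, monoid.mult = monoid.mult A, one = one A,
         ring.zero = ring.zero A, ring.add = ring.add A, module.smult = module.smult A,
         counit = induced_map (free_hom base_algebra gen_counit),
         comult = induced_map (free_hom (tensor_algebra A A) (gen_comult n \<omega>)),
         antipode = induced_map (free_hom (opposite_algebra A) (gen_antipode n \<omega>))\<rparr>)"


section \<open>Roots of unity and units modulo n\<close>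

abbreviation k_units :: "'k::field monoid" where
  "k_units \<equiv> units_of (base_algebra :: ('k, 'k) module)"

definition roots_of_unity :: "nat \<Rightarrow> 'k::field set" where
  "roots_of_unity n = {\<omega>. \<omega> ^ n = 1}"

definition nu :: "'k::field itself \<Rightarrow> nat \<Rightarrow> nat" where
  "nu _ n = card (roots_of_unity n :: 'k set)"

definition residue_class :: "nat \<Rightarrow> int \<Rightarrow> int set" where
  "residue_class n s = Idl\<^bsub>\<Z>\<^esub> {int n} +>\<^bsub>\<Z>\<^esub> s"

abbreviation Zn_units :: "nat \<Rightarrow> int set monoid" where
  "Zn_units n \<equiv> units_of (ZFact (int n))"

text \<open>The following conditions do not depend on the representative of the residue class,
  because nu divides n.\<close>

definition U_sub :: "'k::field itself \<Rightarrow> nat \<Rightarrow> nat \<Rightarrow> int set set" where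
  "U_sub K n t = {residue_class n s | s. residue_class n s \<in> carrier (Zn_units n) \<and>
     int (nu K n) dvd int t * (s - 1)}"

definition V_set :: "'k::field itself \<Rightarrow> nat \<Rightarrow> nat \<Rightarrow> int set set" where
  "V_set K n t = {residue_class n l | l. residue_class n l \<in> carrier (Zn_units n) \<and>
     (\<exists>q. odd q \<and> 2 * int t * (l - 1) = int (nu K n) * q)}"

definition U_tilde :: "'k::field itself \<Rightarrow> nat \<Rightarrow> nat \<Rightarrow> int set set" where
  "U_tilde K n t = U_sub K n t \<union> V_set K n t"

end

theory Submission
  imports Defs
begin

text \<open>Write \<open>\<omega> = \<xi>\<^sup>t\<close>. The algebra \<open>H\<close> on \<open>g, x, c\<close> has the basis \<open>u\<close> and \<open>u x\<close>, where \<open>u\<close> runs through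
the \<open>2n\<close> elements of the commutative group of monomials \<open>g\<^sup>e c\<^sup>i\<close>. A Hopf automorphism \<open>\<phi>\<close> is determined
by what it does to the generators, and the comultiplication leaves little choice.

Comparing coefficients in \<open>\<Delta>(y) = y \<otimes> y\<close> shows that the nonzero group-like elements are exactly the monomials
\<open>g\<^sup>e c\<^sup>i\<close> (\<open>group_like_classification\<close>), so \<open>\<phi>\<close> maps \<open>g\<close> and \<open>c\<close> to such monomials. Then \<open>y = \<phi>(x)\<close> satisfies
\<open>\<Delta>(y) = y \<otimes> 1 + h \<otimes> y\<close> with \<open>h = \<phi>(g)\<close>. Comparing coefficients again leaves only \<open>y = \<alpha> x + \<beta> 1 + \<gamma> h\<close>, and
since \<open>y\<close> anticommutes with \<open>h\<close> and the characteristic is not 2, the last two terms vanish. So \<open>\<phi>(x) = \<alpha> x\<close> with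
\<open>\<alpha> \<noteq> 0\<close>, which in turn forces \<open>h = g\<close> (\<open>skew_primitive_classification\<close>). With \<open>\<phi>(c) = g\<^sup>e c\<^sup>l\<close> the relation
\<open>c\<^sup>n = 1\<close> says that \<open>e n\<close> is even, the relation \<open>c x = \<omega> x c\<close> says that \<open>(-1)\<^sup>e \<omega>\<^sup>l = \<omega>\<close>, and injectivity says that
\<open>l\<close> is prime to \<open>n\<close> (\<open>automorphism_classification\<close>). Conversely all such data occur (\<open>automorphism_exists\<close>).

The automorphisms with data \<open>(\<alpha>, e, l)\<close> and \<open>(\<beta>, e', l')\<close> compose to one with data \<open>(\<alpha> \<beta>, e' + e l', l l')\<close>.
As \<open>e\<close> modulo 2 is determined by \<open>l\<close>, sending \<open>\<phi>\<close> to \<open>\<alpha>\<close> and the class of \<open>l\<close> is an injective homomorphism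
(\<open>hopf_automorphism_group\<close>). Its image is given by the classes with \<open>\<omega>\<^sup>l = \<omega>\<close> (case \<open>e = 0\<close>) and,
when \<open>n\<close> is even, also those with \<open>\<omega>\<^sup>l = -\<omega>\<close> (case \<open>e = 1\<close>). Since \<open>\<xi>\<close> has order \<open>\<nu>(n)\<close>, the first condition
describes \<open>U\<^sub>t\<close> and the second one \<open>V\<^sub>t\<close> (\<open>scaling_conditions\<close>); the second one can only hold when \<open>\<nu>(n)\<close> is even.

What remains is to have enough control over the two quotient constructions. Homomorphisms out of \<open>H\<close> and
out of \<open>H \<otimes> H\<close> come from their universal properties (\<open>H4n_universal\<close>, \<open>tensor_map\<close>). Coefficients are read off
with linear functionals: the coordinate functionals of \<open>H\<close> are defined on words by a normal form
(\<open>coord\<close>), and a pair of functionals on \<open>H\<close> gives one on \<open>H \<otimes> H\<close> (\<open>functional_tensor\<close>), so that no basis of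
the tensor square is needed. Both descend to the quotients because a linear map that vanishes on all
\<open>u r v\<close>, for \<open>r\<close> a relation, vanishes on the ideal generated by the relations (\<open>lin_map_kills_genideal\<close>).\<close>

section \<open>Algebras and their homomorphisms\<close>

text \<open>Since \<open>(s 1) i = s i\<close>, every ideal is a subspace, so that a quotient by an ideal is again an algebra.\<close>

locale k_algebra = ring A for A :: "('k::field, 'a, 'z) module_scheme" (structure) +
  assumes smult_closed [simp]: "a \<in> carrier A \<Longrightarrow> s \<odot> a \<in> carrier A"
    and smult_add_left: "a \<in> carrier A \<Longrightarrow> (s + t) \<odot> a = s \<odot> a \<oplus> t \<odot> a"
    and smult_add_right:
      "\<lbrakk>a \<in> carrier A; b \<in> carrier A\<rbrakk> \<Longrightarrow> s \<odot> (a \<oplus> b) = s \<odot> a \<oplus> s \<odot> b"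
    and smult_smult [simp]: "a \<in> carrier A \<Longrightarrow> s \<odot> (t \<odot> a) = (s * t) \<odot> a"
    and smult_one [simp]: "a \<in> carrier A \<Longrightarrow> 1 \<odot> a = a"
    and smult_mult [simp]:
      "\<lbrakk>a \<in> carrier A; b \<in> carrier A\<rbrakk> \<Longrightarrow> (s \<odot> a) \<otimes> b = s \<odot> (a \<otimes> b)"
    and mult_smult [simp]:
      "\<lbrakk>a \<in> carrier A; b \<in> carrier A\<rbrakk> \<Longrightarrow> a \<otimes> (s \<odot> b) = s \<odot> (a \<otimes> b)"
begin

lemma smult_zero_left [simp]:
  assumes "a \<in> carrier A"
  shows "0 \<odot> a = \<zero>"
proof -
  have "0 \<odot> a \<oplus> 0 \<odot> a = 0 \<odot> a"
    using smult_add_left[OF assms, of 0 0] by simp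
  then show ?thesis using assms by (metis add.l_cancel_one' smult_closed)
qed

lemma smult_zero_right [simp]: "s \<odot> \<zero> = \<zero>"
  by (metis mult_zero_right smult_smult smult_zero_left zero_closed)

lemma minus_eq_smult:
  assumes "a \<in> carrier A"
  shows "\<ominus> a = (- 1) \<odot> a"
proof -
  have "(- 1) \<odot> a \<oplus> a = (-1 + 1) \<odot> a"
    using assms by (simp only: smult_add_left smult_one)
  then have "(- 1) \<odot> a \<oplus> a = \<zero>" using assms by simp
  then show ?thesis using assms by (metis minus_equality smult_closed)
qed

end

definition lin_map :: "('k::field, 'a, 'y) module_scheme \<Rightarrow> ('k, 'b, 'z) module_scheme \<Rightarrow>
    ('a \<Rightarrow> 'b) set" where
  "lin_map A B = {h \<in> carrier A \<rightarrow> carrier B.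
     (\<forall>a\<in>carrier A. \<forall>b\<in>carrier A. h (a \<oplus>\<^bsub>A\<^esub> b) = h a \<oplus>\<^bsub>B\<^esub> h b) \<and>
     (\<forall>s. \<forall>a\<in>carrier A. h (s \<odot>\<^bsub>A\<^esub> a) = s \<odot>\<^bsub>B\<^esub> h a)}"

definition alg_hom :: "('k::field, 'a, 'y) module_scheme \<Rightarrow> ('k, 'b, 'z) module_scheme \<Rightarrow>
    ('a \<Rightarrow> 'b) set" where
  "alg_hom A B = ring_hom A B \<inter> lin_map A B"

lemma lin_mapI:
  assumes "\<And>a. a \<in> carrier A \<Longrightarrow> h a \<in> carrier B"
    and "\<And>a b. \<lbrakk>a \<in> carrier A; b \<in> carrier A\<rbrakk> \<Longrightarrow> h (a \<oplus>\<^bsub>A\<^esub> b) = h a \<oplus>\<^bsub>B\<^esub> h b"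
    and "\<And>s a. a \<in> carrier A \<Longrightarrow> h (s \<odot>\<^bsub>A\<^esub> a) = s \<odot>\<^bsub>B\<^esub> h a"
  shows "h \<in> lin_map A B"
  using assms by (auto simp: lin_map_def)

lemma lin_mapD:
  assumes "h \<in> lin_map A B"
  shows lin_map_closed: "\<And>a. a \<in> carrier A \<Longrightarrow> h a \<in> carrier B"
    and lin_map_add: "\<And>a b. \<lbrakk>a \<in> carrier A; b \<in> carrier A\<rbrakk> \<Longrightarrow> h (a \<oplus>\<^bsub>A\<^esub> b) = h a \<oplus>\<^bsub>B\<^esub> h b"
    and lin_map_smult: "\<And>s a. a \<in> carrier A \<Longrightarrow> h (s \<odot>\<^bsub>A\<^esub> a) = s \<odot>\<^bsub>B\<^esub> h a"
  using assms by (auto simp: lin_map_def)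

lemma lin_map_zero:
  assumes "h \<in> lin_map A B" "k_algebra A" "k_algebra B"
  shows "h \<zero>\<^bsub>A\<^esub> = \<zero>\<^bsub>B\<^esub>"
proof -
  interpret A: k_algebra A by fact
  interpret B: k_algebra B by fact
  have "h (0 \<odot>\<^bsub>A\<^esub> \<zero>\<^bsub>A\<^esub>) = 0 \<odot>\<^bsub>B\<^esub> h \<zero>\<^bsub>A\<^esub>"
    using assms by (blast intro: lin_map_smult)
  then show ?thesis using lin_map_closed[OF assms(1)] by simp
qed

lemma lin_map_minus:
  assumes h: "h \<in> lin_map A B" and A: "k_algebra A" and B: "k_algebra B"
    and ab: "a \<in> carrier A" "b \<in> carrier A"
  shows "h (a \<ominus>\<^bsub>A\<^esub> b) = h a \<ominus>\<^bsub>B\<^esub> h b"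
proof -
  interpret A: k_algebra A by fact
  interpret B: k_algebra B by fact
  show ?thesis
    using ab h by (simp add: a_minus_def A.minus_eq_smult B.minus_eq_smult lin_mapD[OF h])
qed

lemma lin_map_finsum:
  assumes h: "h \<in> lin_map A B" and A: "k_algebra A" and B: "k_algebra B"
    and f: "f \<in> S \<rightarrow> carrier A" and "finite S"
  shows "h (\<Oplus>\<^bsub>A\<^esub>i\<in>S. f i) = (\<Oplus>\<^bsub>B\<^esub>i\<in>S. h (f i))"
  using \<open>finite S\<close> f
proof (induction S)
  interpret A: k_algebra A by fact
  interpret B: k_algebra B by fact
  case empty
  then show ?case using lin_map_zero[OF h A B] by simp
next
  interpret A: k_algebra A by fact
  interpret B: k_algebra B by fact
  case (insert i S)
  then have "f i \<in> carrier A" "f \<in> S \<rightarrow> carrier A" by auto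
  moreover from this have "(\<lambda>i. h (f i)) \<in> S \<rightarrow> carrier B"
    using lin_map_closed[OF h] by auto
  ultimately show ?case
    using insert lin_map_closed[OF h] by (simp add: lin_map_add[OF h])
qed

lemma lin_map_comp:
  assumes "h \<in> lin_map A B" "h' \<in> lin_map B C"
  shows "(\<lambda>a. h' (h a)) \<in> lin_map A C"
  using assms by (auto simp: lin_map_def Pi_iff)

lemma alg_hom_comp:
  assumes "h \<in> alg_hom A B" "h' \<in> alg_hom B C"
  shows "(\<lambda>a. h' (h a)) \<in> alg_hom A C"
  using assms by (auto simp: lin_map_def alg_hom_def ring_hom_def Pi_iff)

lemma alg_homD:
  assumes "h \<in> alg_hom A B"
  shows alg_hom_lin: "h \<in> lin_map A B"
    and alg_hom_closed: "\<And>a. a \<in> carrier A \<Longrightarrow> h a \<in> carrier B"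
    and alg_hom_mult: "\<And>a b. \<lbrakk>a \<in> carrier A; b \<in> carrier A\<rbrakk> \<Longrightarrow> h (a \<otimes>\<^bsub>A\<^esub> b) = h a \<otimes>\<^bsub>B\<^esub> h b"
    and alg_hom_add: "\<And>a b. \<lbrakk>a \<in> carrier A; b \<in> carrier A\<rbrakk> \<Longrightarrow> h (a \<oplus>\<^bsub>A\<^esub> b) = h a \<oplus>\<^bsub>B\<^esub> h b"
    and alg_hom_smult: "\<And>s a. a \<in> carrier A \<Longrightarrow> h (s \<odot>\<^bsub>A\<^esub> a) = s \<odot>\<^bsub>B\<^esub> h a"
    and alg_hom_one: "h \<one>\<^bsub>A\<^esub> = \<one>\<^bsub>B\<^esub>"
  using assms by (auto simp: alg_hom_def lin_map_def ring_hom_def)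

lemma alg_homI:
  assumes "h \<in> lin_map A B"
    and "\<And>a b. \<lbrakk>a \<in> carrier A; b \<in> carrier A\<rbrakk> \<Longrightarrow> h (a \<otimes>\<^bsub>A\<^esub> b) = h a \<otimes>\<^bsub>B\<^esub> h b"
    and "h \<one>\<^bsub>A\<^esub> = \<one>\<^bsub>B\<^esub>"
  shows "h \<in> alg_hom A B"
  using assms by (auto simp: alg_hom_def lin_map_def ring_hom_def)

lemma alg_hom_pow:
  assumes h: "h \<in> alg_hom A B" and "k_algebra A" "k_algebra B" and "a \<in> carrier A"
  shows "h (a [^]\<^bsub>A\<^esub> (m::nat)) = h a [^]\<^bsub>B\<^esub> m"
proof -
  interpret A: k_algebra A by fact
  interpret B: k_algebra B by fact
  show ?thesis using assms(4)
    by (induction m) (simp_all add: alg_homD[OF h])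
qed

lemma alg_hom_kernel_ideal:
  assumes h: "h \<in> alg_hom A B" and "k_algebra A" "k_algebra B"
  shows "ideal {a \<in> carrier A. h a = \<zero>\<^bsub>B\<^esub>} A"
proof -
  interpret A: k_algebra A by fact
  interpret B: k_algebra B by fact
  interpret h: ring_hom_ring A B h
    by (rule ring_hom_ringI2[OF A.ring_axioms B.ring_axioms]) (use h in \<open>simp add: alg_hom_def\<close>)
  show ?thesis by (rule h.kernel_is_ideal[unfolded a_kernel_def'])
qed

lemma base_algebra_simps [simp]:
  "carrier base_algebra = UNIV" "(\<otimes>\<^bsub>base_algebra\<^esub>) = (*)" "\<one>\<^bsub>base_algebra\<^esub> = 1"
  "\<zero>\<^bsub>base_algebra\<^esub> = 0" "(\<oplus>\<^bsub>base_algebra\<^esub>) = (+)" "(\<odot>\<^bsub>base_algebra\<^esub>) = (*)"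
  by (simp_all add: base_algebra_def)

lemma base_algebra_k_algebra: "k_algebra (base_algebra :: ('k::field, 'k) module)"
proof unfold_locales
  show "carrier (add_monoid base_algebra) \<subseteq> Units (add_monoid (base_algebra :: ('k, 'k) module))"
    by (auto simp: Units_def) (metis ab_left_minus add.commute)
qed (auto simp: algebra_simps)

section \<open>Monoid algebras\<close>

text \<open>A formal linear combination is a finite sum of monomials. Hence an identity that is additive in each
argument needs to be checked on monomials only.\<close>

lemma poly_mapping_span_induct [consumes 1, case_names zero single add]:
  fixes p :: "'m \<Rightarrow>\<^sub>0 'k::comm_monoid_add"
  assumes "Poly_Mapping.keys p \<subseteq> S"
    and "P 0"
    and "\<And>m s. m \<in> S \<Longrightarrow> P (Poly_Mapping.single m s)"
    and add: "\<And>p q. \<lbrakk>Poly_Mapping.keys p \<subseteq> S; Poly_Mapping.keys q \<subseteq> S; P p; P q\<rbrakk> \<Longrightarrow> P (p + q)"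
  shows "P p"
proof -
  have "Poly_Mapping.keys (\<Sum>m\<in>K. Poly_Mapping.single m (f m)) \<subseteq> S \<and>
      P (\<Sum>m\<in>K. Poly_Mapping.single m (f m))" if "finite K" "K \<subseteq> S" for K and f :: "'m \<Rightarrow> 'k"
    using that
  proof (induction K)
    case empty
    then show ?case using assms(2) by simp
  next
    case (insert m K)
    have "Poly_Mapping.keys (Poly_Mapping.single m (f m)) \<subseteq> S"
      using insert.prems by simp
    moreover from this insert
    have "Poly_Mapping.keys (Poly_Mapping.single m (f m) + (\<Sum>m\<in>K. Poly_Mapping.single m (f m))) \<subseteq> S"
      using Poly_Mapping.keys_add[of "Poly_Mapping.single m (f m)" "\<Sum>m\<in>K. Poly_Mapping.single m (f m)"]
      by auto
    ultimately show ?case using insert assms(3)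
      by (simp add: add)
  qed
  moreover have "p = (\<Sum>m\<in>Poly_Mapping.keys p. Poly_Mapping.single m (Poly_Mapping.lookup p m))"
    by (rule poly_mapping_eqI)
      (auto simp: lookup_sum lookup_single when_def in_keys_iff sum.delta')
  ultimately show ?thesis using assms(1) by (metis finite_keys)
qed

lemma monoid_algebra_simps:
  "carrier (monoid_algebra M) = {p. Poly_Mapping.keys p \<subseteq> carrier M}"
  "\<one>\<^bsub>monoid_algebra M\<^esub> = Poly_Mapping.single \<one>\<^bsub>M\<^esub> 1"
  "\<zero>\<^bsub>monoid_algebra M\<^esub> = 0"
  "(\<oplus>\<^bsub>monoid_algebra M\<^esub>) = (+)"
  by (simp_all add: monoid_algebra_def)

lemma single_mem_monoid_algebra [simp]:
  "m \<in> carrier M \<Longrightarrow> Poly_Mapping.single m s \<in> carrier (monoid_algebra M)"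
  by (simp add: monoid_algebra_simps)

lemma keys_add_subset:
  "Poly_Mapping.keys p \<subseteq> S \<Longrightarrow> Poly_Mapping.keys q \<subseteq> S \<Longrightarrow> Poly_Mapping.keys (p + q) \<subseteq> S"
  using Poly_Mapping.keys_add[of p q] by blast

lemma keys_smult_subset:
  "Poly_Mapping.keys p \<subseteq> S \<Longrightarrow> Poly_Mapping.keys (s \<odot>\<^bsub>monoid_algebra M\<^esub> p) \<subseteq> S"
  by (auto simp: monoid_algebra_def in_keys_iff Poly_Mapping.map.rep_eq)

lemma lookup_monoid_algebra_smult:
  "Poly_Mapping.lookup (s \<odot>\<^bsub>monoid_algebra M\<^esub> p) m = s * Poly_Mapping.lookup p m"
  by (simp add: monoid_algebra_def Poly_Mapping.map.rep_eq when_def)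

lemma monoid_algebra_smult_single [simp]:
  "s \<odot>\<^bsub>monoid_algebra M\<^esub> Poly_Mapping.single m t = Poly_Mapping.single m (s * t)"
  by (rule poly_mapping_eqI) (simp add: lookup_monoid_algebra_smult lookup_single when_def)

text \<open>The supports of a sum and of its summands differ; summing over fixed larger sets instead
makes additivity of the product visible.\<close>

lemma monoid_algebra_mult_superset:
  fixes p q :: "'m \<Rightarrow>\<^sub>0 'k::field"
  assumes "finite S" "finite T" "Poly_Mapping.keys p \<subseteq> S" "Poly_Mapping.keys q \<subseteq> T"
  shows "p \<otimes>\<^bsub>monoid_algebra M\<^esub> q =
    (\<Sum>a\<in>S. \<Sum>b\<in>T. Poly_Mapping.single (a \<otimes>\<^bsub>M\<^esub> b) (Poly_Mapping.lookup p a * Poly_Mapping.lookup q b))"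
    (is "_ = (\<Sum>a\<in>S. \<Sum>b\<in>T. ?s a b)")
proof -
  have "p \<otimes>\<^bsub>monoid_algebra M\<^esub> q = (\<Sum>a\<in>Poly_Mapping.keys p. \<Sum>b\<in>Poly_Mapping.keys q. ?s a b)"
    by (simp add: monoid_algebra_def)
  also have "\<dots> = (\<Sum>a\<in>Poly_Mapping.keys p. \<Sum>b\<in>T. ?s a b)"
    using assms by (intro sum.cong sum.mono_neutral_left) (auto simp: in_keys_iff)
  also have "\<dots> = (\<Sum>a\<in>S. \<Sum>b\<in>T. ?s a b)"
    using assms by (intro sum.mono_neutral_left) (auto simp: in_keys_iff)
  finally show ?thesis .
qed

lemma monoid_algebra_mult_add_left:
  fixes p q r :: "'m \<Rightarrow>\<^sub>0 'k::field"
  shows "(p + q) \<otimes>\<^bsub>monoid_algebra M\<^esub> r = p \<otimes>\<^bsub>monoid_algebra M\<^esub> r + q \<otimes>\<^bsub>monoid_algebra M\<^esub> r"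
  by (simp add: keys_add_subset monoid_algebra_mult_superset[where
        S = "Poly_Mapping.keys p \<union> Poly_Mapping.keys q" and T = "Poly_Mapping.keys r"]
      lookup_add distrib_right single_add sum.distrib)

lemma monoid_algebra_mult_add_right:
  fixes p q r :: "'m \<Rightarrow>\<^sub>0 'k::field"
  shows "r \<otimes>\<^bsub>monoid_algebra M\<^esub> (p + q) = r \<otimes>\<^bsub>monoid_algebra M\<^esub> p + r \<otimes>\<^bsub>monoid_algebra M\<^esub> q"
  by (simp add: keys_add_subset monoid_algebra_mult_superset[where
        T = "Poly_Mapping.keys p \<union> Poly_Mapping.keys q" and S = "Poly_Mapping.keys r"]
      lookup_add distrib_left single_add sum.distrib)

lemma monoid_algebra_mult_zero [simp]:
  "p \<otimes>\<^bsub>monoid_algebra M\<^esub> 0 = (0 :: 'm \<Rightarrow>\<^sub>0 'k::field)" "0 \<otimes>\<^bsub>monoid_algebra M\<^esub> p = (0 :: 'm \<Rightarrow>\<^sub>0 'k::field)"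
  by (simp_all add: monoid_algebra_def)

lemma monoid_algebra_mult_single [simp]:
  "Poly_Mapping.single a s \<otimes>\<^bsub>monoid_algebra M\<^esub> Poly_Mapping.single b t =
     Poly_Mapping.single (a \<otimes>\<^bsub>M\<^esub> b) (s * t :: 'k::field)"
  by (subst monoid_algebra_mult_superset[where S = "{a}" and T = "{b}"]) auto

lemma monoid_algebra_smult_add:
  "s \<odot>\<^bsub>monoid_algebra M\<^esub> (p + q) = s \<odot>\<^bsub>monoid_algebra M\<^esub> p + s \<odot>\<^bsub>monoid_algebra M\<^esub> q"
  by (rule poly_mapping_eqI) (simp add: lookup_monoid_algebra_smult lookup_add distrib_left)

lemma monoid_algebra_smult_zero [simp]: "s \<odot>\<^bsub>monoid_algebra M\<^esub> 0 = 0"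
  by (rule poly_mapping_eqI) (simp add: lookup_monoid_algebra_smult)

lemma monoid_algebra_smult_mult:
  fixes p q :: "'m \<Rightarrow>\<^sub>0 'k::field"
  shows "(s \<odot>\<^bsub>monoid_algebra M\<^esub> p) \<otimes>\<^bsub>monoid_algebra M\<^esub> q = s \<odot>\<^bsub>monoid_algebra M\<^esub> (p \<otimes>\<^bsub>monoid_algebra M\<^esub> q)"
    and "p \<otimes>\<^bsub>monoid_algebra M\<^esub> (s \<odot>\<^bsub>monoid_algebra M\<^esub> q) = s \<odot>\<^bsub>monoid_algebra M\<^esub> (p \<otimes>\<^bsub>monoid_algebra M\<^esub> q)"
proof -
  have "Poly_Mapping.keys p \<subseteq> UNIV" by simp
  then have "(s \<odot>\<^bsub>monoid_algebra M\<^esub> p) \<otimes>\<^bsub>monoid_algebra M\<^esub> q = s \<odot>\<^bsub>monoid_algebra M\<^esub> (p \<otimes>\<^bsub>monoid_algebra M\<^esub> q)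
    \<and> p \<otimes>\<^bsub>monoid_algebra M\<^esub> (s \<odot>\<^bsub>monoid_algebra M\<^esub> q) = s \<odot>\<^bsub>monoid_algebra M\<^esub> (p \<otimes>\<^bsub>monoid_algebra M\<^esub> q)"
  proof (induction p rule: poly_mapping_span_induct)
    case (single a t)
    have "Poly_Mapping.keys q \<subseteq> UNIV" by simp
    then show ?case
      by (induction q rule: poly_mapping_span_induct)
        (auto simp: monoid_algebra_mult_add_right monoid_algebra_smult_add mult_ac)
  qed (auto simp: monoid_algebra_mult_add_left monoid_algebra_smult_add)
  then show "(s \<odot>\<^bsub>monoid_algebra M\<^esub> p) \<otimes>\<^bsub>monoid_algebra M\<^esub> q = s \<odot>\<^bsub>monoid_algebra M\<^esub> (p \<otimes>\<^bsub>monoid_algebra M\<^esub> q)"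
    and "p \<otimes>\<^bsub>monoid_algebra M\<^esub> (s \<odot>\<^bsub>monoid_algebra M\<^esub> q) = s \<odot>\<^bsub>monoid_algebra M\<^esub> (p \<otimes>\<^bsub>monoid_algebra M\<^esub> q)"
    by auto
qed

lemma monoid_algebra_k_algebra:
  assumes "monoid M"
  shows "k_algebra (monoid_algebra M :: ('k::field, 'm \<Rightarrow>\<^sub>0 'k) module)"
proof -
  interpret M: monoid M by fact
  let ?A = "monoid_algebra M :: ('k::field, 'm \<Rightarrow>\<^sub>0 'k) module"
  have closed: "p \<otimes>\<^bsub>?A\<^esub> q \<in> carrier ?A" if "p \<in> carrier ?A" "q \<in> carrier ?A" for p q
  proof -
    have "Poly_Mapping.keys p \<subseteq> carrier M" "Poly_Mapping.keys q \<subseteq> carrier M"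
      using that by (auto simp: monoid_algebra_simps)
    then have "Poly_Mapping.keys (p \<otimes>\<^bsub>?A\<^esub> q) \<subseteq> carrier M"
    proof (induction p rule: poly_mapping_span_induct)
      case (single a t)
      from single(2) show ?case
        by (induction q rule: poly_mapping_span_induct)
          (use single in \<open>simp_all add: monoid_algebra_mult_add_right keys_add_subset\<close>)
    qed (simp_all add: monoid_algebra_mult_add_left keys_add_subset)
    then show ?thesis by (simp add: monoid_algebra_simps)
  qed
  have assoc: "p \<otimes>\<^bsub>?A\<^esub> q \<otimes>\<^bsub>?A\<^esub> r = p \<otimes>\<^bsub>?A\<^esub> (q \<otimes>\<^bsub>?A\<^esub> r)"
    if "p \<in> carrier ?A" "q \<in> carrier ?A" "r \<in> carrier ?A" for p q r
  proof -
    have "Poly_Mapping.keys p \<subseteq> carrier M" "Poly_Mapping.keys q \<subseteq> carrier M"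
      "Poly_Mapping.keys r \<subseteq> carrier M"
      using that by (auto simp: monoid_algebra_simps)
    then show ?thesis
    proof (induction p rule: poly_mapping_span_induct)
      case p: (single a s)
      from p(2) show ?case
      proof (induction q rule: poly_mapping_span_induct)
        case q: (single b t)
        from \<open>Poly_Mapping.keys r \<subseteq> carrier M\<close> show ?case
          by (induction r rule: poly_mapping_span_induct)
            (use p q in \<open>auto simp: monoid_algebra_mult_add_right M.m_assoc mult_ac\<close>)
      qed (auto simp: monoid_algebra_mult_add_right monoid_algebra_mult_add_left)
    qed (auto simp: monoid_algebra_mult_add_left)
  qed
  have one: "\<one>\<^bsub>?A\<^esub> \<otimes>\<^bsub>?A\<^esub> p = p \<and> p \<otimes>\<^bsub>?A\<^esub> \<one>\<^bsub>?A\<^esub> = p" if "p \<in> carrier ?A" for p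
  proof -
    have "Poly_Mapping.keys p \<subseteq> carrier M"
      using that by (auto simp: monoid_algebra_simps)
    then show ?thesis
      by (induction p rule: poly_mapping_span_induct)
        (auto simp: monoid_algebra_simps monoid_algebra_mult_add_left monoid_algebra_mult_add_right)
  qed
  have "ring ?A"
  proof (rule ringI)
    show "abelian_group ?A"
    proof (rule abelian_groupI)
      fix p assume "p \<in> carrier ?A"
      then show "\<exists>q\<in>carrier ?A. q \<oplus>\<^bsub>?A\<^esub> p = \<zero>\<^bsub>?A\<^esub>"
        by (intro bexI[of _ "- p"]) (auto simp: monoid_algebra_simps in_keys_iff subset_iff)
    qed (auto simp: monoid_algebra_simps keys_add_subset add_ac intro!: keys_add_subset)
    show "Group.monoid ?A"
      by (rule monoidI) (use closed assoc one in \<open>auto simp: monoid_algebra_simps(1,2)\<close>)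
  qed (simp_all add: monoid_algebra_simps monoid_algebra_mult_add_left monoid_algebra_mult_add_right)
  then interpret ring ?A .
  show ?thesis
  proof unfold_locales
    fix p :: "'m \<Rightarrow>\<^sub>0 'k" and s t :: 'k
    show "(s + t) \<odot>\<^bsub>?A\<^esub> p = s \<odot>\<^bsub>?A\<^esub> p \<oplus>\<^bsub>?A\<^esub> t \<odot>\<^bsub>?A\<^esub> p"
      by (rule poly_mapping_eqI)
        (simp add: lookup_monoid_algebra_smult lookup_add monoid_algebra_simps distrib_right)
    show "s \<odot>\<^bsub>?A\<^esub> (t \<odot>\<^bsub>?A\<^esub> p) = (s * t) \<odot>\<^bsub>?A\<^esub> p"
      by (rule poly_mapping_eqI) (simp add: lookup_monoid_algebra_smult)
    show "1 \<odot>\<^bsub>?A\<^esub> p = p"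
      by (rule poly_mapping_eqI) (simp add: lookup_monoid_algebra_smult)
  qed (auto simp: monoid_algebra_simps keys_smult_subset monoid_algebra_smult_add
      monoid_algebra_smult_mult subset_iff dest: subsetD[OF keys_smult_subset[OF subset_refl]])
qed

lemma monoid_algebra_minus:
  fixes p q :: "'m \<Rightarrow>\<^sub>0 'k::field"
  assumes "monoid M" "p \<in> carrier (monoid_algebra M)" "q \<in> carrier (monoid_algebra M)"
  shows "p - q = p \<ominus>\<^bsub>monoid_algebra M\<^esub> q"
proof -
  interpret A: k_algebra "monoid_algebra M :: ('k::field, 'm \<Rightarrow>\<^sub>0 'k) module"
    using assms by (intro monoid_algebra_k_algebra)
  have "(p \<ominus>\<^bsub>monoid_algebra M\<^esub> q) + q = p"
    using A.ring_simprules assms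
    by (metis A.add.inv_solve_right a_minus_def assms A.minus_closed monoid_algebra_simps(4))
  then show ?thesis by (metis add_diff_cancel_right')
qed

lemma (in k_algebra) linear_extension_superset:
  assumes "finite S" "Poly_Mapping.keys p \<subseteq> S" "f \<in> S \<rightarrow> carrier A"
  shows "linear_extension A f p = (\<Oplus>m\<in>S. Poly_Mapping.lookup p m \<odot> f m)"
  unfolding linear_extension_def using assms
  by (intro add.finprod_mono_neutral_cong_left) (auto simp: in_keys_iff Pi_iff)

lemma (in k_algebra) linear_extension_single [simp]:
  assumes "f m \<in> carrier A"
  shows "linear_extension A f (Poly_Mapping.single m s) = s \<odot> f m"
  by (subst linear_extension_superset[of "{m}"]) (use assms in auto)

lemma (in k_algebra) linear_extension_lin_map:
  assumes f: "f \<in> carrier M \<rightarrow> carrier A"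
  shows "linear_extension A f \<in> lin_map (monoid_algebra M) A"
proof (rule lin_mapI)
  fix p q :: "'b \<Rightarrow>\<^sub>0 'k" and s :: 'k
  assume "p \<in> carrier (monoid_algebra M)"
  then have p: "Poly_Mapping.keys p \<subseteq> carrier M" by (simp add: monoid_algebra_simps)
  then have fp: "f \<in> Poly_Mapping.keys p \<rightarrow> carrier A" using f by auto
  show "linear_extension A f p \<in> carrier A"
    unfolding linear_extension_def by (rule finsum_closed) (use fp in \<open>auto simp: Pi_iff\<close>)
  have "linear_extension A f (s \<odot>\<^bsub>monoid_algebra M\<^esub> p) =
      (\<Oplus>m\<in>Poly_Mapping.keys p. s \<odot> (Poly_Mapping.lookup p m \<odot> f m))"
  proof (subst linear_extension_superset[of "Poly_Mapping.keys p"])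
    show "(\<Oplus>m\<in>Poly_Mapping.keys p. Poly_Mapping.lookup (s \<odot>\<^bsub>monoid_algebra M\<^esub> p) m \<odot> f m) =
        (\<Oplus>m\<in>Poly_Mapping.keys p. s \<odot> (Poly_Mapping.lookup p m \<odot> f m))"
      by (rule finsum_cong') (use fp in \<open>auto simp: lookup_monoid_algebra_smult Pi_iff\<close>)
  qed (use fp in \<open>auto simp: keys_smult_subset\<close>)
  also have "\<dots> = s \<odot> (\<Oplus>m\<in>Poly_Mapping.keys p. Poly_Mapping.lookup p m \<odot> f m)"
    by (rule lin_map_finsum[symmetric, where h = "\<lambda>a. s \<odot> a" and A = A])
      (use fp k_algebra_axioms in \<open>auto intro!: lin_mapI simp: smult_add_right mult.commute Pi_iff\<close>)
  finally show "linear_extension A f (s \<odot>\<^bsub>monoid_algebra M\<^esub> p) = s \<odot> linear_extension A f p"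
    by (simp add: linear_extension_def)
  assume "q \<in> carrier (monoid_algebra M)"
  then have q: "Poly_Mapping.keys q \<subseteq> carrier M" by (simp add: monoid_algebra_simps)
  let ?S = "Poly_Mapping.keys p \<union> Poly_Mapping.keys q"
  have fS: "f \<in> ?S \<rightarrow> carrier A" using f p q by auto
  then have "linear_extension A f (p + q) =
      (\<Oplus>m\<in>?S. Poly_Mapping.lookup p m \<odot> f m \<oplus> Poly_Mapping.lookup q m \<odot> f m)"
  proof (subst linear_extension_superset[of ?S])
    show "(\<Oplus>m\<in>?S. Poly_Mapping.lookup (p + q) m \<odot> f m) =
        (\<Oplus>m\<in>?S. Poly_Mapping.lookup p m \<odot> f m \<oplus> Poly_Mapping.lookup q m \<odot> f m)"
      by (rule finsum_cong') (use fS in \<open>auto simp: lookup_add smult_add_left Pi_iff\<close>)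
  qed (use fS Poly_Mapping.keys_add[of p q] in auto)
  also have "\<dots> = linear_extension A f p \<oplus> linear_extension A f q"
  proof -
    have "linear_extension A f p = (\<Oplus>m\<in>?S. Poly_Mapping.lookup p m \<odot> f m)"
      "linear_extension A f q = (\<Oplus>m\<in>?S. Poly_Mapping.lookup q m \<odot> f m)"
      by (rule linear_extension_superset; use fS in auto)+
    then show ?thesis
      by (simp only:) (rule finsum_addf; use fS in \<open>auto simp: Pi_iff\<close>)
  qed
  finally show "linear_extension A f (p \<oplus>\<^bsub>monoid_algebra M\<^esub> q) =
      linear_extension A f p \<oplus> linear_extension A f q"
    by (simp add: monoid_algebra_simps)
qed

text \<open>The universal property of the monoid algebra: both sides of multiplicativity are bilinear, and on monomials
they agree because \<open>f\<close> is multiplicative.\<close>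

lemma (in k_algebra) linear_extension_alg_hom:
  assumes "monoid M" and f: "f \<in> hom M A" and "f \<one>\<^bsub>M\<^esub> = \<one>"
  shows "linear_extension A f \<in> alg_hom (monoid_algebra M) A"
proof -
  interpret M: monoid M by fact
  let ?L = "linear_extension A f"
  let ?F = "monoid_algebra M :: ('k, _) module"
  have fc: "f \<in> carrier M \<rightarrow> carrier A" using f by (auto simp: hom_def)
  then have fcl: "f m \<in> carrier A" if "m \<in> carrier M" for m using that by auto
  have lin: "?L \<in> lin_map ?F A" using fc by (rule linear_extension_lin_map)
  have add: "?L (p + q) = ?L p \<oplus> ?L q" if "Poly_Mapping.keys p \<subseteq> carrier M" "Poly_Mapping.keys q \<subseteq> carrier M" for p q
    using lin_map_add[OF lin, of p q] that by (simp add: monoid_algebra_simps)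
  have cl: "?L p \<in> carrier A" if "Poly_Mapping.keys p \<subseteq> carrier M" for p
    using lin_map_closed[OF lin, of p] that by (simp add: monoid_algebra_simps)
  have mcl: "Poly_Mapping.keys (p \<otimes>\<^bsub>?F\<^esub> q) \<subseteq> carrier M"
    if "Poly_Mapping.keys p \<subseteq> carrier M" "Poly_Mapping.keys q \<subseteq> carrier M" for p q
  proof -
    interpret F: k_algebra ?F by (rule monoid_algebra_k_algebra) fact
    show ?thesis using F.m_closed[of p q] that by (simp add: monoid_algebra_simps)
  qed
  have zero: "?L 0 = \<zero>" by (simp add: linear_extension_def)
  show ?thesis
  proof (rule alg_homI[OF lin])
    fix p q :: "'b \<Rightarrow>\<^sub>0 'k"
    assume "p \<in> carrier ?F" "q \<in> carrier ?F"
    then have "Poly_Mapping.keys p \<subseteq> carrier M" and q: "Poly_Mapping.keys q \<subseteq> carrier M"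
      by (simp_all add: monoid_algebra_simps)
    then show "?L (p \<otimes>\<^bsub>?F\<^esub> q) = ?L p \<otimes> ?L q"
    proof (induction p rule: poly_mapping_span_induct)
      case p: (single a s)
      from q show ?case
        by (induction q rule: poly_mapping_span_induct)
          (use p f in \<open>auto simp: fcl cl mcl add monoid_algebra_mult_add_right r_distr zero hom_def mult_ac\<close>)
    qed (auto simp: zero cl mcl add monoid_algebra_mult_add_left l_distr)
  next
    show "?L \<one>\<^bsub>?F\<^esub> = \<one>" using assms by (simp add: monoid_algebra_simps)
  qed
qed

section \<open>Quotient algebras\<close>

lemma quotient_algebra_simps:
  "carrier (quotient_algebra A I) = carrier (A Quot I)"
  "\<one>\<^bsub>quotient_algebra A I\<^esub> = I +>\<^bsub>A\<^esub> \<one>\<^bsub>A\<^esub>"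
  "\<zero>\<^bsub>quotient_algebra A I\<^esub> = I"
  "(\<odot>\<^bsub>quotient_algebra A I\<^esub>) = (\<lambda>s. induced_map (\<lambda>a. I +>\<^bsub>A\<^esub> (s \<odot>\<^bsub>A\<^esub> a)))"
  by (simp_all add: quotient_algebra_def FactRing_def)

lemma quotient_algebra_carrierE:
  assumes "C \<in> carrier (quotient_algebra A I)"
  obtains a where "a \<in> carrier A" "C = I +>\<^bsub>A\<^esub> a"
  using assms by (auto simp: quotient_algebra_def FactRing_def A_RCOSETS_def')

lemma coset_mem_quotient_algebra:
  "a \<in> carrier A \<Longrightarrow> I +>\<^bsub>A\<^esub> a \<in> carrier (quotient_algebra A I)"
  by (auto simp: quotient_algebra_def FactRing_def A_RCOSETS_def')

lemma (in ideal) induced_map_coset: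
  assumes "a \<in> carrier R" and "\<And>b. b \<in> I +> a \<Longrightarrow> h b = h a"
  shows "induced_map h (I +> a) = h a"
proof -
  have "a \<in> I +> a" using assms(1) by (rule a_rcos_self)
  then have "h ` (I +> a) = {h a}" using assms(2) by blast
  then show ?thesis by (simp add: induced_map_def)
qed

lemma lin_map_const_on_coset:
  assumes h: "h \<in> lin_map A B" and B: "k_algebra B" and I: "ideal I A"
    and "\<And>i. i \<in> I \<Longrightarrow> h i = \<zero>\<^bsub>B\<^esub>" and a: "a \<in> carrier A" and "b \<in> I +>\<^bsub>A\<^esub> a"
  shows "h b = h a"
proof -
  interpret ideal I A by fact
  interpret B: k_algebra B by fact
  obtain i where "i \<in> I" "b = i \<oplus>\<^bsub>A\<^esub> a"
    using assms(6) by (auto simp: a_r_coset_def')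
  then show ?thesis
    using assms by (simp add: lin_map_add[OF h] Icarr lin_map_closed[OF h])
qed

lemma induced_map_lin_coset:
  assumes "h \<in> lin_map A B" "k_algebra B" "ideal I A"
    and "\<And>i. i \<in> I \<Longrightarrow> h i = \<zero>\<^bsub>B\<^esub>" and "a \<in> carrier A"
  shows "induced_map h (I +>\<^bsub>A\<^esub> a) = h a"
  using lin_map_const_on_coset[OF assms(1-4)] assms(5)
  by (intro ideal.induced_map_coset[OF assms(3)]) blast+

lemma (in k_algebra) ideal_smult:
  assumes "ideal I A" and "i \<in> I"
  shows "s \<odot> i \<in> I"
proof -
  interpret ideal I A by fact
  have "s \<odot> i = (s \<odot> \<one>) \<otimes> i" using assms by (simp add: Icarr)
  also have "\<dots> \<in> I" using assms(2) by (rule I_l_closed) simp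
  finally show ?thesis .
qed

lemma (in k_algebra) smult_coset:
  assumes I: "ideal I A" and a: "a \<in> carrier A"
  shows "s \<odot>\<^bsub>quotient_algebra A I\<^esub> (I +> a) = I +> (s \<odot> a)"
proof -
  interpret ideal I A by fact
  have "I +> (s \<odot> b) = I +> (s \<odot> a)" if b: "b \<in> I +> a" for b
  proof -
    obtain i where "i \<in> I" "b = i \<oplus> a"
      using b by (auto simp: a_r_coset_def')
    then have "s \<odot> b = s \<odot> i \<oplus> s \<odot> a" "s \<odot> i \<in> I"
      using a I by (simp_all add: Icarr smult_add_right ideal_smult)
    then have "s \<odot> b \<in> I +> (s \<odot> a)" by (auto simp: a_r_coset_def')
    then show ?thesis using a by (intro a_repr_independence'[symmetric]) auto
  qed
  then show ?thesis
    unfolding quotient_algebra_simps by (intro induced_map_coset a)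
qed

lemma (in k_algebra) coset_mult:
  assumes "ideal I A" "a \<in> carrier A" "b \<in> carrier A"
  shows "(I +> a) \<otimes>\<^bsub>quotient_algebra A I\<^esub> (I +> b) = I +> (a \<otimes> b)"
  using ideal.rcoset_mult_add[OF assms] by (simp add: quotient_algebra_def FactRing_def)

lemma (in k_algebra) coset_add:
  assumes "ideal I A" "a \<in> carrier A" "b \<in> carrier A"
  shows "(I +> a) \<oplus>\<^bsub>quotient_algebra A I\<^esub> (I +> b) = I +> (a \<oplus> b)"
  using ideal.a_rcos_sum[OF assms] by (simp add: quotient_algebra_def FactRing_def)

lemma (in k_algebra) quotient_k_algebra:
  assumes I: "ideal I A"
  shows "k_algebra (quotient_algebra A I)"
proof -
  let ?Q = "quotient_algebra A I"
  interpret I: ideal I A by fact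
  interpret R: ring "A Quot I" by (rule I.quotient_is_ring)
  have "ring ?Q"
  proof (rule ringI)
    show "abelian_group ?Q"
    proof (rule abelian_groupI)
      fix C assume "C \<in> carrier ?Q"
      then show "\<exists>D\<in>carrier ?Q. D \<oplus>\<^bsub>?Q\<^esub> C = \<zero>\<^bsub>?Q\<^esub>"
        by (intro bexI[of _ "\<ominus>\<^bsub>A Quot I\<^esub> C"]) (simp_all add: quotient_algebra_def R.l_neg)
    qed (simp_all add: quotient_algebra_def R.a_ac)
    show "Group.monoid ?Q"
      by (rule monoidI) (simp_all add: quotient_algebra_def R.m_assoc)
  qed (simp_all add: quotient_algebra_def R.l_distr R.r_distr)
  then interpret Q: ring ?Q .
  show ?thesis
  proof unfold_locales
    fix C D s t
    assume "C \<in> carrier ?Q"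
    then obtain a where a: "a \<in> carrier A" and C: "C = I +> a"
      by (rule quotient_algebra_carrierE)
    show "s \<odot>\<^bsub>?Q\<^esub> C \<in> carrier ?Q"
      using a by (simp add: C smult_coset[OF I] coset_mem_quotient_algebra)
    show "(s + t) \<odot>\<^bsub>?Q\<^esub> C = s \<odot>\<^bsub>?Q\<^esub> C \<oplus>\<^bsub>?Q\<^esub> t \<odot>\<^bsub>?Q\<^esub> C"
      using a by (simp add: C smult_coset[OF I] coset_add[OF I] smult_add_left)
    show "s \<odot>\<^bsub>?Q\<^esub> (t \<odot>\<^bsub>?Q\<^esub> C) = (s * t) \<odot>\<^bsub>?Q\<^esub> C"
      using a by (simp add: C smult_coset[OF I])
    show "1 \<odot>\<^bsub>?Q\<^esub> C = C"
      using a by (simp add: C smult_coset[OF I])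
    assume "D \<in> carrier ?Q"
    then obtain b where b: "b \<in> carrier A" and D: "D = I +> b"
      by (rule quotient_algebra_carrierE)
    show "s \<odot>\<^bsub>?Q\<^esub> (C \<oplus>\<^bsub>?Q\<^esub> D) = s \<odot>\<^bsub>?Q\<^esub> C \<oplus>\<^bsub>?Q\<^esub> s \<odot>\<^bsub>?Q\<^esub> D"
      using a b by (simp add: C D smult_coset[OF I] coset_add[OF I] smult_add_right)
    show "(s \<odot>\<^bsub>?Q\<^esub> C) \<otimes>\<^bsub>?Q\<^esub> D = s \<odot>\<^bsub>?Q\<^esub> (C \<otimes>\<^bsub>?Q\<^esub> D)"
      using a b by (simp add: C D smult_coset[OF I] coset_mult[OF I])
    show "C \<otimes>\<^bsub>?Q\<^esub> (s \<odot>\<^bsub>?Q\<^esub> D) = s \<odot>\<^bsub>?Q\<^esub> (C \<otimes>\<^bsub>?Q\<^esub> D)"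
      using a b by (simp add: C D smult_coset[OF I] coset_mult[OF I])
  qed
qed

lemma (in k_algebra) coset_alg_hom:
  assumes "ideal I A"
  shows "(\<lambda>a. I +> a) \<in> alg_hom A (quotient_algebra A I)"
  using assms
  by (intro alg_homI lin_mapI)
    (simp_all add: coset_mult coset_add smult_coset coset_mem_quotient_algebra quotient_algebra_simps(2))

lemma induced_map_lin_map:
  assumes A: "k_algebra A" and h: "h \<in> lin_map A B" and B: "k_algebra B" and I: "ideal I A"
    and 0: "\<And>i. i \<in> I \<Longrightarrow> h i = \<zero>\<^bsub>B\<^esub>"
  shows "induced_map h \<in> lin_map (quotient_algebra A I) B"
proof -
  interpret A: k_algebra A by fact
  note [simp] = induced_map_lin_coset[OF h B I 0] A.smult_coset[OF I] A.coset_add[OF I] lin_mapD[OF h]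
  show ?thesis
    by (rule lin_mapI) (auto elim!: quotient_algebra_carrierE)
qed

lemma induced_map_alg_hom:
  assumes A: "k_algebra A" and h: "h \<in> alg_hom A B" and B: "k_algebra B" and I: "ideal I A"
    and 0: "\<And>i. i \<in> I \<Longrightarrow> h i = \<zero>\<^bsub>B\<^esub>"
  shows "induced_map h \<in> alg_hom (quotient_algebra A I) B"
proof -
  interpret A: k_algebra A by fact
  note ind = induced_map_lin_coset[OF alg_hom_lin[OF h] B I 0]
  show ?thesis
    by (rule alg_homI[OF induced_map_lin_map[OF A alg_hom_lin[OF h] B I 0]])
      (auto elim!: quotient_algebra_carrierE simp: A.coset_mult[OF I] ind alg_homD[OF h] quotient_algebra_simps(2))
qed

lemma alg_hom_kills_genideal:
  assumes A: "k_algebra A" and h: "h \<in> alg_hom A B" and B: "k_algebra B" and "R \<subseteq> carrier A"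
    and "\<And>r. r \<in> R \<Longrightarrow> h r = \<zero>\<^bsub>B\<^esub>" and "p \<in> genideal A R"
  shows "h p = \<zero>\<^bsub>B\<^esub>"
proof -
  have "R \<subseteq> {a \<in> carrier A. h a = \<zero>\<^bsub>B\<^esub>}" using assms by auto
  then have "genideal A R \<subseteq> {a \<in> carrier A. h a = \<zero>\<^bsub>B\<^esub>}"
    using ring.genideal_minimal[OF k_algebra.axioms(1)[OF A] alg_hom_kernel_ideal[OF h A B]] by blast
  then show ?thesis using assms(6) by blast
qed

text \<open>For a merely linear \<open>h\<close>, the kernel need not be an ideal, but the elements \<open>a\<close> such that \<open>h (u a v) = 0\<close> for
all \<open>u, v\<close> do form one. This lets functionals, which are not multiplicative, descend to quotients
that are given by generators of the ideal.\<close>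

lemma lin_map_kills_genideal:
  assumes A: "k_algebra A" and h: "h \<in> lin_map A B" and B: "k_algebra B" and R: "R \<subseteq> carrier A"
    and 0: "\<And>u r v. \<lbrakk>u \<in> carrier A; r \<in> R; v \<in> carrier A\<rbrakk> \<Longrightarrow> h (u \<otimes>\<^bsub>A\<^esub> r \<otimes>\<^bsub>A\<^esub> v) = \<zero>\<^bsub>B\<^esub>"
    and p: "p \<in> genideal A R"
  shows "h p = \<zero>\<^bsub>B\<^esub>"
proof -
  interpret A: k_algebra A by fact
  interpret B: k_algebra B by fact
  let ?J = "{a \<in> carrier A. \<forall>u\<in>carrier A. \<forall>v\<in>carrier A. h (u \<otimes>\<^bsub>A\<^esub> a \<otimes>\<^bsub>A\<^esub> v) = \<zero>\<^bsub>B\<^esub>}"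
  have "ideal ?J A"
  proof (rule idealI[OF A.ring_axioms])
    show "subgroup ?J (add_monoid A)"
    proof (rule A.add.subgroupI)
      have "\<zero>\<^bsub>A\<^esub> \<in> ?J" by (simp add: lin_map_zero[OF h A B])
      then show "?J \<noteq> {}" by blast
    next
      fix a assume "a \<in> ?J"
      then show "\<ominus>\<^bsub>A\<^esub> a \<in> ?J"
        by (auto simp: A.minus_eq_smult lin_map_smult[OF h])
    next
      fix a b assume "a \<in> ?J" "b \<in> ?J"
      then show "a \<oplus>\<^bsub>A\<^esub> b \<in> ?J"
        by (auto simp: A.r_distr A.l_distr lin_map_add[OF h])
    qed auto
  next
    fix a x assume "a \<in> ?J" "x \<in> carrier A"
    then show "x \<otimes>\<^bsub>A\<^esub> a \<in> ?J" by (simp flip: A.m_assoc)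
  next
    fix a x assume ax: "a \<in> ?J" "x \<in> carrier A"
    have "u \<otimes>\<^bsub>A\<^esub> (a \<otimes>\<^bsub>A\<^esub> x) \<otimes>\<^bsub>A\<^esub> v = u \<otimes>\<^bsub>A\<^esub> a \<otimes>\<^bsub>A\<^esub> (x \<otimes>\<^bsub>A\<^esub> v)" if "u \<in> carrier A" "v \<in> carrier A" for u v
      using that ax by (simp add: A.m_assoc)
    then show "a \<otimes>\<^bsub>A\<^esub> x \<in> ?J" using ax by simp
  qed
  moreover have "R \<subseteq> ?J" using R 0 by auto
  ultimately have "p \<in> ?J" using A.genideal_minimal p by blast
  then have "h (\<one>\<^bsub>A\<^esub> \<otimes>\<^bsub>A\<^esub> p \<otimes>\<^bsub>A\<^esub> \<one>\<^bsub>A\<^esub>) = \<zero>\<^bsub>B\<^esub>" by blast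
  then show ?thesis using \<open>p \<in> ?J\<close> by simp
qed

lemma monoid_algebra_lin_map_diff:
  assumes h: "h \<in> lin_map (monoid_algebra M) B" and "monoid M" and "k_algebra B"
    and "p \<in> carrier (monoid_algebra M)" "q \<in> carrier (monoid_algebra M)"
  shows "h (p - q) = h p \<ominus>\<^bsub>B\<^esub> h q"
  using assms
  by (simp add: monoid_algebra_minus lin_map_minus monoid_algebra_k_algebra)

lemma monoid_algebra_mult_diff:
  fixes p q r :: "'m \<Rightarrow>\<^sub>0 'k::field"
  shows "(p - q) \<otimes>\<^bsub>monoid_algebra M\<^esub> r = p \<otimes>\<^bsub>monoid_algebra M\<^esub> r - q \<otimes>\<^bsub>monoid_algebra M\<^esub> r"
    and "r \<otimes>\<^bsub>monoid_algebra M\<^esub> (p - q) = r \<otimes>\<^bsub>monoid_algebra M\<^esub> p - r \<otimes>\<^bsub>monoid_algebra M\<^esub> q"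
  using monoid_algebra_mult_add_left[where p = "p - q" and q = q and M = M and r = r]
    monoid_algebra_mult_add_right[where p = "p - q" and q = q and M = M and r = r]
  by simp_all

text \<open>By bilinearity, the factors \<open>u\<close> and \<open>v\<close> of \<open>lin_map_kills_genideal\<close> may be restricted to elements of the monoid.\<close>

lemma monoid_algebra_lin_map_kills_genideal:
  fixes B :: "('k::field, 'b, 'z) module_scheme" and M :: "('m, 'w) monoid_scheme"
  assumes M: "monoid M" and h: "h \<in> lin_map (monoid_algebra M) B" and B: "k_algebra B"
    and R: "R \<subseteq> carrier (monoid_algebra M)"
    and 0: "\<And>u r v. \<lbrakk>u \<in> carrier M; r \<in> R; v \<in> carrier M\<rbrakk> \<Longrightarrow>
      h (Poly_Mapping.single u 1 \<otimes>\<^bsub>monoid_algebra M\<^esub> r \<otimes>\<^bsub>monoid_algebra M\<^esub> Poly_Mapping.single v 1) = \<zero>\<^bsub>B\<^esub>"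
    and p: "p \<in> genideal (monoid_algebra M) R"
  shows "h p = \<zero>\<^bsub>B\<^esub>"
proof (rule lin_map_kills_genideal[OF _ h B R _ p])
  let ?F = "monoid_algebra M :: ('k, 'm \<Rightarrow>\<^sub>0 'k) module"
  show F: "k_algebra ?F" by (rule monoid_algebra_k_algebra[OF M])
  interpret F: k_algebra ?F by fact
  interpret B: k_algebra B by fact
  have h0: "h 0 = \<zero>\<^bsub>B\<^esub>" using lin_map_zero[OF h F B] by (simp add: monoid_algebra_simps)
  have h_add: "h (a + b) = h a \<oplus>\<^bsub>B\<^esub> h b" if "a \<in> carrier ?F" "b \<in> carrier ?F" for a b
    using lin_map_add[OF h that] by (simp add: monoid_algebra_simps)
  fix u r v assume "u \<in> carrier ?F" and r: "r \<in> R" and "v \<in> carrier ?F"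
  then have "Poly_Mapping.keys u \<subseteq> carrier M" and v: "Poly_Mapping.keys v \<subseteq> carrier M"
    by (auto simp: monoid_algebra_simps)
  note rc = subsetD[OF R r]
  have cc: "p \<in> carrier ?F" if "Poly_Mapping.keys p \<subseteq> carrier M" for p
    using that by (simp add: monoid_algebra_simps)
  have s1: "Poly_Mapping.single m s = s \<odot>\<^bsub>?F\<^esub> Poly_Mapping.single m 1" for m s by simp
  from \<open>Poly_Mapping.keys u \<subseteq> carrier M\<close> v
  show "h (u \<otimes>\<^bsub>?F\<^esub> r \<otimes>\<^bsub>?F\<^esub> v) = \<zero>\<^bsub>B\<^esub>"
  proof (induction u rule: poly_mapping_span_induct)
    case zero then show ?case by (simp add: h0)
  next
    case (add u u')
    then show ?case
      by (simp add: cc rc monoid_algebra_mult_add_left h_add)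
  next
    case u: (single m s)
    from v show ?case
    proof (induction v rule: poly_mapping_span_induct)
      case zero then show ?case by (simp add: h0)
    next
      case (add v v')
      with u show ?case
        by (simp add: cc rc monoid_algebra_mult_add_right h_add)
    next
      case (single m' s')
      let ?x = "Poly_Mapping.single m 1" and ?y = "Poly_Mapping.single m' 1"
      have x: "?x \<in> carrier ?F" "?y \<in> carrier ?F" using u single by auto
      have "Poly_Mapping.single m s \<otimes>\<^bsub>?F\<^esub> r \<otimes>\<^bsub>?F\<^esub> Poly_Mapping.single m' s' =
          (s * s') \<odot>\<^bsub>?F\<^esub> (?x \<otimes>\<^bsub>?F\<^esub> r \<otimes>\<^bsub>?F\<^esub> ?y)"
        unfolding s1[of m s] s1[of m' s'] using x rc
        by (simp del: monoid_algebra_smult_single add: mult.commute)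
      then show ?case
        using 0[OF u(1) r single(1)] x rc by (simp add: lin_map_smult[OF h])
    qed
  qed
qed

section \<open>Tensor products\<close>

locale tensor_product = A: k_algebra A + B: k_algebra B
  for A :: "('k::field, 'a, 'y) module_scheme" and B :: "('k, 'b, 'z) module_scheme"
begin

abbreviation "F \<equiv> monoid_algebra (A \<times>\<times> B) :: ('k, 'a \<times> 'b \<Rightarrow>\<^sub>0 'k) module"
abbreviation "T \<equiv> tensor_algebra A B"
abbreviation "I \<equiv> tensor_ideal A B"
abbreviation tensor (infixl "\<otimes>\<^sub>t" 66) where "a \<otimes>\<^sub>t b \<equiv> pure_tensor A B a b"

lemma monoid_AB: "monoid (A \<times>\<times> B)"
  by (rule DirProd_monoid) (rule A.monoid_axioms B.monoid_axioms)+

sublocale F: k_algebra F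
  by (rule monoid_algebra_k_algebra[OF monoid_AB])

lemma single_F: "a \<in> carrier A \<Longrightarrow> b \<in> carrier B \<Longrightarrow> Poly_Mapping.single (a, b) s \<in> carrier F"
  by (rule single_mem_monoid_algebra) simp

lemma diff_F: "p \<in> carrier F \<Longrightarrow> q \<in> carrier F \<Longrightarrow> p - q \<in> carrier F"
  by (simp add: monoid_algebra_minus[OF monoid_AB])

lemma add_F: "p \<in> carrier F \<Longrightarrow> q \<in> carrier F \<Longrightarrow> p + q \<in> carrier F"
  using F.a_closed by (simp add: monoid_algebra_simps(4))

lemma bilinear_relations_subset: "bilinear_relations A B \<subseteq> carrier F"
  unfolding bilinear_relations_def by (auto intro!: diff_F single_F)

lemma ideal_I: "ideal I F"
  unfolding tensor_ideal_def by (rule F.genideal_ideal[OF bilinear_relations_subset])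

lemma relation_mem_I: "r \<in> bilinear_relations A B \<Longrightarrow> r \<in> I"
  unfolding tensor_ideal_def using F.genideal_self[OF bilinear_relations_subset] by blast

sublocale T: k_algebra T
  unfolding tensor_algebra_def by (rule F.quotient_k_algebra[OF ideal_I])

lemma coset_eqI:
  assumes "p - q \<in> I" "p \<in> carrier F" "q \<in> carrier F"
  shows "I +>\<^bsub>F\<^esub> p = I +>\<^bsub>F\<^esub> q"
  using assms F.quotient_eq_iff_same_a_r_cos[OF ideal_I] monoid_algebra_minus[OF monoid_AB] by metis

lemma tensor_closed [simp]: "a \<in> carrier A \<Longrightarrow> b \<in> carrier B \<Longrightarrow> a \<otimes>\<^sub>t b \<in> carrier T"
  by (simp add: pure_tensor_def tensor_algebra_def coset_mem_quotient_algebra single_F)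

lemma coset_sum: "p \<in> carrier F \<Longrightarrow> q \<in> carrier F \<Longrightarrow> (I +>\<^bsub>F\<^esub> p) \<oplus>\<^bsub>T\<^esub> (I +>\<^bsub>F\<^esub> q) = I +>\<^bsub>F\<^esub> (p + q)"
  by (simp add: tensor_algebra_def F.coset_add[OF ideal_I] monoid_algebra_simps(4))

lemma tensor_add_left:
  assumes "a \<in> carrier A" "a' \<in> carrier A" "b \<in> carrier B"
  shows "(a \<oplus>\<^bsub>A\<^esub> a') \<otimes>\<^sub>t b = a \<otimes>\<^sub>t b \<oplus>\<^bsub>T\<^esub> a' \<otimes>\<^sub>t b"
proof -
  have "Poly_Mapping.single (a \<oplus>\<^bsub>A\<^esub> a', b) 1 - Poly_Mapping.single (a, b) 1 - Poly_Mapping.single (a', b) 1 \<in> bilinear_relations A B"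
    unfolding bilinear_relations_def using assms by blast
  then have "Poly_Mapping.single (a \<oplus>\<^bsub>A\<^esub> a', b) 1 - (Poly_Mapping.single (a, b) 1 + Poly_Mapping.single (a', b) 1) \<in> I"
    by (simp add: relation_mem_I diff_diff_eq)
  then have "I +>\<^bsub>F\<^esub> Poly_Mapping.single (a \<oplus>\<^bsub>A\<^esub> a', b) 1 = I +>\<^bsub>F\<^esub> (Poly_Mapping.single (a, b) 1 + Poly_Mapping.single (a', b) 1)"
    using assms by (intro coset_eqI) (simp_all add: single_F add_F)
  then show ?thesis
    using assms by (simp add: pure_tensor_def coset_sum single_F)
qed

lemma tensor_add_right:
  assumes "a \<in> carrier A" "b \<in> carrier B" "b' \<in> carrier B"
  shows "a \<otimes>\<^sub>t (b \<oplus>\<^bsub>B\<^esub> b') = a \<otimes>\<^sub>t b \<oplus>\<^bsub>T\<^esub> a \<otimes>\<^sub>t b'"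
proof -
  have "Poly_Mapping.single (a, b \<oplus>\<^bsub>B\<^esub> b') 1 - Poly_Mapping.single (a, b) 1 - Poly_Mapping.single (a, b') 1 \<in> bilinear_relations A B"
    unfolding bilinear_relations_def using assms by blast
  then have "Poly_Mapping.single (a, b \<oplus>\<^bsub>B\<^esub> b') 1 - (Poly_Mapping.single (a, b) 1 + Poly_Mapping.single (a, b') 1) \<in> I"
    by (simp add: relation_mem_I diff_diff_eq)
  then have "I +>\<^bsub>F\<^esub> Poly_Mapping.single (a, b \<oplus>\<^bsub>B\<^esub> b') 1 = I +>\<^bsub>F\<^esub> (Poly_Mapping.single (a, b) 1 + Poly_Mapping.single (a, b') 1)"
    using assms by (intro coset_eqI) (simp_all add: single_F add_F)
  then show ?thesis
    using assms by (simp add: pure_tensor_def coset_sum single_F)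
qed

lemma tensor_smult_left:
  assumes "a \<in> carrier A" "b \<in> carrier B"
  shows "(s \<odot>\<^bsub>A\<^esub> a) \<otimes>\<^sub>t b = s \<odot>\<^bsub>T\<^esub> (a \<otimes>\<^sub>t b)"
proof -
  have "s \<odot>\<^bsub>T\<^esub> (a \<otimes>\<^sub>t b) = I +>\<^bsub>F\<^esub> Poly_Mapping.single (a, b) s"
    unfolding pure_tensor_def tensor_algebra_def
    using assms by (subst F.smult_coset[OF ideal_I]) (auto intro: single_F)
  also have "\<dots> = I +>\<^bsub>F\<^esub> Poly_Mapping.single (s \<odot>\<^bsub>A\<^esub> a, b) 1"
  proof (rule coset_eqI[symmetric])
    show "Poly_Mapping.single (s \<odot>\<^bsub>A\<^esub> a, b) 1 - Poly_Mapping.single (a, b) s \<in> I"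
      by (rule relation_mem_I) (unfold bilinear_relations_def, use assms in blast)
  qed (use assms in \<open>simp_all add: single_F\<close>)
  finally show ?thesis by (simp add: pure_tensor_def)
qed

lemma tensor_smult_right:
  assumes "a \<in> carrier A" "b \<in> carrier B"
  shows "a \<otimes>\<^sub>t (s \<odot>\<^bsub>B\<^esub> b) = s \<odot>\<^bsub>T\<^esub> (a \<otimes>\<^sub>t b)"
proof -
  have "s \<odot>\<^bsub>T\<^esub> (a \<otimes>\<^sub>t b) = I +>\<^bsub>F\<^esub> Poly_Mapping.single (a, b) s"
    unfolding pure_tensor_def tensor_algebra_def
    using assms by (subst F.smult_coset[OF ideal_I]) (auto intro: single_F)
  also have "\<dots> = I +>\<^bsub>F\<^esub> Poly_Mapping.single (a, s \<odot>\<^bsub>B\<^esub> b) 1"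
  proof (rule coset_eqI[symmetric])
    show "Poly_Mapping.single (a, s \<odot>\<^bsub>B\<^esub> b) 1 - Poly_Mapping.single (a, b) s \<in> I"
      by (rule relation_mem_I) (unfold bilinear_relations_def, use assms in blast)
  qed (use assms in \<open>simp_all add: single_F\<close>)
  finally show ?thesis by (simp add: pure_tensor_def)
qed

lemma tensor_mult [simp]:
  assumes "a \<in> carrier A" "b \<in> carrier B" "c \<in> carrier A" "d \<in> carrier B"
  shows "(a \<otimes>\<^sub>t b) \<otimes>\<^bsub>T\<^esub> (c \<otimes>\<^sub>t d) = (a \<otimes>\<^bsub>A\<^esub> c) \<otimes>\<^sub>t (b \<otimes>\<^bsub>B\<^esub> d)"
  unfolding pure_tensor_def tensor_algebra_def
  using assms by (simp add: F.coset_mult[OF ideal_I] single_F)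

lemma tensor_one: "\<one>\<^bsub>A\<^esub> \<otimes>\<^sub>t \<one>\<^bsub>B\<^esub> = \<one>\<^bsub>T\<^esub>"
  by (simp add: pure_tensor_def tensor_algebra_def quotient_algebra_simps monoid_algebra_simps)

lemma tensor_pow:
  assumes "a \<in> carrier A" "b \<in> carrier B"
  shows "(a \<otimes>\<^sub>t b) [^]\<^bsub>T\<^esub> (m::nat) = (a [^]\<^bsub>A\<^esub> m) \<otimes>\<^sub>t (b [^]\<^bsub>B\<^esub> m)"
  by (induction m) (use assms in \<open>simp_all add: tensor_one\<close>)

text \<open>The functional \<open>f \<otimes> f'\<close> on \<open>A \<otimes> B\<close>; such functionals serve to compare coefficients of tensors.\<close>

definition functional_tensor :: "('a \<Rightarrow> 'k) \<Rightarrow> ('b \<Rightarrow> 'k) \<Rightarrow> ('a \<times> 'b \<Rightarrow>\<^sub>0 'k) set \<Rightarrow> 'k" where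
  "functional_tensor f f' = induced_map (linear_extension base_algebra (\<lambda>(a, b). f a * f' b))"

text \<open>Multiplying a bilinearity relation by \<open>(a, b)\<close> from the left and by \<open>(c, d)\<close> from the right gives a
bilinearity relation of the same kind, and \<open>(a, b) \<mapsto> f a * f' b\<close> respects these.\<close>

lemma functional_tensor:
  assumes f: "f \<in> lin_map A base_algebra" and f': "f' \<in> lin_map B base_algebra"
  shows functional_tensor_lin_map: "functional_tensor f f' \<in> lin_map T base_algebra"
    and functional_tensor_tensor:
      "\<And>a b. \<lbrakk>a \<in> carrier A; b \<in> carrier B\<rbrakk> \<Longrightarrow> functional_tensor f f' (a \<otimes>\<^sub>t b) = f a * f' b"
proof -
  interpret K: k_algebra "base_algebra :: ('k, 'k) module" by (rule base_algebra_k_algebra)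
  let ?L = "linear_extension base_algebra (\<lambda>(a, b). f a * f' b)"
  note f_simps = lin_mapD(2,3)[OF f, simplified] lin_mapD(2,3)[OF f', simplified]
  have L: "?L \<in> lin_map F base_algebra"
    by (rule K.linear_extension_lin_map) simp
  have L_single: "?L (Poly_Mapping.single (a, b) s) = s * (f a * f' b)" for a b s
    by (subst K.linear_extension_single) auto
  have L_diff: "?L (p - q) = ?L p - ?L q" if "p \<in> carrier F" "q \<in> carrier F" for p q
    using monoid_algebra_lin_map_diff[OF L monoid_AB K.k_algebra_axioms that]
    by (simp add: a_minus_def K.minus_eq_smult)
  have kills: "?L p = 0" if p: "p \<in> I" for p
  proof -
    have "?L p = \<zero>\<^bsub>base_algebra\<^esub>"
    proof (rule monoid_algebra_lin_map_kills_genideal[OF monoid_AB L K.k_algebra_axioms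
          bilinear_relations_subset _ p[unfolded tensor_ideal_def]])
      fix u r v
      assume uv: "u \<in> carrier (A \<times>\<times> B)" "v \<in> carrier (A \<times>\<times> B)" and r: "r \<in> bilinear_relations A B"
      obtain a b c d where u: "u = (a, b)" and v: "v = (c, d)" by (cases u, cases v)
      have abcd: "a \<in> carrier A" "b \<in> carrier B" "c \<in> carrier A" "d \<in> carrier B"
        using uv u v by auto
      show "?L (Poly_Mapping.single u 1 \<otimes>\<^bsub>F\<^esub> r \<otimes>\<^bsub>F\<^esub> Poly_Mapping.single v 1) = \<zero>\<^bsub>base_algebra\<^esub>"
        using r unfolding bilinear_relations_def u v
        by (elim UnE CollectE exE conjE; hypsubst; use abcd in \<open>simp add: monoid_algebra_mult_diff L_diff L_single
            single_F diff_F A.r_distr A.l_distr B.r_distr B.l_distr f_simps distrib_left distrib_right mult_ac\<close>)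
    qed
    then show ?thesis by simp
  qed
  show "functional_tensor f f' \<in> lin_map T base_algebra"
    unfolding functional_tensor_def tensor_algebra_def
    by (rule induced_map_lin_map[OF F.k_algebra_axioms L K.k_algebra_axioms ideal_I]) (simp add: kills)
  fix a b assume "a \<in> carrier A" "b \<in> carrier B"
  then show "functional_tensor f f' (a \<otimes>\<^sub>t b) = f a * f' b"
    unfolding functional_tensor_def pure_tensor_def
    by (subst induced_map_lin_coset[OF L K.k_algebra_axioms ideal_I])
      (simp_all add: kills single_F L_single)
qed

end

text \<open>The map \<open>(a, a') \<mapsto> h a \<otimes> h' a'\<close> is multiplicative, hence extends to an algebra homomorphism on the
monoid algebra, and bilinearity of the tensor product says that this extension kills the relations.\<close>

lemma tensor_map:
  assumes "k_algebra A" "k_algebra A'" "k_algebra B" "k_algebra B'"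
    and h: "h \<in> alg_hom A B" and h': "h' \<in> alg_hom A' B'"
  shows tensor_map_alg_hom:
      "tensor_map B B' h h' \<in> alg_hom (tensor_algebra A A') (tensor_algebra B B')"
    and tensor_map_tensor: "\<And>a a'. \<lbrakk>a \<in> carrier A; a' \<in> carrier A'\<rbrakk> \<Longrightarrow>
      tensor_map B B' h h' (pure_tensor A A' a a') = pure_tensor B B' (h a) (h' a')"
proof -
  interpret A: tensor_product A A' using assms by (simp add: tensor_product_def)
  interpret B: tensor_product B B' using assms by (simp add: tensor_product_def)
  let ?f = "\<lambda>(a, a'). pure_tensor B B' (h a) (h' a')"
  let ?L = "linear_extension B.T ?f"
  note [simp] = alg_homD(2-6)[OF h] alg_homD(2-6)[OF h']
  have f_hom: "?f \<in> hom (A \<times>\<times> A') B.T"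
    by (rule homI) auto
  have L: "?L \<in> alg_hom A.F B.T"
    by (rule B.T.linear_extension_alg_hom[OF A.monoid_AB f_hom]) (simp add: B.tensor_one)
  have L_single: "?L (Poly_Mapping.single (a, a') s) = s \<odot>\<^bsub>B.T\<^esub> pure_tensor B B' (h a) (h' a')"
    if "a \<in> carrier A" "a' \<in> carrier A'" for a a' s
    using that by (subst B.T.linear_extension_single) auto
  have L_diff: "?L (p - q) = ?L p \<ominus>\<^bsub>B.T\<^esub> ?L q" if "p \<in> carrier A.F" "q \<in> carrier A.F" for p q
    by (rule monoid_algebra_lin_map_diff[OF alg_hom_lin[OF L] A.monoid_AB B.T.k_algebra_axioms that])
  have cancel: "x \<oplus>\<^bsub>B.T\<^esub> y \<ominus>\<^bsub>B.T\<^esub> x \<ominus>\<^bsub>B.T\<^esub> y = \<zero>\<^bsub>B.T\<^esub>" "x \<ominus>\<^bsub>B.T\<^esub> x = \<zero>\<^bsub>B.T\<^esub>"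
    if "x \<in> carrier B.T" "y \<in> carrier B.T" for x y
  proof -
    have "x \<oplus>\<^bsub>B.T\<^esub> y \<ominus>\<^bsub>B.T\<^esub> x \<ominus>\<^bsub>B.T\<^esub> y = (x \<oplus>\<^bsub>B.T\<^esub> y) \<oplus>\<^bsub>B.T\<^esub> \<ominus>\<^bsub>B.T\<^esub> (x \<oplus>\<^bsub>B.T\<^esub> y)"
      using that by (simp add: a_minus_def B.T.a_assoc B.T.minus_add)
    then show "x \<oplus>\<^bsub>B.T\<^esub> y \<ominus>\<^bsub>B.T\<^esub> x \<ominus>\<^bsub>B.T\<^esub> y = \<zero>\<^bsub>B.T\<^esub>" "x \<ominus>\<^bsub>B.T\<^esub> x = \<zero>\<^bsub>B.T\<^esub>"
      using that by (simp_all add: B.T.r_neg a_minus_def)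
  qed
  have kills: "?L p = \<zero>\<^bsub>B.T\<^esub>" if p: "p \<in> A.I" for p
  proof (rule alg_hom_kills_genideal[OF A.F.k_algebra_axioms L B.T.k_algebra_axioms
        A.bilinear_relations_subset _ p[unfolded tensor_ideal_def]])
    fix r assume r: "r \<in> bilinear_relations A A'"
    show "?L r = \<zero>\<^bsub>B.T\<^esub>"
      using r unfolding bilinear_relations_def
      by (elim UnE CollectE exE conjE; simp add: L_diff L_single A.single_F A.diff_F
          B.tensor_add_left B.tensor_add_right B.tensor_smult_left B.tensor_smult_right cancel)
  qed
  show "tensor_map B B' h h' \<in> alg_hom A.T B.T"
    unfolding tensor_map_def tensor_algebra_def[of A A']
    by (rule induced_map_alg_hom[OF A.F.k_algebra_axioms L B.T.k_algebra_axioms A.ideal_I]) (rule kills)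
  fix a a' assume "a \<in> carrier A" "a' \<in> carrier A'"
  then show "tensor_map B B' h h' (pure_tensor A A' a a') = pure_tensor B B' (h a) (h' a')"
    unfolding tensor_map_def pure_tensor_def[of A A']
    by (subst induced_map_lin_coset[OF alg_hom_lin[OF L] B.T.k_algebra_axioms A.ideal_I])
      (simp_all add: kills A.single_F L_single)
qed

section \<open>The defining relations\<close>

text \<open>Triples of elements that satisfy the defining relations. By \<open>H4n_universal\<close> they amount to algebra homomorphisms
from \<open>H\<close> to \<open>A\<close>; besides \<open>A = H\<close> this is applied to the ground field (counit), the tensor square (comultiplication)
and the opposite algebra (antipode).\<close>

locale H4n_triple = k_algebra A for A :: "('k::field, 'a, 'z) module_scheme" (structure) +
  fixes n :: nat and \<omega> :: 'k and g x c :: 'a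
  assumes g_closed [simp]: "g \<in> carrier A" and x_closed [simp]: "x \<in> carrier A"
    and c_closed [simp]: "c \<in> carrier A"
    and g_g: "g \<otimes> g = \<one>" and c_pow_n: "c [^] n = \<one>" and x_x: "x \<otimes> x = \<zero>"
    and x_g: "x \<otimes> g \<oplus> g \<otimes> x = \<zero>" and c_g: "c \<otimes> g = g \<otimes> c" and c_x: "c \<otimes> x = \<omega> \<odot> (x \<otimes> c)"
begin

lemma g_x: "g \<otimes> x = (-1) \<odot> (x \<otimes> g)"
  using x_g by (metis add.inv_solve_left' g_closed l_neg m_closed minus_eq_smult minus_equality
      minus_minus x_closed)

definition gc :: "nat \<Rightarrow> nat \<Rightarrow> 'a" where
  "gc e i = g [^] e \<otimes> c [^] i"

lemma gc_closed [simp]: "gc e i \<in> carrier A"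
  by (simp add: gc_def)

lemma gc_zero [simp]: "gc 0 0 = \<one>"
  by (simp add: gc_def)

lemma gc_g: "gc (Suc 0) 0 = g"
  by (simp add: gc_def)

lemma gc_mult: "gc e i \<otimes> gc e' i' = gc (e + e') (i + i')"
proof -
  have comm: "c [^] i \<otimes> g [^] e' = g [^] e' \<otimes> c [^] i"
    by (metis c_closed c_g g_closed group_commutes_pow nat_pow_closed)
  have "gc e i \<otimes> gc e' i' = g [^] e \<otimes> (c [^] i \<otimes> g [^] e') \<otimes> c [^] i'"
    by (simp add: gc_def m_assoc)
  also have "\<dots> = (g [^] e \<otimes> g [^] e') \<otimes> (c [^] i \<otimes> c [^] i')"
    unfolding comm by (simp add: m_assoc)
  finally show ?thesis by (simp add: gc_def nat_pow_mult)
qed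

lemma gc_pow: "gc e i [^] m = gc (e * m) (i * m)"
  by (induction m) (simp_all add: gc_mult add.commute)

lemma gc_cong:
  assumes "e mod 2 = e' mod 2" "i mod n = i' mod n"
  shows "gc e i = gc e' i'"
proof -
  have g2: "g [^] (2 :: nat) = \<one>" by (simp add: numeral_2_eq_2 g_g)
  have g: "g [^] e = g [^] (e mod 2)" for e :: nat
  proof -
    have "g [^] e = (g [^] (2 :: nat)) [^] (e div 2) \<otimes> g [^] (e mod 2)"
      by (simp add: nat_pow_pow nat_pow_mult)
    then show ?thesis by (simp add: g2)
  qed
  have c: "c [^] i = c [^] (i mod n)" for i :: nat
  proof -
    have "c [^] i = (c [^] n) [^] (i div n) \<otimes> c [^] (i mod n)"
      by (simp add: nat_pow_pow nat_pow_mult)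
    then show ?thesis by (simp add: c_pow_n)
  qed
  show ?thesis unfolding gc_def using assms g[of e] g[of e'] c[of i] c[of i'] by simp
qed

lemma gc_x: "gc e i \<otimes> x = ((-1) ^ e * \<omega> ^ i) \<odot> (x \<otimes> gc e i)"
proof -
  have c: "c [^] i \<otimes> x = \<omega> ^ i \<odot> (x \<otimes> c [^] i)" for i :: nat
  proof (induction i)
    case (Suc i)
    have "c [^] Suc i \<otimes> x = c [^] i \<otimes> (c \<otimes> x)" by (simp add: m_assoc)
    also have "\<dots> = \<omega> \<odot> (c [^] i \<otimes> x \<otimes> c)" by (simp add: c_x m_assoc)
    finally show ?case by (simp add: Suc m_assoc)
  qed simp
  have g: "g [^] e \<otimes> x = (-1) ^ e \<odot> (x \<otimes> g [^] e)" for e :: nat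
  proof (induction e)
    case (Suc e)
    have "g [^] Suc e \<otimes> x = g [^] e \<otimes> (g \<otimes> x)" by (simp add: m_assoc)
    also have "\<dots> = (-1) \<odot> (g [^] e \<otimes> x \<otimes> g)" by (simp add: g_x m_assoc)
    finally show ?case by (simp add: Suc m_assoc)
  qed simp
  have "gc e i \<otimes> x = g [^] e \<otimes> (c [^] i \<otimes> x)" by (simp add: gc_def m_assoc)
  also have "\<dots> = \<omega> ^ i \<odot> (g [^] e \<otimes> x \<otimes> c [^] i)" by (simp add: c m_assoc)
  finally show ?thesis by (simp add: g gc_def m_assoc mult.commute)
qed

text \<open>The two conditions are what the relations for \<open>c\<close> become for \<open>g\<^sup>e c\<^sup>l\<close>: its \<open>n\<close>-th power is \<open>g\<close> to the power \<open>e n\<close>,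
and passing \<open>x\<close> through it costs the factor \<open>(-1)\<^sup>e \<omega>\<^sup>l\<close>.\<close>

lemma new_triple:
  assumes "even (e * n)" "(-1) ^ e * \<omega> ^ l = \<omega>"
  shows "H4n_triple A n \<omega> g (\<alpha> \<odot> x) (gc e l)"
proof unfold_locales
  show "gc e l [^] n = \<one>"
    using gc_cong[of "e * n" 0 "l * n" 0] assms(1) by (simp add: gc_pow)
  show "gc e l \<otimes> g = g \<otimes> gc e l"
    using gc_mult[of e l 1 0] gc_mult[of 1 0 e l] by (simp add: gc_g)
  show "gc e l \<otimes> (\<alpha> \<odot> x) = \<omega> \<odot> (\<alpha> \<odot> x \<otimes> gc e l)"
    using assms(2) by (simp add: gc_x mult.commute)
  show "\<alpha> \<odot> x \<otimes> g \<oplus> g \<otimes> (\<alpha> \<odot> x) = \<zero>"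
    using x_g by (simp flip: smult_add_right)
qed (simp_all add: g_g x_x)

end

section \<open>Presentation and universal property\<close>

lemma word_monoid: "monoid word_monoid"
  by (rule monoidI) (simp_all add: word_monoid_def)

lemma word_monoid_simps [simp]:
  "carrier word_monoid = UNIV" "u \<otimes>\<^bsub>word_monoid\<^esub> v = u @ v" "\<one>\<^bsub>word_monoid\<^esub> = []"
  by (simp_all add: word_monoid_def)

lemma free_algebra_k_algebra: "k_algebra (free_algebra :: ('k::field, gen list \<Rightarrow>\<^sub>0 'k) module)"
  unfolding free_algebra_def by (rule monoid_algebra_k_algebra[OF word_monoid])

lemma free_algebra_simps [simp]:
  "carrier free_algebra = UNIV"
  "\<one>\<^bsub>free_algebra\<^esub> = word []"
  "\<zero>\<^bsub>free_algebra\<^esub> = 0"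
  "p \<oplus>\<^bsub>free_algebra\<^esub> q = p + q"
  "s \<odot>\<^bsub>free_algebra\<^esub> Poly_Mapping.single w t = Poly_Mapping.single w (s * t)"
  "Poly_Mapping.single u s \<otimes>\<^bsub>free_algebra\<^esub> Poly_Mapping.single v t = Poly_Mapping.single (u @ v) (s * t)"
  by (auto simp: free_algebra_def monoid_algebra_simps)

lemma (in k_algebra) free_hom:
  fixes f :: "gen \<Rightarrow> 'a"
  assumes "\<And>u. f u \<in> carrier A"
  shows free_hom_alg_hom: "free_hom A f \<in> alg_hom free_algebra A"
    and free_hom_single: "\<And>w s. free_hom A f (Poly_Mapping.single w s) = s \<odot> foldr (\<lambda>u b. f u \<otimes> b) w \<one>"
proof -
  let ?m = "\<lambda>w. foldr (\<lambda>u b. f u \<otimes> b) w \<one>"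
  have cl: "?m w \<in> carrier A" for w
    by (induction w) (use assms in auto)
  have "?m (u @ v) = ?m u \<otimes> ?m v" for u v
    by (induction u) (use assms cl in \<open>simp_all add: m_assoc\<close>)
  then have hom: "?m \<in> hom word_monoid A"
    by (intro homI) (auto simp: cl)
  show "free_hom A f \<in> alg_hom free_algebra A"
    unfolding free_hom_def free_algebra_def
    by (rule linear_extension_alg_hom[OF word_monoid hom]) simp
  show "free_hom A f (Poly_Mapping.single w s) = s \<odot> ?m w" for w s
    unfolding free_hom_def by (rule linear_extension_single) (rule cl)
qed

lemma H4n_relations_subset: "H4n_relations n \<omega> \<subseteq> carrier free_algebra"
  by simp

lemma H4n_ideal_ideal: "ideal (H4n_ideal n \<omega>) free_algebra"
proof -
  interpret k_algebra free_algebra by (rule free_algebra_k_algebra)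
  show ?thesis unfolding H4n_ideal_def by (rule genideal_ideal) simp
qed

lemma H4n_algebra_k_algebra: "k_algebra (H4n_algebra n \<omega>)"
  unfolding H4n_algebra_def
  by (rule k_algebra.quotient_k_algebra[OF free_algebra_k_algebra H4n_ideal_ideal])

lemma H4n_class_alg_hom: "H4n_class n \<omega> \<in> alg_hom free_algebra (H4n_algebra n \<omega>)"
  unfolding H4n_algebra_def H4n_class_def[abs_def]
  by (rule k_algebra.coset_alg_hom[OF free_algebra_k_algebra H4n_ideal_ideal])

lemma H4n_carrierE:
  assumes "a \<in> carrier (H4n_algebra n \<omega>)"
  obtains p where "a = H4n_class n \<omega> p"
  using assms unfolding H4n_algebra_def H4n_class_def by (auto elim: quotient_algebra_carrierE)

lemma H4n_class_cong:
  assumes "p - q \<in> H4n_relations n \<omega>"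
  shows "H4n_class n \<omega> p = H4n_class n \<omega> q"
proof -
  interpret F: k_algebra free_algebra by (rule free_algebra_k_algebra)
  have "p \<ominus>\<^bsub>free_algebra\<^esub> q \<in> H4n_ideal n \<omega>"
    using F.genideal_self[of "H4n_relations n \<omega>"] assms
      monoid_algebra_minus[OF word_monoid, of p q]
    by (auto simp: H4n_ideal_def free_algebra_def monoid_algebra_simps)
  then show ?thesis
    using F.quotient_eq_iff_same_a_r_cos[OF H4n_ideal_ideal, of p q] by (simp add: H4n_class_def)
qed

lemma H4n_class_relation:
  assumes "p \<in> H4n_relations n \<omega>"
  shows "H4n_class n \<omega> p = \<zero>\<^bsub>H4n_algebra n \<omega>\<^esub>"
  using H4n_class_cong[of p 0 n \<omega>] assms
    lin_map_zero[OF alg_hom_lin[OF H4n_class_alg_hom] free_algebra_k_algebra H4n_algebra_k_algebra, of n \<omega>]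
  by simp

abbreviation H4n_gen :: "nat \<Rightarrow> 'k::field \<Rightarrow> gen \<Rightarrow> (gen list \<Rightarrow>\<^sub>0 'k) set" where
  "H4n_gen n \<omega> u \<equiv> H4n_class n \<omega> (word [u])"

lemma H4n_class_word_Cons:
  "H4n_class n \<omega> (word (u # w)) = H4n_gen n \<omega> u \<otimes>\<^bsub>H4n_algebra n \<omega>\<^esub> H4n_class n \<omega> (word w)"
  using alg_hom_mult[OF H4n_class_alg_hom, of "word [u]" "word w" n \<omega>] by simp

lemma H4n_class_word_append:
  "H4n_class n \<omega> (word (u @ w)) = H4n_class n \<omega> (word u) \<otimes>\<^bsub>H4n_algebra n \<omega>\<^esub> H4n_class n \<omega> (word w)"
  using alg_hom_mult[OF H4n_class_alg_hom, of "word u" "word w" n \<omega>] by simp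

lemma H4n_class_one: "H4n_class n \<omega> (word []) = \<one>\<^bsub>H4n_algebra n \<omega>\<^esub>"
  using alg_hom_one[OF H4n_class_alg_hom, of n \<omega>] by simp

lemma H4n_class_closed [simp]: "H4n_class n \<omega> p \<in> carrier (H4n_algebra n \<omega>)"
  by (rule alg_hom_closed[OF H4n_class_alg_hom]) simp

lemma H4n_class_single:
  "H4n_class n \<omega> (Poly_Mapping.single w s) = s \<odot>\<^bsub>H4n_algebra n \<omega>\<^esub> H4n_class n \<omega> (word w)"
  using alg_hom_smult[OF H4n_class_alg_hom, of "word w" n \<omega> s] by simp

lemma H4n_class_add:
  "H4n_class n \<omega> (p + q) = H4n_class n \<omega> p \<oplus>\<^bsub>H4n_algebra n \<omega>\<^esub> H4n_class n \<omega> q"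
  using alg_hom_add[OF H4n_class_alg_hom, of p q n \<omega>] by simp

lemma H4n_class_replicate:
  "H4n_class n \<omega> (word (replicate m u)) = H4n_gen n \<omega> u [^]\<^bsub>H4n_algebra n \<omega>\<^esub> m"
proof -
  interpret k_algebra "H4n_algebra n \<omega>" by (rule H4n_algebra_k_algebra)
  show ?thesis
  proof (induction m)
    case (Suc m)
    have "H4n_class n \<omega> (word (replicate (Suc m) u)) =
        H4n_class n \<omega> (word (replicate m u @ [u]))"
      by (simp add: replicate_append_same)
    then show ?case by (simp only: H4n_class_word_append Suc nat_pow_Suc)
  qed (simp add: H4n_class_one)
qed

lemma H4n_gen_triple:
  "H4n_triple (H4n_algebra n \<omega>) n \<omega> (H4n_gen n \<omega> GenG) (H4n_gen n \<omega> GenX) (H4n_gen n \<omega> GenC)"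
proof -
  let ?A = "H4n_algebra n \<omega>" and ?cl = "H4n_class n \<omega>"
  interpret k_algebra ?A by (rule H4n_algebra_k_algebra)
  have w2: "H4n_gen n \<omega> u \<otimes>\<^bsub>?A\<^esub> H4n_gen n \<omega> v = ?cl (word [u, v])" for u v
    by (subst H4n_class_word_Cons[of _ _ u "[v]"]) (rule refl)
  show ?thesis
  proof unfold_locales
    show "H4n_gen n \<omega> GenG \<otimes>\<^bsub>?A\<^esub> H4n_gen n \<omega> GenG = \<one>\<^bsub>?A\<^esub>"
      unfolding w2 H4n_class_one[symmetric] by (rule H4n_class_cong) (simp add: H4n_relations_def)
    show "H4n_gen n \<omega> GenC [^]\<^bsub>?A\<^esub> n = \<one>\<^bsub>?A\<^esub>"
      unfolding H4n_class_replicate[symmetric] H4n_class_one[symmetric]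
      by (rule H4n_class_cong) (simp add: H4n_relations_def)
    show "H4n_gen n \<omega> GenX \<otimes>\<^bsub>?A\<^esub> H4n_gen n \<omega> GenX = \<zero>\<^bsub>?A\<^esub>"
      unfolding w2 by (rule H4n_class_relation) (simp add: H4n_relations_def)
    show "H4n_gen n \<omega> GenX \<otimes>\<^bsub>?A\<^esub> H4n_gen n \<omega> GenG \<oplus>\<^bsub>?A\<^esub>
        H4n_gen n \<omega> GenG \<otimes>\<^bsub>?A\<^esub> H4n_gen n \<omega> GenX = \<zero>\<^bsub>?A\<^esub>"
      unfolding w2 H4n_class_add[symmetric] by (rule H4n_class_relation) (simp add: H4n_relations_def)
    show "H4n_gen n \<omega> GenC \<otimes>\<^bsub>?A\<^esub> H4n_gen n \<omega> GenG = H4n_gen n \<omega> GenG \<otimes>\<^bsub>?A\<^esub> H4n_gen n \<omega> GenC"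
      unfolding w2 by (rule H4n_class_cong) (simp add: H4n_relations_def)
    show "H4n_gen n \<omega> GenC \<otimes>\<^bsub>?A\<^esub> H4n_gen n \<omega> GenX = \<omega> \<odot>\<^bsub>?A\<^esub> (H4n_gen n \<omega> GenX \<otimes>\<^bsub>?A\<^esub> H4n_gen n \<omega> GenC)"
      unfolding w2 H4n_class_single[symmetric] by (rule H4n_class_cong) (simp add: H4n_relations_def)
  qed simp_all
qed

text \<open>The universal property of the presentation: the lift to the free algebra kills the relations exactly because
the images of the generators satisfy them.\<close>

lemma H4n_universal:
  assumes "H4n_triple B n \<omega> (f GenG) (f GenX) (f GenC)"
  shows H4n_lift_alg_hom: "induced_map (free_hom B f) \<in> alg_hom (H4n_algebra n \<omega>) B"
    and H4n_lift_gen: "induced_map (free_hom B f) (H4n_gen n \<omega> u) = f u"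
proof -
  interpret H4n_triple B n \<omega> "f GenG" "f GenX" "f GenC" by fact
  have f: "f u \<in> carrier B" for u by (cases u) auto
  note fh = free_hom_alg_hom[of f, OF f] and fs = free_hom_single[of f, OF f]
  have diff: "free_hom B f (p - q) = free_hom B f p \<ominus>\<^bsub>B\<^esub> free_hom B f q" for p q
    by (rule monoid_algebra_lin_map_diff[OF alg_hom_lin[OF fh, unfolded free_algebra_def] word_monoid])
      (auto simp: k_algebra_axioms monoid_algebra_simps)
  have fadd: "free_hom B f (p + q) = free_hom B f p \<oplus>\<^bsub>B\<^esub> free_hom B f q" for p q
    using alg_hom_add[OF fh, of p q] by simp
  have rep: "((\<otimes>\<^bsub>B\<^esub>) (f u) ^^ m) \<one>\<^bsub>B\<^esub> = f u [^]\<^bsub>B\<^esub> m" for m u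
    by (induction m) (simp_all add: f nat_pow_Suc2[symmetric] del: nat_pow_Suc)
  have "free_hom B f p = \<zero>\<^bsub>B\<^esub>" if "p \<in> H4n_relations n \<omega>" for p
    using that
    by (auto simp: H4n_relations_def diff fs fadd rep f g_g c_pow_n x_x x_g c_g c_x r_neg a_minus_def)
  then have kills: "free_hom B f p = \<zero>\<^bsub>B\<^esub>" if "p \<in> H4n_ideal n \<omega>" for p
    using alg_hom_kills_genideal[OF free_algebra_k_algebra fh k_algebra_axioms H4n_relations_subset]
      that unfolding H4n_ideal_def by blast
  show "induced_map (free_hom B f) \<in> alg_hom (H4n_algebra n \<omega>) B"
    unfolding H4n_algebra_def
    by (rule induced_map_alg_hom[OF free_algebra_k_algebra fh k_algebra_axioms H4n_ideal_ideal kills])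
  show "induced_map (free_hom B f) (H4n_gen n \<omega> u) = f u"
    unfolding H4n_class_def
    by (subst induced_map_lin_coset[OF alg_hom_lin[OF fh] k_algebra_axioms H4n_ideal_ideal kills])
      (simp_all add: fs f)
qed

lemma H4n_hom_eqI:
  assumes h: "h \<in> alg_hom (H4n_algebra n \<omega>) B" and h': "h' \<in> alg_hom (H4n_algebra n \<omega>) B" and B: "k_algebra B"
    and gens: "\<And>u. h (H4n_gen n \<omega> u) = h' (H4n_gen n \<omega> u)"
    and a: "a \<in> carrier (H4n_algebra n \<omega>)"
  shows "h a = h' a"
proof -
  interpret A: k_algebra "H4n_algebra n \<omega>" by (rule H4n_algebra_k_algebra)
  obtain p where p: "a = H4n_class n \<omega> p" using a by (rule H4n_carrierE)
  have w: "h (H4n_class n \<omega> (word w)) = h' (H4n_class n \<omega> (word w))" for w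
  proof (induction w)
    case Nil
    then show ?case by (simp add: H4n_class_one alg_hom_one[OF h] alg_hom_one[OF h'])
  next
    case (Cons u w)
    then show ?case
      by (subst (1 2) H4n_class_word_Cons) (simp add: alg_hom_mult[OF h] alg_hom_mult[OF h'] gens)
  qed
  have "Poly_Mapping.keys p \<subseteq> UNIV" by simp
  then have "h (H4n_class n \<omega> p) = h' (H4n_class n \<omega> p)"
  proof (induction p rule: poly_mapping_span_induct)
    case zero
    have "H4n_class n \<omega> 0 = \<zero>\<^bsub>H4n_algebra n \<omega>\<^esub>"
      using lin_map_zero[OF alg_hom_lin[OF H4n_class_alg_hom] free_algebra_k_algebra H4n_algebra_k_algebra]
      by simp
    then show ?case
      using lin_map_zero[OF alg_hom_lin[OF h] H4n_algebra_k_algebra B]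
        lin_map_zero[OF alg_hom_lin[OF h'] H4n_algebra_k_algebra B] by simp
  next
    case (single w s)
    then show ?case
      by (subst (1 2) H4n_class_single) (simp add: alg_hom_smult[OF h] alg_hom_smult[OF h'] w)
  next
    case (add p q)
    then show ?case by (simp add: H4n_class_add alg_hom_add[OF h] alg_hom_add[OF h'])
  qed
  then show ?thesis by (simp add: p)
qed

section \<open>A basis and its coordinate functionals\<close>

text \<open>The scalar \<open>\<chi>\<close> with \<open>x w = \<chi> w x\<close> for a word \<open>w\<close> in \<open>g\<close> and \<open>c\<close>.\<close>

definition twist :: "'k::field \<Rightarrow> gen list \<Rightarrow> 'k" where
  "twist \<omega> w = inverse ((-1) ^ count_list w GenG * \<omega> ^ count_list w GenC)"

text \<open>The scalar that arises when all letters \<open>x\<close> of a word are moved to its right end.\<close>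

primrec reorder_scalar :: "'k::field \<Rightarrow> gen list \<Rightarrow> 'k" where
  "reorder_scalar \<omega> [] = 1"
| "reorder_scalar \<omega> (u # w) = (if u = GenX then twist \<omega> w else 1) * reorder_scalar \<omega> w"

text \<open>The exponents \<open>(e, i, b)\<close> of the normal form \<open>g\<^sup>e c\<^sup>i x\<^sup>b\<close> of a word. The exponent of \<open>x\<close> is not truncated: words
with \<open>b \<ge> 2\<close> represent zero and have an index outside of the index set of the basis.\<close>

definition word_index :: "nat \<Rightarrow> gen list \<Rightarrow> nat \<times> nat \<times> nat" where
  "word_index n w = (count_list w GenG mod 2, count_list w GenC mod n, count_list w GenX)"

definition word_coordinate :: "nat \<Rightarrow> 'k::field \<Rightarrow> nat \<times> nat \<times> nat \<Rightarrow> gen list \<Rightarrow> 'k" where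
  "word_coordinate n \<omega> \<beta> w = (if word_index n w = \<beta> then reorder_scalar \<omega> w else 0)"

lemma twist_append: "twist \<omega> (u @ v) = twist \<omega> u * twist \<omega> v"
  by (simp add: twist_def power_add)

lemma reorder_scalar_append:
  "reorder_scalar \<omega> (u @ v) =
     reorder_scalar \<omega> u * reorder_scalar \<omega> v * twist \<omega> v ^ count_list u GenX"
  by (induction u) (auto simp: twist_append)

lemma count_list_replicate: "count_list (replicate m u) v = (if u = v then m else 0)"
  by (induction m) auto

lemma reorder_scalar_no_x: "count_list w GenX = 0 \<Longrightarrow> reorder_scalar \<omega> w = 1"
  by (induction w) (auto split: if_splits)

lemma power_cong_mod:
  fixes \<omega> :: "'a::monoid_mult"
  assumes "\<omega> ^ n = 1" "a mod n = b mod n"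
  shows "\<omega> ^ a = \<omega> ^ b"
proof -
  have "\<omega> ^ a = \<omega> ^ (a mod n)" for a :: nat
  proof -
    have "\<omega> ^ a = (\<omega> ^ n) ^ (a div n) * \<omega> ^ (a mod n)"
      by (metis mult_div_mod_eq power_add power_mult)
    then show ?thesis using assms(1) by simp
  qed
  then show ?thesis using assms(2) by metis
qed

lemma twist_cong:
  assumes "\<omega> ^ n = 1" "word_index n m = word_index n m'"
  shows "twist \<omega> m = twist \<omega> m'"
proof -
  have sgn: "(-1) ^ a = ((-1) ^ (a mod 2) :: 'a)" for a :: nat
    by (simp add: minus_one_power_iff)
  show ?thesis
    using assms(2) unfolding twist_def word_index_def
    by (metis sgn power_cong_mod[OF assms(1)] prod.inject)
qed

lemma word_index_context:
  assumes "word_index n m = word_index n m'"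
  shows "word_index n (u @ m @ v) = word_index n (u @ m' @ v)"
  using assms unfolding word_index_def
  by (auto simp only: count_list_append prod.inject intro!: mod_add_cong)

text \<open>All defining relations except \<open>x\<^sup>2 = 0\<close> equate a word \<open>m'\<close> with a multiple \<open>t m\<close> of a word with the same
exponents, and \<open>t\<close> is the ratio of their reordering scalars. Inside a larger word the ratio stays the same, since the scalar of
a concatenation depends on the middle part only through its own scalar and its exponents.\<close>

lemma word_coordinate_context:
  assumes "\<omega> ^ n = 1" "word_index n m = word_index n m'"
    and "reorder_scalar \<omega> m' = t * reorder_scalar \<omega> m"
  shows "word_coordinate n \<omega> \<beta> (u @ m' @ v) = t * word_coordinate n \<omega> \<beta> (u @ m @ v)"
proof -
  have "count_list m GenX = count_list m' GenX" using assms(2) by (simp add: word_index_def)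
  then have "reorder_scalar \<omega> (u @ m' @ v) = t * reorder_scalar \<omega> (u @ m @ v)"
    using assms(3) twist_cong[OF assms(1,2)] by (simp add: reorder_scalar_append twist_append)
  then show ?thesis
    using word_index_context[OF assms(2), of u v] by (simp add: word_coordinate_def)
qed

locale H4n_data =
  fixes n :: nat and \<omega> :: "'k::field"
  assumes n_pos: "n > 0" and \<omega>_pow_n: "\<omega> ^ n = 1"
begin

abbreviation "A \<equiv> H4n_algebra n \<omega>"
abbreviation "g \<equiv> H4n_gen n \<omega> GenG"
abbreviation "x \<equiv> H4n_gen n \<omega> GenX"
abbreviation "c \<equiv> H4n_gen n \<omega> GenC"

lemma \<omega>_nonzero: "\<omega> \<noteq> 0"
  using \<omega>_pow_n n_pos by (metis power_0_left less_numeral_extra(3) zero_neq_one)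

sublocale H4n_triple A n \<omega> g x c
  by (rule H4n_gen_triple)

sublocale AA: tensor_product A A ..

definition mon :: "nat \<times> nat \<times> nat \<Rightarrow> (gen list \<Rightarrow>\<^sub>0 'k) set" where
  "mon = (\<lambda>(e, i, b). gc e i \<otimes>\<^bsub>A\<^esub> x [^]\<^bsub>A\<^esub> b)"

definition indices :: "(nat \<times> nat \<times> nat) set" where
  "indices = {..<2} \<times> {..<n} \<times> {..<2}"

lemma finite_indices [simp]: "finite indices"
  by (simp add: indices_def)

lemma mon_closed [simp]: "mon \<beta> \<in> carrier A"
  by (cases \<beta>) (simp add: mon_def)

lemma mon_0: "mon (e, i, 0) = gc e i"
  by (simp add: mon_def)

lemma mon_1: "mon (e, i, Suc 0) = gc e i \<otimes>\<^bsub>A\<^esub> x"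
  by (simp add: mon_def)

lemma x_pow_zero: "(b :: nat) \<ge> 2 \<Longrightarrow> x [^]\<^bsub>A\<^esub> b = \<zero>\<^bsub>A\<^esub>"
proof -
  assume "b \<ge> 2"
  then obtain k where "b = Suc (Suc k)" by (metis add_2_eq_Suc le_Suc_ex)
  then show ?thesis by (simp add: m_assoc x_x)
qed

lemma x_gc: "x \<otimes>\<^bsub>A\<^esub> gc e i = inverse ((-1) ^ e * \<omega> ^ i) \<odot>\<^bsub>A\<^esub> (gc e i \<otimes>\<^bsub>A\<^esub> x)"
proof -
  let ?s = "(-1) ^ e * \<omega> ^ i"
  have "inverse ?s \<odot>\<^bsub>A\<^esub> (gc e i \<otimes>\<^bsub>A\<^esub> x) = (inverse ?s * ?s) \<odot>\<^bsub>A\<^esub> (x \<otimes>\<^bsub>A\<^esub> gc e i)"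
    unfolding gc_x by (rule smult_smult) simp
  also have "inverse ?s * ?s = 1" using \<omega>_nonzero by (intro left_inverse) simp
  finally show ?thesis by simp
qed

text \<open>Move the letters to their places from right to left: \<open>g\<close> and \<open>c\<close> are absorbed by the power of \<open>g\<close> or \<open>c\<close>, and passing an
\<open>x\<close> through the powers of \<open>g\<close> and \<open>c\<close> costs the twist.\<close>

lemma class_word_normal_form:
  "H4n_class n \<omega> (word w) = reorder_scalar \<omega> w \<odot>\<^bsub>A\<^esub> mon (word_index n w)"
proof (induction w)
  case Nil
  then show ?case by (simp add: mon_def word_index_def H4n_class_one)
next
  case (Cons u w)
  have mon_w: "mon (word_index n w) = gc (count_list w GenG) (count_list w GenC) \<otimes>\<^bsub>A\<^esub> x [^]\<^bsub>A\<^esub> count_list w GenX" for w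
    using gc_cong[of "count_list w GenG mod 2" "count_list w GenG" "count_list w GenC mod n" "count_list w GenC"]
    by (simp add: word_index_def mon_def)
  have *: "H4n_class n \<omega> (word (u # w)) =
      reorder_scalar \<omega> w \<odot>\<^bsub>A\<^esub> (H4n_gen n \<omega> u \<otimes>\<^bsub>A\<^esub> mon (word_index n w))"
    by (subst H4n_class_word_Cons) (simp add: Cons)
  show ?case
  proof (cases u)
    case GenG
    have "g \<otimes>\<^bsub>A\<^esub> gc e i = gc (Suc e) i" for e i
      using gc_mult[of 1 0 e i] by (simp add: gc_g)
    then show ?thesis
      unfolding * unfolding GenG mon_w by (simp flip: m_assoc)
  next
    case GenC
    have "c \<otimes>\<^bsub>A\<^esub> gc e i = gc e (Suc i)" for e i
      using gc_mult[of 0 1 e i] by (simp add: gc_def[of 0 "Suc 0"])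
    then show ?thesis
      unfolding * unfolding GenC mon_w by (simp flip: m_assoc)
  next
    case GenX
    have "x \<otimes>\<^bsub>A\<^esub> mon (word_index n w) =
        x \<otimes>\<^bsub>A\<^esub> gc (count_list w GenG) (count_list w GenC) \<otimes>\<^bsub>A\<^esub> x [^]\<^bsub>A\<^esub> count_list w GenX"
      unfolding mon_w by (simp add: m_assoc)
    also have "\<dots> = twist \<omega> w \<odot>\<^bsub>A\<^esub> mon (word_index n (u # w))"
      unfolding x_gc mon_w[of "u # w"] by (simp add: GenX twist_def m_assoc nat_pow_Suc2[symmetric] del: nat_pow_Suc)
    finally show ?thesis unfolding * unfolding GenX by (simp add: mult.commute)
  qed
qed

definition coord :: "nat \<times> nat \<times> nat \<Rightarrow> (gen list \<Rightarrow>\<^sub>0 'k) set \<Rightarrow> 'k" where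
  "coord \<beta> = induced_map (linear_extension base_algebra (word_coordinate n \<omega> \<beta>))"

text \<open>The coordinates are compatible with the relations, so they are well defined on the quotient. This is what
makes the monomials linearly independent.\<close>

lemma coord:
  assumes \<beta>: "\<beta> \<in> indices"
  shows coord_lin_map: "coord \<beta> \<in> lin_map A base_algebra"
    and coord_word: "coord \<beta> (H4n_class n \<omega> (word w)) = word_coordinate n \<omega> \<beta> w"
proof -
  interpret K: k_algebra "base_algebra :: ('k, 'k) module" by (rule base_algebra_k_algebra)
  let ?L = "linear_extension base_algebra (word_coordinate n \<omega> \<beta>)"
  have L: "?L \<in> lin_map (monoid_algebra word_monoid) base_algebra"
    by (rule K.linear_extension_lin_map) simp
  have L': "?L \<in> lin_map free_algebra base_algebra"
    using L by (simp add: free_algebra_def)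
  have L_single: "?L (Poly_Mapping.single w s) = s * word_coordinate n \<omega> \<beta> w" for w s
    by (subst K.linear_extension_single) auto
  have L_diff: "?L (p - q) = ?L p - ?L q" for p q
    using monoid_algebra_lin_map_diff[OF L word_monoid K.k_algebra_axioms, of p q]
    by (simp add: a_minus_def K.minus_eq_smult monoid_algebra_simps)
  have L_add: "?L (p + q) = ?L p + ?L q" for p q
    using lin_map_add[OF L', of p q] by simp
  have kills: "?L p = 0" if p: "p \<in> H4n_ideal n \<omega>" for p
  proof -
    have "?L p = \<zero>\<^bsub>base_algebra\<^esub>"
    proof (rule monoid_algebra_lin_map_kills_genideal[OF word_monoid L K.k_algebra_axioms
          _ _ p[unfolded H4n_ideal_def free_algebra_def]])
      fix u r v assume r: "r \<in> H4n_relations n \<omega>"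
      let ?W = "\<lambda>m. word_coordinate n \<omega> \<beta> (u @ m @ v)"
      note ctxt = word_coordinate_context[OF \<omega>_pow_n, where u = u and v = v and \<beta> = \<beta>]
      have "?W [GenG, GenG] = ?W []" "?W (replicate n GenC) = ?W []"
        "?W [GenX, GenG] = - ?W [GenG, GenX]" "?W [GenC, GenG] = ?W [GenG, GenC]"
        "?W [GenX, GenC] = inverse \<omega> * ?W [GenC, GenX]"
        using ctxt[of "[]" "[GenG, GenG]" 1] ctxt[of "[]" "replicate n GenC" 1]
          ctxt[of "[GenG, GenX]" "[GenX, GenG]" "-1"] ctxt[of "[GenG, GenC]" "[GenC, GenG]" 1]
          ctxt[of "[GenC, GenX]" "[GenX, GenC]" "inverse \<omega>"]
        by (simp_all add: word_index_def twist_def reorder_scalar_no_x count_list_replicate)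
      moreover have "?W [GenX, GenX] = 0"
        using \<beta> by (auto simp: word_coordinate_def word_index_def indices_def)
      ultimately show "?L (word u \<otimes>\<^bsub>monoid_algebra word_monoid\<^esub> r \<otimes>\<^bsub>monoid_algebra word_monoid\<^esub> word v) = \<zero>\<^bsub>base_algebra\<^esub>"
        using r \<omega>_nonzero unfolding H4n_relations_def
        by (auto simp: monoid_algebra_mult_diff monoid_algebra_mult_add_left monoid_algebra_mult_add_right
            L_diff L_add L_single)
    qed (simp add: monoid_algebra_simps)
    then show ?thesis by simp
  qed
  show "coord \<beta> \<in> lin_map A base_algebra"
    unfolding coord_def H4n_algebra_def
    by (rule induced_map_lin_map[OF free_algebra_k_algebra L' K.k_algebra_axioms H4n_ideal_ideal])
      (simp add: kills)
  show "coord \<beta> (H4n_class n \<omega> (word w)) = word_coordinate n \<omega> \<beta> w"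
    unfolding coord_def H4n_class_def
    by (subst induced_map_lin_coset[OF L' K.k_algebra_axioms H4n_ideal_ideal])
      (simp_all add: kills L_single)
qed

lemma coord_simps:
  assumes "\<beta> \<in> indices"
  shows coord_add: "a \<in> carrier A \<Longrightarrow> b \<in> carrier A \<Longrightarrow> coord \<beta> (a \<oplus>\<^bsub>A\<^esub> b) = coord \<beta> a + coord \<beta> b"
    and coord_smult: "a \<in> carrier A \<Longrightarrow> coord \<beta> (s \<odot>\<^bsub>A\<^esub> a) = s * coord \<beta> a"
    and coord_zero: "coord \<beta> \<zero>\<^bsub>A\<^esub> = 0"
  using lin_mapD[OF coord_lin_map[OF assms]]
    lin_map_zero[OF coord_lin_map[OF assms] k_algebra_axioms base_algebra_k_algebra] by simp_all

lemma coord_mon: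
  assumes "\<beta> \<in> indices"
  shows "coord \<beta> (mon (e, i, b)) = (if \<beta> = (e mod 2, i mod n, b) then 1 else 0)"
proof -
  let ?w = "replicate e GenG @ replicate i GenC @ replicate b GenX"
  have "reorder_scalar \<omega> (replicate b GenX) = 1"
    by (induction b) (auto simp: twist_def count_list_replicate)
  then have s: "reorder_scalar \<omega> ?w = 1"
    by (simp add: reorder_scalar_append reorder_scalar_no_x count_list_replicate)
  have i: "word_index n ?w = (e mod 2, i mod n, b)"
    by (simp add: word_index_def count_list_replicate)
  have "mon (e mod 2, i mod n, b) = mon (e, i, b)"
    using gc_cong[of "e mod 2" e "i mod n" i] by (simp add: mon_def)
  then have "mon (e, i, b) = H4n_class n \<omega> (word ?w)"
    by (simp add: class_word_normal_form s i)
  then show ?thesis using assms by (auto simp add: coord_word word_coordinate_def s i)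
qed

text \<open>The monomials span, because every word is a multiple of one of them or, when it contains two letters \<open>x\<close>, zero.\<close>

lemma coord_expansion:
  assumes "a \<in> carrier A"
  shows "a = (\<Oplus>\<^bsub>A\<^esub>\<beta>\<in>indices. coord \<beta> a \<odot>\<^bsub>A\<^esub> mon \<beta>)"
proof -
  let ?E = "\<lambda>a. \<Oplus>\<^bsub>A\<^esub>\<beta>\<in>indices. coord \<beta> a \<odot>\<^bsub>A\<^esub> mon \<beta>"
  have E_word: "?E (H4n_class n \<omega> (Poly_Mapping.single w s)) = H4n_class n \<omega> (Poly_Mapping.single w s)" for w s
  proof -
    let ?a = "H4n_class n \<omega> (Poly_Mapping.single w s)"
    have a: "?a = (s * reorder_scalar \<omega> w) \<odot>\<^bsub>A\<^esub> mon (word_index n w)"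
      by (subst H4n_class_single) (simp add: class_word_normal_form)
    have coord_a: "coord \<beta> ?a = (if word_index n w = \<beta> then s * reorder_scalar \<omega> w else 0)" if "\<beta> \<in> indices" for \<beta>
      by (subst H4n_class_single) (simp add: coord_smult[OF that] coord_word[OF that] word_coordinate_def)
    show ?thesis
    proof (cases "word_index n w \<in> indices")
      case True
      have "?E ?a = (\<Oplus>\<^bsub>A\<^esub>\<beta>\<in>indices. if word_index n w = \<beta> then ?a else \<zero>\<^bsub>A\<^esub>)"
      proof (rule finsum_cong')
        fix \<beta> assume \<beta>: "\<beta> \<in> indices"
        show "coord \<beta> ?a \<odot>\<^bsub>A\<^esub> mon \<beta> = (if word_index n w = \<beta> then ?a else \<zero>\<^bsub>A\<^esub>)"
          unfolding coord_a[OF \<beta>] using a by auto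
      qed auto
      also have "\<dots> = ?a"
        using finsum_singleton[OF True finite_indices, of "\<lambda>_. ?a"] by simp
      finally show ?thesis .
    next
      case False
      then have "2 \<le> count_list w GenX"
        using n_pos by (auto simp: word_index_def indices_def)
      then have "mon (word_index n w) = \<zero>\<^bsub>A\<^esub>"
        by (simp add: word_index_def mon_def x_pow_zero)
      moreover have "?E ?a = \<zero>\<^bsub>A\<^esub>"
      proof (subst finsum_cong')
        fix \<beta> assume \<beta>: "\<beta> \<in> indices"
        then show "coord \<beta> ?a \<odot>\<^bsub>A\<^esub> mon \<beta> = \<zero>\<^bsub>A\<^esub>"
          unfolding coord_a[OF \<beta>] using False by (cases "word_index n w = \<beta>") auto
      qed auto
      ultimately show ?thesis by (simp add: a)
    qed
  qed
  obtain p where p: "a = H4n_class n \<omega> p" using assms by (rule H4n_carrierE)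
  have "Poly_Mapping.keys p \<subseteq> UNIV" by simp
  then have "?E (H4n_class n \<omega> p) = H4n_class n \<omega> p"
  proof (induction p rule: poly_mapping_span_induct)
    case zero
    show ?case using E_word[of "[]" 0] by simp
  next
    case (single w s)
    show ?case by (rule E_word)
  next
    case (add p q)
    let ?p = "H4n_class n \<omega> p" and ?q = "H4n_class n \<omega> q"
    have "?E (H4n_class n \<omega> (p + q)) = (\<Oplus>\<^bsub>A\<^esub>\<beta>\<in>indices. coord \<beta> ?p \<odot>\<^bsub>A\<^esub> mon \<beta> \<oplus>\<^bsub>A\<^esub> coord \<beta> ?q \<odot>\<^bsub>A\<^esub> mon \<beta>)"
      by (rule finsum_cong') (auto simp: H4n_class_add coord_add smult_add_left)
    also have "\<dots> = ?E ?p \<oplus>\<^bsub>A\<^esub> ?E ?q"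
      by (rule finsum_addf) auto
    finally show ?case using add by (simp add: H4n_class_add)
  qed
  then show ?thesis by (simp add: p)
qed

lemma coord_eqI:
  assumes "a \<in> carrier A" "b \<in> carrier A" "\<And>\<beta>. \<beta> \<in> indices \<Longrightarrow> coord \<beta> a = coord \<beta> b"
  shows "a = b"
proof -
  have "a = (\<Oplus>\<^bsub>A\<^esub>\<beta>\<in>indices. coord \<beta> b \<odot>\<^bsub>A\<^esub> mon \<beta>)"
    by (subst coord_expansion[OF assms(1)], rule finsum_cong') (auto simp: assms(3))
  then show ?thesis using coord_expansion[OF assms(2)] by simp
qed

lemma lin_map_expansion:
  assumes L: "L \<in> lin_map A base_algebra" and a: "a \<in> carrier A"
  shows "L a = (\<Sum>\<beta>\<in>indices. coord \<beta> a * L (mon \<beta>))"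
proof -
  interpret K: k_algebra "base_algebra :: ('k, 'k) module" by (rule base_algebra_k_algebra)
  have fin: "finsum base_algebra f S = sum f S" if "finite S" for S and f :: "'s \<Rightarrow> 'k"
    using that by (induction S) auto
  have "L a = L (\<Oplus>\<^bsub>A\<^esub>\<beta>\<in>indices. coord \<beta> a \<odot>\<^bsub>A\<^esub> mon \<beta>)"
    using coord_expansion[OF a] by simp
  also have "\<dots> = (\<Sum>\<beta>\<in>indices. L (coord \<beta> a \<odot>\<^bsub>A\<^esub> mon \<beta>))"
    by (subst lin_map_finsum[OF L k_algebra_axioms K.k_algebra_axioms]) (auto simp: fin)
  finally show ?thesis by (simp add: lin_map_smult[OF L])
qed

end

section \<open>The Hopf algebra structure\<close>

lemma (in k_algebra) minus_one_smult_cancel: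
  assumes "a \<in> carrier A"
  shows "(-1) \<odot> a \<oplus> a = \<zero>" "a \<oplus> (-1) \<odot> a = \<zero>"
  using assms by (simp_all add: l_neg r_neg flip: minus_eq_smult)

context tensor_product
begin

lemma tensor_zero_left [simp]: "b \<in> carrier B \<Longrightarrow> \<zero>\<^bsub>A\<^esub> \<otimes>\<^sub>t b = \<zero>\<^bsub>T\<^esub>"
  using tensor_smult_left[of "\<zero>\<^bsub>A\<^esub>" b 0] by simp

lemma tensor_zero_right [simp]: "a \<in> carrier A \<Longrightarrow> a \<otimes>\<^sub>t \<zero>\<^bsub>B\<^esub> = \<zero>\<^bsub>T\<^esub>"
  using tensor_smult_right[of a "\<zero>\<^bsub>B\<^esub>" 0] by simp

end

lemma opposite_algebra_simps [simp]:
  "carrier (opposite_algebra A) = carrier A" "a \<otimes>\<^bsub>opposite_algebra A\<^esub> b = b \<otimes>\<^bsub>A\<^esub> a"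
  "\<one>\<^bsub>opposite_algebra A\<^esub> = \<one>\<^bsub>A\<^esub>" "\<zero>\<^bsub>opposite_algebra A\<^esub> = \<zero>\<^bsub>A\<^esub>"
  "(\<oplus>\<^bsub>opposite_algebra A\<^esub>) = (\<oplus>\<^bsub>A\<^esub>)" "(\<odot>\<^bsub>opposite_algebra A\<^esub>) = (\<odot>\<^bsub>A\<^esub>)"
  by (simp_all add: opposite_algebra_def)

lemma (in k_algebra) opposite_k_algebra: "k_algebra (opposite_algebra A)"
proof -
  let ?O = "opposite_algebra A"
  have "ring ?O"
  proof (rule ringI)
    show "abelian_group ?O"
    proof (rule abelian_groupI)
      fix a assume "a \<in> carrier ?O"
      then show "\<exists>b\<in>carrier ?O. b \<oplus>\<^bsub>?O\<^esub> a = \<zero>\<^bsub>?O\<^esub>"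
        by (intro bexI[of _ "\<ominus> a"]) (simp_all add: l_neg)
    qed (simp_all add: a_ac)
    show "Group.monoid ?O"
      by (rule monoidI) (simp_all add: m_assoc)
  qed (simp_all add: l_distr r_distr)
  then interpret O: ring ?O .
  show ?thesis
    by unfold_locales (simp_all add: smult_add_left smult_add_right)
qed

lemma (in k_algebra) opposite_pow:
  assumes "a \<in> carrier A"
  shows "a [^]\<^bsub>opposite_algebra A\<^esub> (m :: nat) = a [^] m"
proof -
  interpret O: k_algebra "opposite_algebra A" by (rule opposite_k_algebra)
  show ?thesis
  proof (induction m)
    case (Suc m)
    have "a [^]\<^bsub>opposite_algebra A\<^esub> Suc m = a \<otimes> a [^] m" by (simp add: Suc)
    then show ?case using nat_pow_Suc2[OF assms] by simp
  qed simp
qed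

lemma alg_hom_opposite: "h \<in> alg_hom A B \<Longrightarrow> h \<in> alg_hom (opposite_algebra A) (opposite_algebra B)"
  by (auto simp: alg_hom_def lin_map_def ring_hom_def)

context H4n_data
begin

abbreviation "counitA \<equiv> induced_map (free_hom base_algebra (gen_counit :: gen \<Rightarrow> 'k))"
abbreviation "comultA \<equiv> induced_map (free_hom (tensor_algebra A A) (gen_comult n \<omega>))"
abbreviation "antipodeA \<equiv> induced_map (free_hom (opposite_algebra A) (gen_antipode n \<omega>))"

lemma gen_comult_simps:
  "gen_comult n \<omega> GenG = pure_tensor A A g g"
  "gen_comult n \<omega> GenX = pure_tensor A A x \<one>\<^bsub>A\<^esub> \<oplus>\<^bsub>tensor_algebra A A\<^esub> pure_tensor A A g x"
  "gen_comult n \<omega> GenC = pure_tensor A A c c"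
  by (simp_all add: gen_comult_def Let_def H4n_class_one)

lemma counit_triple:
  "H4n_triple (base_algebra :: ('k, 'k) module) n \<omega> (gen_counit GenG) (gen_counit GenX) (gen_counit GenC)"
proof -
  interpret K: k_algebra "base_algebra :: ('k, 'k) module" by (rule base_algebra_k_algebra)
  show ?thesis
    by unfold_locales (use K.nat_pow_one[of n] in simp_all)
qed

text \<open>The images of the generators under \<open>\<Delta>\<close> satisfy the relations. In the square of \<open>x \<otimes> 1 + g \<otimes> x\<close> the mixed terms
combine to \<open>(x g + g x) \<otimes> x\<close>, and the same cancellation in each factor shows that it anticommutes with \<open>g \<otimes> g\<close>.\<close>

lemma comult_triple:
  "H4n_triple (tensor_algebra A A) n \<omega> (gen_comult n \<omega> GenG) (gen_comult n \<omega> GenX) (gen_comult n \<omega> GenC)"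
  unfolding gen_comult_simps
proof unfold_locales
  let ?T = "tensor_algebra A A" and ?t = "pure_tensor A A"
  let ?x = "?t x \<one>\<^bsub>A\<^esub> \<oplus>\<^bsub>?T\<^esub> ?t g x"
  show "?t g g \<otimes>\<^bsub>?T\<^esub> ?t g g = \<one>\<^bsub>?T\<^esub>"
    by (simp add: g_g AA.tensor_one)
  show "?t c c [^]\<^bsub>?T\<^esub> n = \<one>\<^bsub>?T\<^esub>"
    by (simp add: AA.tensor_pow c_pow_n AA.tensor_one)
  show "?t c c \<otimes>\<^bsub>?T\<^esub> ?t g g = ?t g g \<otimes>\<^bsub>?T\<^esub> ?t c c"
    by (simp add: c_g)
  show "?t c c \<otimes>\<^bsub>?T\<^esub> ?x = \<omega> \<odot>\<^bsub>?T\<^esub> (?x \<otimes>\<^bsub>?T\<^esub> ?t c c)"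
    by (simp add: AA.T.l_distr AA.T.r_distr c_x c_g AA.tensor_smult_left AA.tensor_smult_right
        AA.T.smult_add_right)
  have "?x \<otimes>\<^bsub>?T\<^esub> ?t g g \<oplus>\<^bsub>?T\<^esub> ?t g g \<otimes>\<^bsub>?T\<^esub> ?x =
      ?t (x \<otimes>\<^bsub>A\<^esub> g \<oplus>\<^bsub>A\<^esub> g \<otimes>\<^bsub>A\<^esub> x) g \<oplus>\<^bsub>?T\<^esub> ?t \<one>\<^bsub>A\<^esub> (x \<otimes>\<^bsub>A\<^esub> g \<oplus>\<^bsub>A\<^esub> g \<otimes>\<^bsub>A\<^esub> x)"
    by (simp add: AA.T.l_distr AA.T.r_distr g_g AA.tensor_add_left AA.tensor_add_right AA.T.a_ac)
  then show "?x \<otimes>\<^bsub>?T\<^esub> ?t g g \<oplus>\<^bsub>?T\<^esub> ?t g g \<otimes>\<^bsub>?T\<^esub> ?x = \<zero>\<^bsub>?T\<^esub>"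
    by (simp add: x_g)
  have "?x \<otimes>\<^bsub>?T\<^esub> ?x = ?t (x \<otimes>\<^bsub>A\<^esub> x) \<one>\<^bsub>A\<^esub> \<oplus>\<^bsub>?T\<^esub>
      ?t (x \<otimes>\<^bsub>A\<^esub> g \<oplus>\<^bsub>A\<^esub> g \<otimes>\<^bsub>A\<^esub> x) x \<oplus>\<^bsub>?T\<^esub> ?t \<one>\<^bsub>A\<^esub> (x \<otimes>\<^bsub>A\<^esub> x)"
    by (simp add: AA.T.l_distr AA.T.r_distr g_g AA.tensor_add_left AA.T.a_ac)
  then show "?x \<otimes>\<^bsub>?T\<^esub> ?x = \<zero>\<^bsub>?T\<^esub>"
    by (simp add: x_g x_x)
qed simp_all

lemma gen_antipode_simps:
  "gen_antipode n \<omega> GenG = g"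
  "gen_antipode n \<omega> GenX = (-1) \<odot>\<^bsub>A\<^esub> (g \<otimes>\<^bsub>A\<^esub> x)"
  "gen_antipode n \<omega> GenC = gc 0 (n - 1)"
proof -
  have "- word [GenG, GenX] = Poly_Mapping.single [GenG, GenX] (-1 :: 'k)"
    by (simp add: single_uminus)
  then show "gen_antipode n \<omega> GenX = (-1) \<odot>\<^bsub>A\<^esub> (g \<otimes>\<^bsub>A\<^esub> x)"
    using H4n_class_word_Cons[of n \<omega> GenG "[GenX]"]
    by (simp add: H4n_class_single[of n \<omega> _ "-1"])
  show "gen_antipode n \<omega> GenC = gc 0 (n - 1)"
    by (simp add: H4n_class_replicate gc_def)
qed simp

text \<open>In the opposite algebra the relation \<open>c x = \<omega> x c\<close> asks for \<open>(g x) c\<^sup>-\<^sup>1 = \<omega> c\<^sup>-\<^sup>1 (g x)\<close>, where \<open>c\<^sup>-\<^sup>1\<close> is the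
power with exponent \<open>n - 1\<close>; moving it past \<open>g x\<close> costs the power of \<open>\<omega>\<close> with the same exponent, and \<open>\<omega>\<^sup>n = 1\<close>.\<close>

lemma antipode_triple:
  "H4n_triple (opposite_algebra A) n \<omega> (gen_antipode n \<omega> GenG) (gen_antipode n \<omega> GenX) (gen_antipode n \<omega> GenC)"
proof -
  interpret O: k_algebra "opposite_algebra A" by (rule opposite_k_algebra)
  have g_gc: "g \<otimes>\<^bsub>A\<^esub> gc e i = gc (Suc e) i" "gc e i \<otimes>\<^bsub>A\<^esub> g = gc (Suc e) i" for e i
    using gc_mult[of 1 0 e i] gc_mult[of e i 1 0] by (simp_all add: gc_g)
  have gxg: "g \<otimes>\<^bsub>A\<^esub> x \<otimes>\<^bsub>A\<^esub> g = (-1) \<odot>\<^bsub>A\<^esub> x" "g \<otimes>\<^bsub>A\<^esub> (g \<otimes>\<^bsub>A\<^esub> x) = x"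
  proof -
    have "g \<otimes>\<^bsub>A\<^esub> x \<otimes>\<^bsub>A\<^esub> g = (-1) \<odot>\<^bsub>A\<^esub> (x \<otimes>\<^bsub>A\<^esub> (g \<otimes>\<^bsub>A\<^esub> g))"
      by (simp add: g_x m_assoc del: mult_smult)
    then show "g \<otimes>\<^bsub>A\<^esub> x \<otimes>\<^bsub>A\<^esub> g = (-1) \<odot>\<^bsub>A\<^esub> x" by (simp add: g_g)
    have "g \<otimes>\<^bsub>A\<^esub> (g \<otimes>\<^bsub>A\<^esub> x) = (g \<otimes>\<^bsub>A\<^esub> g) \<otimes>\<^bsub>A\<^esub> x" by (simp only: m_assoc g_closed x_closed)
    then show "g \<otimes>\<^bsub>A\<^esub> (g \<otimes>\<^bsub>A\<^esub> x) = x" by (simp add: g_g)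
  qed
  show ?thesis unfolding gen_antipode_simps
  proof unfold_locales
    have "gc 0 (n - 1) [^]\<^bsub>A\<^esub> n = \<one>\<^bsub>A\<^esub>"
      using gc_cong[of 0 0 "(n - 1) * n" 0] by (simp add: gc_pow)
    then show "gc 0 (n - 1) [^]\<^bsub>opposite_algebra A\<^esub> n = \<one>\<^bsub>opposite_algebra A\<^esub>"
      by (simp add: opposite_pow)
    have "g \<otimes>\<^bsub>A\<^esub> x \<otimes>\<^bsub>A\<^esub> (g \<otimes>\<^bsub>A\<^esub> x) = g \<otimes>\<^bsub>A\<^esub> x \<otimes>\<^bsub>A\<^esub> g \<otimes>\<^bsub>A\<^esub> x"
      by (simp add: m_assoc)
    then have "g \<otimes>\<^bsub>A\<^esub> x \<otimes>\<^bsub>A\<^esub> (g \<otimes>\<^bsub>A\<^esub> x) = \<zero>\<^bsub>A\<^esub>"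
      by (simp add: gxg x_x)
    then show "((-1) \<odot>\<^bsub>A\<^esub> (g \<otimes>\<^bsub>A\<^esub> x)) \<otimes>\<^bsub>opposite_algebra A\<^esub> ((-1) \<odot>\<^bsub>A\<^esub> (g \<otimes>\<^bsub>A\<^esub> x)) = \<zero>\<^bsub>opposite_algebra A\<^esub>"
      by simp
    show "(-1) \<odot>\<^bsub>A\<^esub> (g \<otimes>\<^bsub>A\<^esub> x) \<otimes>\<^bsub>opposite_algebra A\<^esub> g \<oplus>\<^bsub>opposite_algebra A\<^esub>
        g \<otimes>\<^bsub>opposite_algebra A\<^esub> ((-1) \<odot>\<^bsub>A\<^esub> (g \<otimes>\<^bsub>A\<^esub> x)) = \<zero>\<^bsub>opposite_algebra A\<^esub>"
      by (simp add: gxg minus_one_smult_cancel)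
    have "gc 0 (n - 1) \<otimes>\<^bsub>A\<^esub> (g \<otimes>\<^bsub>A\<^esub> x) = g \<otimes>\<^bsub>A\<^esub> (gc 0 (n - 1) \<otimes>\<^bsub>A\<^esub> x)"
      by (simp add: g_gc flip: m_assoc)
    also have "\<dots> = \<omega> ^ (n - 1) \<odot>\<^bsub>A\<^esub> (g \<otimes>\<^bsub>A\<^esub> x \<otimes>\<^bsub>A\<^esub> gc 0 (n - 1))"
      by (simp add: gc_x m_assoc)
    finally have "\<omega> \<odot>\<^bsub>A\<^esub> (gc 0 (n - 1) \<otimes>\<^bsub>A\<^esub> (g \<otimes>\<^bsub>A\<^esub> x)) = \<omega> ^ Suc (n - 1) \<odot>\<^bsub>A\<^esub> (g \<otimes>\<^bsub>A\<^esub> x \<otimes>\<^bsub>A\<^esub> gc 0 (n - 1))"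
      by simp
    also have "\<omega> ^ Suc (n - 1) = 1"
      using \<omega>_pow_n n_pos by simp
    finally show "gc 0 (n - 1) \<otimes>\<^bsub>opposite_algebra A\<^esub> ((-1) \<odot>\<^bsub>A\<^esub> (g \<otimes>\<^bsub>A\<^esub> x)) =
        \<omega> \<odot>\<^bsub>opposite_algebra A\<^esub> ((-1) \<odot>\<^bsub>A\<^esub> (g \<otimes>\<^bsub>A\<^esub> x) \<otimes>\<^bsub>opposite_algebra A\<^esub> gc 0 (n - 1))"
      by (simp add: mult.commute[of \<omega> "-1"]) (metis gc_closed g_closed x_closed m_closed smult_smult mult_minus1)
  qed (simp_all add: g_g g_gc)
qed

lemmas counit_alg_hom = H4n_lift_alg_hom[OF counit_triple]
lemmas counit_gen = H4n_lift_gen[OF counit_triple]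
lemmas comult_alg_hom = H4n_lift_alg_hom[OF comult_triple]
lemmas comult_gen = H4n_lift_gen[OF comult_triple]
lemmas antipode_alg_hom = H4n_lift_alg_hom[OF antipode_triple]
lemmas antipode_gen = H4n_lift_gen[OF antipode_triple]

lemma H4n_simps:
  "carrier (H4n n \<omega>) = carrier A" "(\<otimes>\<^bsub>H4n n \<omega>\<^esub>) = (\<otimes>\<^bsub>A\<^esub>)" "\<one>\<^bsub>H4n n \<omega>\<^esub> = \<one>\<^bsub>A\<^esub>"
  "\<zero>\<^bsub>H4n n \<omega>\<^esub> = \<zero>\<^bsub>A\<^esub>" "(\<oplus>\<^bsub>H4n n \<omega>\<^esub>) = (\<oplus>\<^bsub>A\<^esub>)" "(\<odot>\<^bsub>H4n n \<omega>\<^esub>) = (\<odot>\<^bsub>A\<^esub>)"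
  "counit (H4n n \<omega>) = counitA" "comult (H4n n \<omega>) = comultA" "antipode (H4n n \<omega>) = antipodeA"
  by (simp_all add: H4n_def Let_def)

text \<open>The Hopf algebra record extends the algebra \<open>A\<close>, and the tensor constructions depend on the algebra structure only.\<close>

lemma tensor_map_H4n: "tensor_map (H4n n \<omega>) (H4n n \<omega>) = tensor_map A A"
proof -
  have D: "H4n n \<omega> \<times>\<times> H4n n \<omega> = A \<times>\<times> A"
    by (simp add: DirProd_def H4n_simps)
  have R: "bilinear_relations (H4n n \<omega>) (H4n n \<omega>) = bilinear_relations A A"
    unfolding bilinear_relations_def H4n_simps ..
  show ?thesis
    by (intro ext) (simp add: tensor_map_def tensor_algebra_def pure_tensor_def tensor_ideal_def D R)
qed

lemma hopf_auto_H4n_iff: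
  "\<phi> \<in> hopf_auto (H4n n \<omega>) \<longleftrightarrow> \<phi> \<in> alg_hom A A \<and> \<phi> \<in> Bij (carrier A) \<and>
    (\<forall>a\<in>carrier A. counitA (\<phi> a) = counitA a) \<and>
    (\<forall>a\<in>carrier A. comultA (\<phi> a) = tensor_map A A \<phi> \<phi> (comultA a)) \<and>
    (\<forall>a\<in>carrier A. antipodeA (\<phi> a) = \<phi> (antipodeA a))"
proof -
  have "ring_hom (H4n n \<omega>) (H4n n \<omega>) = ring_hom A A"
    by (simp add: ring_hom_def H4n_simps)
  then show ?thesis
    unfolding hopf_auto_def H4n_simps tensor_map_H4n alg_hom_def lin_map_def
    by (auto simp: ring_hom_def)
qed

lemma comult_gc: "comultA (gc e i) = pure_tensor A A (gc e i) (gc e i)"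
  by (simp add: gc_def alg_hom_mult[OF comult_alg_hom] comult_gen gen_comult_simps AA.tensor_pow
      alg_hom_pow[OF comult_alg_hom k_algebra_axioms AA.T.k_algebra_axioms])

lemma gc_times_g: "gc e i \<otimes>\<^bsub>A\<^esub> g = gc (Suc e) i"
  using gc_mult[of e i 1 0] by (simp add: gc_g)

lemma comult_mon_1:
  "comultA (mon (e, i, Suc 0)) = pure_tensor A A (mon (e, i, Suc 0)) (gc e i)
     \<oplus>\<^bsub>tensor_algebra A A\<^esub> pure_tensor A A (gc (Suc e) i) (mon (e, i, Suc 0))"
  by (simp add: mon_1 alg_hom_mult[OF comult_alg_hom] comult_gc comult_gen gen_comult_simps
      AA.T.r_distr gc_times_g)

section \<open>Group-like and skew-primitive elements\<close>

abbreviation "coord2 \<beta> \<gamma> \<equiv> AA.functional_tensor (coord \<beta>) (coord \<gamma>)"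

lemma coord2:
  assumes "\<beta> \<in> indices" "\<gamma> \<in> indices"
  shows coord2_comult_lin: "(\<lambda>a. coord2 \<beta> \<gamma> (comultA a)) \<in> lin_map A base_algebra"
    and coord2_tensor: "\<And>a b. \<lbrakk>a \<in> carrier A; b \<in> carrier A\<rbrakk> \<Longrightarrow>
      coord2 \<beta> \<gamma> (pure_tensor A A a b) = coord \<beta> a * coord \<gamma> b"
    and coord2_add: "\<And>a b. \<lbrakk>a \<in> carrier AA.T; b \<in> carrier AA.T\<rbrakk> \<Longrightarrow>
      coord2 \<beta> \<gamma> (a \<oplus>\<^bsub>AA.T\<^esub> b) = coord2 \<beta> \<gamma> a + coord2 \<beta> \<gamma> b"
proof -
  note lin = AA.functional_tensor_lin_map[OF coord_lin_map[OF assms(1)] coord_lin_map[OF assms(2)]]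
  show "(\<lambda>a. coord2 \<beta> \<gamma> (comultA a)) \<in> lin_map A base_algebra"
    by (rule lin_map_comp[OF alg_hom_lin[OF comult_alg_hom] lin])
  show "\<And>a b. \<lbrakk>a \<in> carrier A; b \<in> carrier A\<rbrakk> \<Longrightarrow>
      coord2 \<beta> \<gamma> (pure_tensor A A a b) = coord \<beta> a * coord \<gamma> b"
    by (rule AA.functional_tensor_tensor[OF coord_lin_map[OF assms(1)] coord_lin_map[OF assms(2)]])
  show "\<And>a b. \<lbrakk>a \<in> carrier AA.T; b \<in> carrier AA.T\<rbrakk> \<Longrightarrow>
      coord2 \<beta> \<gamma> (a \<oplus>\<^bsub>AA.T\<^esub> b) = coord2 \<beta> \<gamma> a + coord2 \<beta> \<gamma> b"
    using lin_map_add[OF lin] by simp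
qed

lemma index_cases:
  assumes "\<beta> \<in> indices"
  obtains e i where "e < 2" "i < n" "\<beta> = (e, i, 0)" | e i where "e < 2" "i < n" "\<beta> = (e, i, Suc 0)"
  using assms by (auto simp: indices_def less_2_cases_iff)

text \<open>A coefficient of \<open>\<Delta>(a)\<close> is a linear functional of \<open>a\<close>, so it can be computed on the basis, and the
formula for \<open>\<Delta>\<close> on the basis makes it nonzero on at most one basis element.\<close>

lemma coord2_comult_eqI:
  assumes "\<beta> \<in> indices" "\<gamma> \<in> indices" "\<delta> \<in> indices" "a \<in> carrier A"
    and 0: "\<And>e i. \<lbrakk>e < 2; i < n\<rbrakk> \<Longrightarrow> coord2 \<beta> \<gamma> (comultA (mon (e, i, 0))) = (if \<delta> = (e, i, 0) then k else 0)"
    and 1: "\<And>e i. \<lbrakk>e < 2; i < n\<rbrakk> \<Longrightarrow>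
      coord2 \<beta> \<gamma> (comultA (mon (e, i, Suc 0))) = (if \<delta> = (e, i, Suc 0) then k else 0)"
  shows "coord2 \<beta> \<gamma> (comultA a) = k * coord \<delta> a"
proof -
  have *: "coord2 \<beta> \<gamma> (comultA (mon \<eta>)) = (if \<delta> = \<eta> then k else 0)" if "\<eta> \<in> indices" for \<eta>
    using that by (cases rule: index_cases) (simp_all add: 0 1)
  have "coord2 \<beta> \<gamma> (comultA a) = (\<Sum>\<eta>\<in>indices. coord \<eta> a * coord2 \<beta> \<gamma> (comultA (mon \<eta>)))"
    by (rule lin_map_expansion[OF coord2_comult_lin[OF assms(1,2)] assms(4)])
  also have "\<dots> = (\<Sum>\<eta>\<in>indices. if \<delta> = \<eta> then k * coord \<delta> a else 0)"
    by (rule sum.cong[OF refl]) (simp add: *)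
  finally show ?thesis using assms(3) by simp
qed

lemma coord2_comult_mon:
  assumes \<beta>\<gamma>: "\<beta> \<in> indices" "\<gamma> \<in> indices" and ei: "e < 2" "i < n"
  shows "coord2 \<beta> \<gamma> (comultA (mon (e, i, 0))) = (if \<beta> = (e, i, 0) \<and> \<gamma> = (e, i, 0) then 1 else 0)"
    and "coord2 \<beta> \<gamma> (comultA (mon (e, i, Suc 0))) =
      (if \<beta> = (e, i, Suc 0) \<and> \<gamma> = (e, i, 0) \<or> \<beta> = (1 - e, i, 0) \<and> \<gamma> = (e, i, Suc 0) then 1 else 0)"
proof -
  have ei': "e mod 2 = e" "i mod n = i" "Suc e mod 2 = 1 - e"
    using ei by (auto simp: less_2_cases_iff)
  have gc: "coord \<delta> (gc e i) = (if \<delta> = (e, i, 0) then 1 else 0)"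
    "coord \<delta> (gc (Suc e) i) = (if \<delta> = (1 - e, i, 0) then 1 else 0)" if "\<delta> \<in> indices" for \<delta>
    using coord_mon[OF that, of e i 0] coord_mon[OF that, of "Suc e" i 0] by (simp_all add: mon_0 ei')
  show "coord2 \<beta> \<gamma> (comultA (mon (e, i, 0))) = (if \<beta> = (e, i, 0) \<and> \<gamma> = (e, i, 0) then 1 else 0)"
    by (simp add: mon_0 comult_gc coord2_tensor[OF \<beta>\<gamma>] gc \<beta>\<gamma>)
  have "coord2 \<beta> \<gamma> (comultA (mon (e, i, Suc 0))) = coord \<beta> (mon (e, i, Suc 0)) * coord \<gamma> (gc e i)
      + coord \<beta> (gc (Suc e) i) * coord \<gamma> (mon (e, i, Suc 0))"
    by (simp add: comult_mon_1 coord2_tensor[OF \<beta>\<gamma>] coord2_add[OF \<beta>\<gamma>])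
  then show "coord2 \<beta> \<gamma> (comultA (mon (e, i, Suc 0))) =
      (if \<beta> = (e, i, Suc 0) \<and> \<gamma> = (e, i, 0) \<or> \<beta> = (1 - e, i, 0) \<and> \<gamma> = (e, i, Suc 0) then 1 else 0)"
    by (simp add: gc coord_mon ei' \<beta>\<gamma>)
qed

text \<open>The coefficients of \<open>\<Delta>(a)\<close> at \<open>u \<otimes> v\<close>, \<open>u x \<otimes> v\<close>, \<open>u \<otimes> v x\<close> and \<open>u x \<otimes> v x\<close>. They are read off from
\<open>\<Delta>(u) = u \<otimes> u\<close> and \<open>\<Delta>(u x) = u x \<otimes> u + u g \<otimes> u x\<close>; multiplication by \<open>g\<close> turns the exponent \<open>e'\<close> into \<open>1 - e'\<close>.\<close>

lemma coord2_comult: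
  assumes a: "a \<in> carrier A" and u: "e < 2" "i < n" and v: "e' < 2" "i' < n"
  shows "coord2 (e, i, 0) (e', i', 0) (comultA a) = (if e = e' \<and> i = i' then coord (e, i, 0) a else 0)"
    and "coord2 (e, i, Suc 0) (e', i', 0) (comultA a) = (if e = e' \<and> i = i' then coord (e, i, Suc 0) a else 0)"
    and "coord2 (e, i, 0) (e', i', Suc 0) (comultA a) = (if e = 1 - e' \<and> i = i' then coord (e', i', Suc 0) a else 0)"
    and "coord2 (e, i, Suc 0) (e', i', Suc 0) (comultA a) = 0"
proof -
  have ind: "(e, i, 0) \<in> indices" "(e, i, Suc 0) \<in> indices" "(e', i', 0) \<in> indices" "(e', i', Suc 0) \<in> indices"
    using u v by (auto simp: indices_def)
  have "coord2 (e, i, 0) (e', i', 0) (comultA a) = (if e = e' \<and> i = i' then 1 else 0) * coord (e, i, 0) a"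
    by (rule coord2_comult_eqI) (use ind a in \<open>auto simp: coord2_comult_mon\<close>)
  then show "coord2 (e, i, 0) (e', i', 0) (comultA a) = (if e = e' \<and> i = i' then coord (e, i, 0) a else 0)"
    by simp
  have "coord2 (e, i, Suc 0) (e', i', 0) (comultA a) = (if e = e' \<and> i = i' then 1 else 0) * coord (e, i, Suc 0) a"
    by (rule coord2_comult_eqI) (use ind a in \<open>auto simp: coord2_comult_mon\<close>)
  then show "coord2 (e, i, Suc 0) (e', i', 0) (comultA a) = (if e = e' \<and> i = i' then coord (e, i, Suc 0) a else 0)"
    by simp
  have "coord2 (e, i, 0) (e', i', Suc 0) (comultA a) = (if e = 1 - e' \<and> i = i' then 1 else 0) * coord (e', i', Suc 0) a"
    by (rule coord2_comult_eqI) (use ind a in \<open>auto simp: coord2_comult_mon\<close>)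
  then show "coord2 (e, i, 0) (e', i', Suc 0) (comultA a) = (if e = 1 - e' \<and> i = i' then coord (e', i', Suc 0) a else 0)"
    by simp
  have "coord2 (e, i, Suc 0) (e', i', Suc 0) (comultA a) = 0 * coord (e, i, Suc 0) a"
    by (rule coord2_comult_eqI) (use ind a in \<open>auto simp: coord2_comult_mon\<close>)
  then show "coord2 (e, i, Suc 0) (e', i', Suc 0) (comultA a) = 0"
    by simp
qed

lemma coord_gc:
  assumes "\<beta> \<in> indices" "e < 2" "i < n"
  shows "coord \<beta> (gc e i) = (if \<beta> = (e, i, 0) then 1 else 0)"
  using coord_mon[of \<beta> e i 0] assms by (simp add: mon_0)

text \<open>The coefficient at \<open>u x \<otimes> u x\<close> shows that the square of the coefficient of \<open>y\<close> at \<open>u x\<close> is zero. Those at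
\<open>u \<otimes> v\<close> show that the coefficients of \<open>y\<close> in the group are orthogonal idempotents of the field,
so precisely one of them is 1.\<close>

lemma group_like_classification:
  assumes y: "y \<in> carrier A" and y0: "y \<noteq> \<zero>\<^bsub>A\<^esub>" and \<Delta>: "comultA y = pure_tensor A A y y"
  obtains e i where "e < 2" "i < n" "y = gc e i"
proof -
  have prod: "coord \<beta> y * coord \<gamma> y = coord2 \<beta> \<gamma> (comultA y)" if "\<beta> \<in> indices" "\<gamma> \<in> indices" for \<beta> \<gamma>
    unfolding \<Delta> by (rule coord2_tensor[OF that y y, symmetric])
  have q: "coord (e, i, Suc 0) y = 0" if "e < 2" "i < n" for e i
    using prod[of "(e, i, Suc 0)" "(e, i, Suc 0)"] coord2_comult(4)[OF y that that] that
    by (simp add: indices_def)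
  have p: "coord (e, i, 0) y * coord (e', i', 0) y = (if e = e' \<and> i = i' then coord (e, i, 0) y else 0)"
    if "e < 2" "i < n" "e' < 2" "i' < n" for e i e' i'
    using prod[of "(e, i, 0)" "(e', i', 0)"] coord2_comult(1)[OF y that] that
    by (simp add: indices_def)
  have "\<exists>\<beta>\<in>indices. coord \<beta> y \<noteq> 0"
    using coord_eqI[OF y zero_closed] y0 by (metis coord_zero)
  then obtain e i where ei: "e < 2" "i < n" and nz: "coord (e, i, 0) y \<noteq> 0"
    by (metis index_cases q)
  have "y = gc e i"
  proof (rule coord_eqI[OF y gc_closed])
    fix \<beta> assume \<beta>: "\<beta> \<in> indices"
    then show "coord \<beta> y = coord \<beta> (gc e i)"
    proof (cases rule: index_cases)
      case (1 e' i')
      then show ?thesis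
        using p[OF ei 1(1,2)] nz \<beta> ei by (auto simp: coord_gc split: if_splits)
    next
      case (2 e' i')
      then show ?thesis using q \<beta> ei by (simp add: coord_gc)
    qed
  qed
  then show thesis using ei that by blast
qed

lemma coord_x:
  assumes "\<beta> \<in> indices"
  shows "coord \<beta> x = (if \<beta> = (0, 0, Suc 0) then 1 else 0)"
  using coord_mon[OF assms, of 0 0 1] by (simp add: mon_1)

lemma coord_x_gc:
  assumes "e < 2" "i < n" "e' < 2" "i' < n"
  shows "coord (e, i, 0) (x \<otimes>\<^bsub>A\<^esub> gc e' i') = 0" "coord (e, i, 0) (gc e' i' \<otimes>\<^bsub>A\<^esub> x) = 0"
proof -
  have ind: "(e, i, 0) \<in> indices" using assms by (simp add: indices_def)
  show "coord (e, i, 0) (gc e' i' \<otimes>\<^bsub>A\<^esub> x) = 0"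
    using coord_mon[OF ind, of e' i' 1] by (simp add: mon_1)
  then show "coord (e, i, 0) (x \<otimes>\<^bsub>A\<^esub> gc e' i') = 0"
    by (simp add: x_gc coord_smult[OF ind])
qed

text \<open>Comparing coefficients on both sides of the equation for \<open>\<Delta>(y)\<close> leaves \<open>y = \<alpha> x + \<beta> 1 + \<gamma> h\<close> for \<open>h\<close> the given
group-like element. As \<open>h\<close> commutes with 1 and \<open>h\<close>, anticommutation with \<open>y\<close> gives \<open>2 \<beta> = 2 \<gamma> = 0\<close>. The coefficient of \<open>\<Delta>(y)\<close>
at \<open>h \<otimes> x\<close> then forces \<open>h = g\<close>, since that of \<open>\<Delta>(x)\<close> is nonzero only at \<open>g \<otimes> x\<close>.\<close>

lemma skew_primitive_classification:
  assumes two: "(2 :: 'k) \<noteq> 0"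
    and y: "y \<in> carrier A" and y0: "y \<noteq> \<zero>\<^bsub>A\<^esub>"
    and ei: "e < 2" "i < n" and h1: "gc e i \<noteq> \<one>\<^bsub>A\<^esub>" and h2: "gc e i \<otimes>\<^bsub>A\<^esub> gc e i = \<one>\<^bsub>A\<^esub>"
    and \<Delta>: "comultA y = pure_tensor A A y \<one>\<^bsub>A\<^esub> \<oplus>\<^bsub>tensor_algebra A A\<^esub> pure_tensor A A (gc e i) y"
    and anti: "y \<otimes>\<^bsub>A\<^esub> gc e i \<oplus>\<^bsub>A\<^esub> gc e i \<otimes>\<^bsub>A\<^esub> y = \<zero>\<^bsub>A\<^esub>"
  obtains \<alpha> where "\<alpha> \<noteq> 0" "y = \<alpha> \<odot>\<^bsub>A\<^esub> x" "gc e i = g"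
proof -
  let ?h = "gc e i"
  have one: "coord \<beta> \<one>\<^bsub>A\<^esub> = (if \<beta> = (0, 0, 0) then 1 else 0)" if "\<beta> \<in> indices" for \<beta>
    using coord_gc[OF that, of 0 0] n_pos by simp
  have ei0: "(e, i) \<noteq> (0, 0)" using h1 by auto
  have \<Delta>': "coord2 \<beta> \<gamma> (comultA y) = coord \<beta> y * (if \<gamma> = (0, 0, 0) then 1 else 0)
      + (if \<beta> = (e, i, 0) then 1 else 0) * coord \<gamma> y"
    if "\<beta> \<in> indices" "\<gamma> \<in> indices" for \<beta> \<gamma>
    unfolding \<Delta> using that y ei by (simp add: coord2_add coord2_tensor one coord_gc)
  \<comment> \<open>compare coefficients at \<open>u x \<otimes> u\<close>, where \<open>u \<noteq> 1\<close>\<close>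
  have q: "coord (e', i', Suc 0) y = 0" if "e' < 2" "i' < n" "(e', i') \<noteq> (0, 0)" for e' i'
    using \<Delta>'[of "(e', i', Suc 0)" "(e', i', 0)"] coord2_comult(2)[OF y that(1,2) that(1,2)] that
    by (auto simp: indices_def)
  \<comment> \<open>compare coefficients at \<open>u \<otimes> u\<close>, where \<open>u\<close> is different from 1 and \<open>h\<close>\<close>
  have p: "coord (e', i', 0) y = 0" if "e' < 2" "i' < n" "(e', i') \<noteq> (0, 0)" "(e', i') \<noteq> (e, i)" for e' i'
    using \<Delta>'[of "(e', i', 0)" "(e', i', 0)"] coord2_comult(1)[OF y that(1,2) that(1,2)] that
    by (auto simp: indices_def)
  define \<alpha> \<beta> \<gamma> where "\<alpha> = coord (0, 0, Suc 0) y" and "\<beta> = coord (0, 0, 0) y" and "\<gamma> = coord (e, i, 0) y"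
  have y_eq: "y = \<alpha> \<odot>\<^bsub>A\<^esub> x \<oplus>\<^bsub>A\<^esub> (\<beta> \<odot>\<^bsub>A\<^esub> \<one>\<^bsub>A\<^esub> \<oplus>\<^bsub>A\<^esub> \<gamma> \<odot>\<^bsub>A\<^esub> ?h)"
  proof (rule coord_eqI[OF y])
    fix \<delta> assume \<delta>: "\<delta> \<in> indices"
    then show "coord \<delta> y = coord \<delta> (\<alpha> \<odot>\<^bsub>A\<^esub> x \<oplus>\<^bsub>A\<^esub> (\<beta> \<odot>\<^bsub>A\<^esub> \<one>\<^bsub>A\<^esub> \<oplus>\<^bsub>A\<^esub> \<gamma> \<odot>\<^bsub>A\<^esub> ?h))"
      by (cases rule: index_cases)
        (use ei0 ei q p \<delta> in \<open>auto simp: coord_add coord_smult coord_x coord_gc one \<alpha>_def \<beta>_def \<gamma>_def\<close>)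
  qed simp
  have "y \<otimes>\<^bsub>A\<^esub> ?h \<oplus>\<^bsub>A\<^esub> ?h \<otimes>\<^bsub>A\<^esub> y = \<alpha> \<odot>\<^bsub>A\<^esub> (x \<otimes>\<^bsub>A\<^esub> ?h) \<oplus>\<^bsub>A\<^esub> (\<beta> \<odot>\<^bsub>A\<^esub> ?h \<oplus>\<^bsub>A\<^esub> \<gamma> \<odot>\<^bsub>A\<^esub> \<one>\<^bsub>A\<^esub>)
      \<oplus>\<^bsub>A\<^esub> (\<alpha> \<odot>\<^bsub>A\<^esub> (?h \<otimes>\<^bsub>A\<^esub> x) \<oplus>\<^bsub>A\<^esub> (\<beta> \<odot>\<^bsub>A\<^esub> ?h \<oplus>\<^bsub>A\<^esub> \<gamma> \<odot>\<^bsub>A\<^esub> \<one>\<^bsub>A\<^esub>))"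
    by (subst (1 2) y_eq) (simp add: l_distr r_distr h2)
  then have co: "coord \<delta> \<zero>\<^bsub>A\<^esub> = \<alpha> * coord \<delta> (x \<otimes>\<^bsub>A\<^esub> ?h) + (\<beta> * coord \<delta> ?h + \<gamma> * coord \<delta> \<one>\<^bsub>A\<^esub>)
      + (\<alpha> * coord \<delta> (?h \<otimes>\<^bsub>A\<^esub> x) + (\<beta> * coord \<delta> ?h + \<gamma> * coord \<delta> \<one>\<^bsub>A\<^esub>))" if "\<delta> \<in> indices" for \<delta>
    using that anti by (simp add: coord_add coord_smult)
  \<comment> \<open>the coefficients of the anticommutator at \<open>h\<close> and at \<open>1 = h\<^sup>2\<close>\<close>
  have "\<beta> + \<beta> = 0"
    using co[of "(e, i, 0)"] ei ei0 by (auto simp: indices_def coord_x_gc coord_gc one coord_zero)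
  moreover have "\<gamma> + \<gamma> = 0"
    using co[of "(0, 0, 0)"] ei ei0 n_pos by (auto simp: indices_def coord_x_gc coord_gc one coord_zero)
  ultimately have "\<beta> = 0" "\<gamma> = 0"
    using two by (simp_all flip: mult_2)
  then have y_x: "y = \<alpha> \<odot>\<^bsub>A\<^esub> x" using y_eq by simp
  then have \<alpha>: "\<alpha> \<noteq> 0" using y0 by auto
  have "(e, i) = (1, 0)"
    using \<Delta>'[of "(e, i, 0)" "(0, 0, Suc 0)"] coord2_comult(3)[OF y ei, of 0 0] ei n_pos \<alpha>
    by (auto simp: indices_def \<alpha>_def split: if_splits)
  then have "?h = g" by (simp add: gc_g)
  then show thesis using that y_x \<alpha> by blast
qed

end

section \<open>Classification of the Hopf automorphisms\<close>

lemma inverse_mod_exists: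
  fixes l n :: nat
  assumes "coprime l n"
  obtains l' where "(l * l') mod n = 1 mod n"
proof (cases "l = 0")
  case True
  then have "n = 1" using assms by simp
  then show ?thesis using that by simp
next
  case False
  then obtain y z where "l * y = n * z + gcd l n" using bezout_nat by blast
  then have "l * y = 1 + z * n" using assms by (simp add: coprime_iff_gcd_eq_1)
  then have "(l * y) mod n = 1 mod n" by (metis mod_mult_self1)
  then show ?thesis by (rule that)
qed

context H4n_data
begin

lemma gc_eq_iff: "gc e i = gc e' i' \<longleftrightarrow> e mod 2 = e' mod 2 \<and> i mod n = i' mod n"
proof
  have ind: "(e mod 2, i mod n, 0) \<in> indices" using n_pos by (simp add: indices_def)
  assume "gc e i = gc e' i'"
  then have "coord (e mod 2, i mod n, 0) (mon (e, i, 0)) = coord (e mod 2, i mod n, 0) (mon (e', i', 0))"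
    by (simp add: mon_0)
  then show "e mod 2 = e' mod 2 \<and> i mod n = i' mod n"
    by (simp add: coord_mon[OF ind] split: if_splits)
qed (rule gc_cong; simp)

lemma mon_nonzero:
  assumes "b < 2"
  shows "mon (e, i, b) \<noteq> \<zero>\<^bsub>A\<^esub>"
proof
  have ind: "(e mod 2, i mod n, b) \<in> indices" using n_pos assms by (simp add: indices_def)
  assume "mon (e, i, b) = \<zero>\<^bsub>A\<^esub>"
  then show False using coord_mon[OF ind, of e i b] coord_zero[OF ind] by simp
qed

lemma gc_nonzero: "gc e i \<noteq> \<zero>\<^bsub>A\<^esub>"
  using mon_nonzero[of 0 e i] by (simp add: mon_0)

lemma gc_x_nonzero: "gc e i \<otimes>\<^bsub>A\<^esub> x \<noteq> \<zero>\<^bsub>A\<^esub>"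
  using mon_nonzero[of 1 e i] by (simp add: mon_1)

lemma smult_cancel:
  assumes "a \<in> carrier A" "a \<noteq> \<zero>\<^bsub>A\<^esub>" "s \<odot>\<^bsub>A\<^esub> a = t \<odot>\<^bsub>A\<^esub> a"
  shows "s = t"
proof -
  obtain \<beta> where \<beta>: "\<beta> \<in> indices" "coord \<beta> a \<noteq> coord \<beta> \<zero>\<^bsub>A\<^esub>"
    using coord_eqI[OF assms(1) zero_closed] assms(2) by blast
  have "s * coord \<beta> a = t * coord \<beta> a"
    using arg_cong[OF assms(3), of "coord \<beta>"] by (simp only: coord_smult[OF \<beta>(1) assms(1)])
  then show ?thesis using \<beta>(2) coord_zero[OF \<beta>(1)] by simp
qed

text \<open>Since the values on generators determine an endomorphism, \<open>(\<alpha>, e, l)\<close> serves as its name; only \<open>e\<close> modulo 2 and \<open>l\<close> modulo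
\<open>n\<close> matter.\<close>

definition acts_by :: "((gen list \<Rightarrow>\<^sub>0 'k) set \<Rightarrow> (gen list \<Rightarrow>\<^sub>0 'k) set) \<Rightarrow> 'k \<Rightarrow> nat \<Rightarrow> nat \<Rightarrow> bool" where
  "acts_by \<phi> \<alpha> e l \<longleftrightarrow> \<phi> g = g \<and> \<phi> x = \<alpha> \<odot>\<^bsub>A\<^esub> x \<and> \<phi> c = gc e l"

lemma acts_by_gc:
  assumes \<phi>: "\<phi> \<in> alg_hom A A" and "acts_by \<phi> \<alpha> e l"
  shows "\<phi> (gc e' i') = gc (e' + e * i') (l * i')"
proof -
  have "\<phi> (gc e' i') = g [^]\<^bsub>A\<^esub> e' \<otimes>\<^bsub>A\<^esub> gc e l [^]\<^bsub>A\<^esub> i'"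
    using assms(2) unfolding gc_def[of e' i'] acts_by_def
    by (simp add: alg_hom_mult[OF \<phi>] alg_hom_pow[OF \<phi> k_algebra_axioms k_algebra_axioms])
  also have "\<dots> = gc e' 0 \<otimes>\<^bsub>A\<^esub> gc (e * i') (l * i')"
    by (simp add: gc_pow gc_def[of e' 0])
  finally show ?thesis by (simp add: gc_mult)
qed

lemma acts_by_comp:
  assumes \<phi>: "\<phi> \<in> alg_hom A A" and "acts_by \<phi> \<alpha> e l" and "acts_by \<psi> \<beta> e' l'"
  shows "acts_by (\<lambda>a. \<phi> (\<psi> a)) (\<alpha> * \<beta>) (e' + e * l') (l * l')"
  using assms(2,3) acts_by_gc[OF assms(1,2)]
  by (simp add: acts_by_def alg_hom_smult[OF \<phi>] mult.commute)

lemma acts_by_determines: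
  assumes "\<phi> \<in> alg_hom A A" "\<psi> \<in> alg_hom A A" "acts_by \<phi> \<alpha> e l" "acts_by \<psi> \<alpha> e' l'"
    and "e mod 2 = e' mod 2" "l mod n = l' mod n" and "a \<in> carrier A"
  shows "\<phi> a = \<psi> a"
proof (rule H4n_hom_eqI[OF assms(1,2) k_algebra_axioms _ assms(7)])
  show "\<phi> (H4n_gen n \<omega> u) = \<psi> (H4n_gen n \<omega> u)" for u
    using assms(3,4) gc_cong[OF assms(5,6)] by (cases u) (auto simp: acts_by_def)
qed

lemma acts_by_unique:
  assumes "acts_by \<phi> \<alpha> e l" "acts_by \<phi> \<alpha>' e' l'"
  shows "\<alpha> = \<alpha>'" "e mod 2 = e' mod 2" "l mod n = l' mod n"
proof -
  have "x \<noteq> \<zero>\<^bsub>A\<^esub>" using gc_x_nonzero[of 0 0] by simp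
  then show "\<alpha> = \<alpha>'"
    using assms by (auto simp: acts_by_def intro: smult_cancel[of x])
  show "e mod 2 = e' mod 2" "l mod n = l' mod n"
    using assms gc_eq_iff by (auto simp: acts_by_def)
qed

lemma endomorphism_exists:
  assumes "even (e * n)" "(-1) ^ e * \<omega> ^ l = \<omega>"
  obtains \<phi> where "\<phi> \<in> alg_hom A A" "acts_by \<phi> \<alpha> e l"
proof -
  let ?f = "\<lambda>u. case u of GenG \<Rightarrow> g | GenX \<Rightarrow> \<alpha> \<odot>\<^bsub>A\<^esub> x | GenC \<Rightarrow> gc e l"
  have t: "H4n_triple A n \<omega> (?f GenG) (?f GenX) (?f GenC)"
    using new_triple[OF assms, of \<alpha>] by simp
  show thesis
    by (rule that[OF H4n_lift_alg_hom[of A n \<omega> ?f, OF t]])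
      (simp add: acts_by_def H4n_lift_gen[of A n \<omega> ?f, OF t])
qed

lemma acts_by_id: "acts_by (\<lambda>a. a) 1 0 1"
  by (simp add: acts_by_def gc_def)

lemma id_alg_hom: "(\<lambda>a. a) \<in> alg_hom A A"
  by (intro alg_homI lin_mapI) auto

text \<open>Compatibility with counit, comultiplication and antipode holds on generators and hence everywhere. For the antipode at \<open>c\<close>
one needs \<open>e \<equiv> e (n - 1)\<close> modulo 2, which is the condition that \<open>e n\<close> is even.\<close>

lemma acts_by_hopf_auto:
  assumes \<phi>: "\<phi> \<in> alg_hom A A" and bij: "\<phi> \<in> Bij (carrier A)" and "acts_by \<phi> \<alpha> e l" and en: "even (e * n)"
  shows "\<phi> \<in> hopf_auto (H4n n \<omega>)"
proof -
  have act: "\<phi> g = g" "\<phi> x = \<alpha> \<odot>\<^bsub>A\<^esub> x" "\<phi> c = gc e l"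
    using assms(3) by (auto simp: acts_by_def)
  interpret K: k_algebra "base_algebra :: ('k, 'k) module" by (rule base_algebra_k_algebra)
  interpret O: k_algebra "opposite_algebra A" by (rule opposite_k_algebra)
  note tm = tensor_map[OF k_algebra_axioms k_algebra_axioms k_algebra_axioms k_algebra_axioms \<phi> \<phi>]
  have pow1: "1 [^]\<^bsub>base_algebra\<^esub> m = (1 :: 'k)" for m :: nat
    using K.nat_pow_one[of m] by simp
  have "counitA (\<phi> a) = counitA a" if "a \<in> carrier A" for a
  proof (rule H4n_hom_eqI[OF alg_hom_comp[OF \<phi> counit_alg_hom] counit_alg_hom K.k_algebra_axioms _ that])
    show "counitA (\<phi> (H4n_gen n \<omega> u)) = counitA (H4n_gen n \<omega> u)" for u
      by (cases u) (simp_all add: act alg_hom_smult[OF counit_alg_hom] counit_gen gc_def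
          alg_hom_mult[OF counit_alg_hom] pow1
          alg_hom_pow[OF counit_alg_hom k_algebra_axioms K.k_algebra_axioms])
  qed
  moreover have "comultA (\<phi> a) = tensor_map A A \<phi> \<phi> (comultA a)" if "a \<in> carrier A" for a
  proof (rule H4n_hom_eqI[OF alg_hom_comp[OF \<phi> comult_alg_hom]
          alg_hom_comp[OF comult_alg_hom tm(1)] AA.T.k_algebra_axioms _ that])
    show "comultA (\<phi> (H4n_gen n \<omega> u)) = tensor_map A A \<phi> \<phi> (comultA (H4n_gen n \<omega> u))" for u
      by (cases u) (simp_all add: act comult_gen gen_comult_simps tm(2) comult_gc alg_hom_add[OF tm(1)]
          alg_hom_smult[OF comult_alg_hom] alg_hom_one[OF \<phi>] AA.tensor_smult_left AA.tensor_smult_right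
          AA.T.smult_add_right)
  qed
  moreover have "antipodeA (\<phi> a) = \<phi> (antipodeA a)" if "a \<in> carrier A" for a
  proof (rule H4n_hom_eqI[OF alg_hom_comp[OF \<phi> antipode_alg_hom]
          alg_hom_comp[OF antipode_alg_hom alg_hom_opposite[OF \<phi>]] O.k_algebra_axioms _ that])
    have "e + e * (n - 1) = e * n" using n_pos by (cases n) auto
    then have parity: "e mod 2 = (e * (n - 1)) mod 2" using en by presburger
    have "antipodeA (gc e l) = gc 0 ((n - 1) * l) \<otimes>\<^bsub>A\<^esub> gc e 0"
      unfolding gc_def[of e l]
      by (simp add: alg_hom_mult[OF antipode_alg_hom] antipode_gen gen_antipode_simps opposite_pow gc_pow
          alg_hom_pow[OF antipode_alg_hom k_algebra_axioms O.k_algebra_axioms] gc_def[of e 0]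
          del: gen_antipode.simps)
    also have "\<dots> = gc (e * (n - 1)) (l * (n - 1))"
      unfolding gc_mult by (rule gc_cong) (use parity in \<open>simp_all add: mult.commute\<close>)
    finally have S: "antipodeA (gc e l) = \<phi> (gc 0 (n - 1))"
      using acts_by_gc[OF \<phi> assms(3), of 0 "n - 1"] by simp
    show "antipodeA (\<phi> (H4n_gen n \<omega> u)) = \<phi> (antipodeA (H4n_gen n \<omega> u))" for u
      by (cases u) (use S in \<open>simp_all add: act antipode_gen gen_antipode_simps
          alg_hom_smult[OF antipode_alg_hom] alg_hom_smult[OF \<phi>] alg_hom_mult[OF \<phi>] mult.commute del: gen_antipode.simps\<close>)
  qed
  ultimately show ?thesis using \<phi> bij by (simp add: hopf_auto_H4n_iff)
qed

lemmas omega_pow_cong = power_cong_mod[OF \<omega>_pow_n]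

text \<open>With \<open>l l' \<equiv> 1\<close> modulo \<open>n\<close>, the endomorphism with data \<open>(\<alpha>\<^sup>-\<^sup>1, e l', l')\<close> is a two-sided inverse: the powers of \<open>g\<close>
in the composites have the even exponents \<open>2 e l'\<close> and \<open>e (1 + l l')\<close>.\<close>

lemma automorphism_exists:
  assumes \<alpha>: "\<alpha> \<noteq> 0" and l: "coprime l n" and en: "even (e * n)" and \<omega>l: "(-1) ^ e * \<omega> ^ l = \<omega>"
  obtains \<phi> where "\<phi> \<in> hopf_auto (H4n n \<omega>)" "acts_by \<phi> \<alpha> e l"
proof -
  obtain l' where ll': "(l * l') mod n = 1 mod n" by (rule inverse_mod_exists[OF l])
  have "\<omega> ^ l' = ((-1) ^ e * \<omega> ^ l) ^ l'" using \<omega>l by simp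
  also have "\<dots> = (-1) ^ (e * l') * \<omega>"
    using omega_pow_cong[OF ll'] by (simp add: power_mult_distrib flip: power_mult)
  finally have \<omega>l': "(-1) ^ (e * l') * \<omega> ^ l' = \<omega>"
    by (simp add: minus_one_power_iff)
  \<comment> \<open>if \<open>e\<close> is odd then \<open>n\<close> is even, so that \<open>l l'\<close> is odd\<close>
  have el: "even (e + e * l' * l)"
  proof (cases "even e")
    case False
    then have "even n" using en by simp
    then have "odd (l * l')" using ll'
      by (metis dvd_mod_iff odd_one)
    then show ?thesis using False by (simp add: algebra_simps)
  qed simp
  obtain \<phi> where \<phi>: "\<phi> \<in> alg_hom A A" "acts_by \<phi> \<alpha> e l"
    by (rule endomorphism_exists[OF en \<omega>l])
  obtain \<psi> where \<psi>: "\<psi> \<in> alg_hom A A" "acts_by \<psi> (inverse \<alpha>) (e * l') l'"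
    by (rule endomorphism_exists[of "e * l'" l' "inverse \<alpha>", OF _ \<omega>l']) (use en in auto)
  have "\<phi> (\<psi> a) = a" if "a \<in> carrier A" for a
    by (rule acts_by_determines[OF alg_hom_comp[OF \<psi>(1) \<phi>(1)] id_alg_hom _ acts_by_id _ _ that,
          where e = "e * l' + e * l'" and l = "l * l'"])
      (use acts_by_comp[OF \<phi> \<psi>(2)] \<alpha> ll' in auto)
  moreover have "\<psi> (\<phi> a) = a" if "a \<in> carrier A" for a
    by (rule acts_by_determines[OF alg_hom_comp[OF \<phi>(1) \<psi>(1)] id_alg_hom _ acts_by_id _ _ that,
          where e = "e + e * l' * l" and l = "l' * l"])
      (use acts_by_comp[OF \<psi> \<phi>(2)] \<alpha> ll' el in \<open>auto simp: mult.commute[of l' l] even_iff_mod_2_eq_zero\<close>)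
  ultimately have bij: "bij_betw \<phi> (carrier A) (carrier A)"
    using alg_hom_closed[OF \<phi>(1)] alg_hom_closed[OF \<psi>(1)]
    by (intro bij_betw_byWitness[where f' = \<psi>]) auto
  let ?\<phi> = "restrict \<phi> (carrier A)"
  have "bij_betw ?\<phi> (carrier A) (carrier A)"
    using bij by (rule bij_betw_cong[THEN iffD1, rotated]) simp
  then have "?\<phi> \<in> Bij (carrier A)" by (simp add: Bij_def)
  moreover have "?\<phi> \<in> alg_hom A A"
    using \<phi>(1) by (auto simp: alg_hom_def lin_map_def ring_hom_def)
  moreover have "acts_by ?\<phi> \<alpha> e l" using \<phi>(2) by (simp add: acts_by_def)
  ultimately show thesis using acts_by_hopf_auto[OF _ _ _ en] that by blast
qed

text \<open>The images of \<open>g\<close> and \<open>c\<close> are group-like, that of \<open>x\<close> is skew-primitive, and all three satisfy the defining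
relations. The conditions on \<open>e\<close> and \<open>l\<close> come from \<open>c\<^sup>n = 1\<close>, from \<open>c x = \<omega> x c\<close> and from injectivity.\<close>

lemma automorphism_classification:
  assumes two: "(2 :: 'k) \<noteq> 0" and \<phi>H: "\<phi> \<in> hopf_auto (H4n n \<omega>)"
  obtains \<alpha> e l where "\<alpha> \<noteq> 0" "e < 2" "l < n" "acts_by \<phi> \<alpha> e l" "coprime l n"
    "even (e * n)" "(-1) ^ e * \<omega> ^ l = \<omega>"
proof -
  have \<phi>: "\<phi> \<in> alg_hom A A" and "\<phi> \<in> Bij (carrier A)"
    and comult: "\<And>a. a \<in> carrier A \<Longrightarrow> comultA (\<phi> a) = tensor_map A A \<phi> \<phi> (comultA a)"
    using \<phi>H by (auto simp: hopf_auto_H4n_iff)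
  then have inj: "inj_on \<phi> (carrier A)" by (auto simp: Bij_def bij_betw_def)
  note [simp] = alg_hom_closed[OF \<phi>]
  note tm = tensor_map[OF k_algebra_axioms k_algebra_axioms k_algebra_axioms k_algebra_axioms \<phi> \<phi>]
  have \<phi>0: "\<phi> \<zero>\<^bsub>A\<^esub> = \<zero>\<^bsub>A\<^esub>"
    by (rule lin_map_zero[OF alg_hom_lin[OF \<phi>] k_algebra_axioms k_algebra_axioms])
  have nonzero: "\<phi> a \<noteq> \<zero>\<^bsub>A\<^esub>" if "a \<in> carrier A" "a \<noteq> \<zero>\<^bsub>A\<^esub>" for a
    using inj_onD[OF inj _ that(1) zero_closed] \<phi>0 that by auto
  have gl: "\<exists>e i. e < 2 \<and> i < n \<and> \<phi> a = gc e i"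
    if a: "a \<in> carrier A" "a \<noteq> \<zero>\<^bsub>A\<^esub>" "comultA a = pure_tensor A A a a" for a
  proof -
    have "comultA (\<phi> a) = pure_tensor A A (\<phi> a) (\<phi> a)"
      using a by (simp add: comult tm(2))
    then show ?thesis
      using group_like_classification[of "\<phi> a"] nonzero a by auto
  qed
  have "g \<noteq> \<zero>\<^bsub>A\<^esub>" "c \<noteq> \<zero>\<^bsub>A\<^esub>" "x \<noteq> \<zero>\<^bsub>A\<^esub>"
    using gc_nonzero[of 1 0] gc_nonzero[of 0 1] gc_x_nonzero[of 0 0] by (simp_all add: gc_def)
  obtain e0 i0 where ei0: "e0 < 2" "i0 < n" and \<phi>g: "\<phi> g = gc e0 i0"
    using gl[of g] \<open>g \<noteq> \<zero>\<^bsub>A\<^esub>\<close> by (auto simp: comult_gen gen_comult_simps)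
  obtain e l where el: "e < 2" "l < n" and \<phi>c: "\<phi> c = gc e l"
    using gl[of c] \<open>c \<noteq> \<zero>\<^bsub>A\<^esub>\<close> by (auto simp: comult_gen gen_comult_simps)
  have "g \<noteq> \<one>\<^bsub>A\<^esub>" using gc_eq_iff[of 1 0 0 0] by (simp add: gc_g)
  then have "gc e0 i0 \<noteq> \<one>\<^bsub>A\<^esub>"
    using inj_onD[OF inj, of g "\<one>\<^bsub>A\<^esub>"] alg_hom_one[OF \<phi>] by (auto simp: \<phi>g)
  moreover have "gc e0 i0 \<otimes>\<^bsub>A\<^esub> gc e0 i0 = \<one>\<^bsub>A\<^esub>"
    using alg_hom_mult[OF \<phi>, of g g] alg_hom_one[OF \<phi>] by (simp add: g_g \<phi>g)
  moreover have "comultA (\<phi> x) = pure_tensor A A (\<phi> x) \<one>\<^bsub>A\<^esub> \<oplus>\<^bsub>AA.T\<^esub> pure_tensor A A (gc e0 i0) (\<phi> x)"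
    by (simp add: comult comult_gen gen_comult_simps alg_hom_add[OF tm(1)] tm(2) alg_hom_one[OF \<phi>] \<phi>g)
  moreover have "\<phi> x \<otimes>\<^bsub>A\<^esub> gc e0 i0 \<oplus>\<^bsub>A\<^esub> gc e0 i0 \<otimes>\<^bsub>A\<^esub> \<phi> x = \<zero>\<^bsub>A\<^esub>"
    using arg_cong[OF x_g, of \<phi>] by (simp add: alg_hom_add[OF \<phi>] alg_hom_mult[OF \<phi>] \<phi>g \<phi>0)
  ultimately obtain \<alpha> where \<alpha>: "\<alpha> \<noteq> 0" and \<phi>x: "\<phi> x = \<alpha> \<odot>\<^bsub>A\<^esub> x" and "gc e0 i0 = g"
    using skew_primitive_classification[OF two _ nonzero[OF _ \<open>x \<noteq> \<zero>\<^bsub>A\<^esub>\<close>] ei0] by (metis alg_hom_closed[OF \<phi>] x_closed)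
  then have act: "acts_by \<phi> \<alpha> e l" by (simp add: acts_by_def \<phi>g \<phi>c)
  have "gc (e * n) (l * n) = gc 0 0"
    using alg_hom_pow[OF \<phi> k_algebra_axioms k_algebra_axioms c_closed, of n]
    by (simp add: c_pow_n alg_hom_one[OF \<phi>] \<phi>c gc_pow)
  then have en: "even (e * n)" using gc_eq_iff[of "e * n" "l * n" 0 0] by (simp add: even_iff_mod_2_eq_zero)
  have "\<alpha> \<odot>\<^bsub>A\<^esub> (gc e l \<otimes>\<^bsub>A\<^esub> x) = (\<omega> * \<alpha>) \<odot>\<^bsub>A\<^esub> (x \<otimes>\<^bsub>A\<^esub> gc e l)"
    using arg_cong[OF c_x, of \<phi>]
    by (simp add: alg_hom_smult[OF \<phi>] alg_hom_mult[OF \<phi>] \<phi>c \<phi>x)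
  then have eq: "(\<alpha> * ((-1) ^ e * \<omega> ^ l)) \<odot>\<^bsub>A\<^esub> (x \<otimes>\<^bsub>A\<^esub> gc e l) = (\<omega> * \<alpha>) \<odot>\<^bsub>A\<^esub> (x \<otimes>\<^bsub>A\<^esub> gc e l)"
    by (simp add: gc_x)
  have nz: "x \<otimes>\<^bsub>A\<^esub> gc e l \<noteq> \<zero>\<^bsub>A\<^esub>"
    using gc_x_nonzero[of e l] gc_x smult_zero_right by metis
  have "\<alpha> * ((-1) ^ e * \<omega> ^ l) = \<omega> * \<alpha>"
    by (rule smult_cancel[OF _ nz eq]) simp
  then have \<omega>l: "(-1) ^ e * \<omega> ^ l = \<omega>" using \<alpha> by (simp add: mult.commute)
  have "coprime l n"
  proof -
    \<comment> \<open>for \<open>d = gcd l n\<close> and \<open>m = n / d\<close>, the power \<open>c\<^sup>m\<close> is mapped to a power of \<open>g\<close>, which \<open>\<phi>\<close> fixes\<close>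
    define d m where "d = gcd l n" and "m = n div d"
    have d: "d dvd n" "d dvd l" "d > 0" using n_pos by (auto simp: d_def)
    then have n: "n = d * m" by (simp add: m_def)
    have m: "m > 0" using n n_pos by auto
    have "n dvd l * m" using d(2) unfolding n by (intro mult_dvd_mono) auto
    then have "\<phi> (gc 0 m) = \<phi> (gc (e * m) 0)"
      unfolding acts_by_gc[OF \<phi> act] by (intro gc_cong) auto
    then have "gc 0 m = gc (e * m) 0" using inj_onD[OF inj] by simp
    then have "m mod n = 0" by (simp add: gc_eq_iff)
    then have "n dvd m" by auto
    then have "d * m \<le> m" using m n by (auto dest: dvd_imp_le)
    then have "d = 1" using m d(3) by simp
    then show ?thesis by (simp add: d_def coprime_iff_gcd_eq_1)
  qed
  then show thesis using that[OF \<alpha> el act _ en \<omega>l] by blast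
qed

end

section \<open>Residue classes\<close>

lemma residue_class_ZMod: "residue_class n s = ZMod (int n) s"
  by (simp add: residue_class_def ZMod_def)

lemma residue_class_eq_iff: "residue_class n s = residue_class n s' \<longleftrightarrow> s mod int n = s' mod int n"
  by (simp add: residue_class_ZMod ZMod_eq_mod)

lemma residue_class_mult:
  "residue_class n s \<otimes>\<^bsub>ZFact (int n)\<^esub> residue_class n s' = residue_class n (s * s')"
proof -
  interpret ideal "Idl\<^bsub>\<Z>\<^esub> {int n}" \<Z> by (rule int.genideal_ideal) simp
  show ?thesis
    using rcoset_mult_add[of s s'] by (simp add: residue_class_def ZFact_def FactRing_def)
qed

lemma ZFact_one_residue_class: "\<one>\<^bsub>ZFact (int n)\<^esub> = residue_class n 1"
  by (simp add: residue_class_def ZFact_def FactRing_def)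

lemma ZFact_carrier: "carrier (ZFact (int n)) = range (residue_class n)"
  by (auto simp: residue_class_def ZFact_def FactRing_def A_RCOSETS_def')

text \<open>Invertibility modulo \<open>n\<close> is a Bezout identity.\<close>

lemma residue_class_Zn_units_iff:
  "residue_class n s \<in> carrier (Zn_units n) \<longleftrightarrow> coprime s (int n)"
proof -
  have "residue_class n s \<in> carrier (Zn_units n) \<longleftrightarrow> (\<exists>s'. (s * s') mod int n = 1 mod int n)"
    by (auto simp: units_of_def Units_def ZFact_carrier residue_class_mult ZFact_one_residue_class
        residue_class_eq_iff mult.commute)
  also have "\<dots> \<longleftrightarrow> coprime s (int n)"
  proof
    assume "\<exists>s'. (s * s') mod int n = 1 mod int n"
    then obtain s' where "int n dvd s * s' - 1" by (metis mod_eq_dvd_iff)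
    then obtain k where "s * s' - 1 = int n * k" by (elim dvdE)
    then have "s * s' - int n * k = 1" by simp
    then have "d dvd 1" if "d dvd s" "d dvd int n" for d
      using that by (metis dvd_diff dvd_mult2)
    then show "coprime s (int n)" by (auto intro: coprimeI)
  next
    assume "coprime s (int n)"
    moreover obtain u v where "u * s + v * int n = gcd s (int n)" using bezout_int by blast
    ultimately have "s * u = 1 + (- v) * int n" by (simp add: coprime_iff_gcd_eq_1 algebra_simps)
    then have "(s * u) mod int n = 1 mod int n" by (metis mod_mult_self1)
    then show "\<exists>s'. (s * s') mod int n = 1 mod int n" by blast
  qed
  finally show ?thesis .
qed

section \<open>The group of nonzero scalars\<close>

lemma k_units_simps:
  "carrier (k_units :: 'k::field monoid) = {a. a \<noteq> 0}"
  "a \<otimes>\<^bsub>(k_units :: 'k monoid)\<^esub> b = a * b" "\<one>\<^bsub>(k_units :: 'k monoid)\<^esub> = 1"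
proof -
  have "\<exists>b. b * a = 1 \<and> a * b = 1" if "a \<noteq> 0" for a :: 'k
    using that by (intro exI[of _ "inverse a"]) simp
  then show "carrier (k_units :: 'k monoid) = {a. a \<noteq> 0}"
    by (auto simp: units_of_def Units_def)
qed (simp_all add: units_of_def)

lemma k_units_group: "group (k_units :: 'k::field monoid)"
proof -
  interpret k_algebra "base_algebra :: ('k, 'k) module" by (rule base_algebra_k_algebra)
  show ?thesis by (rule units_group)
qed

lemma k_units_pow: "a [^]\<^bsub>(k_units :: 'k::field monoid)\<^esub> (m :: nat) = a ^ m"
proof -
  interpret group "k_units :: 'k monoid" by (rule k_units_group)
  show ?thesis by (induction m) (simp_all add: k_units_simps mult.commute)
qed

lemma power_eq_1_iff_nu_dvd:
  fixes \<xi> :: "'k::field"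
  assumes "generate k_units {\<xi>} = roots_of_unity n" and "\<xi> \<noteq> 0"
  shows "\<xi> ^ m = 1 \<longleftrightarrow> nu TYPE('k) n dvd m"
proof -
  interpret group "k_units :: 'k monoid" by (rule k_units_group)
  have \<xi>: "\<xi> \<in> carrier k_units" using assms(2) by (simp add: k_units_simps)
  have "ord \<xi> = nu TYPE('k) n"
    using generate_pow_card[OF \<xi>] assms(1) by (simp add: nu_def)
  then show ?thesis
    using pow_eq_id[OF \<xi>, of m] by (simp add: k_units_pow k_units_simps)
qed

lemma two_nonzero:
  assumes "CHAR('k::field) \<noteq> 2"
  shows "(2 :: 'k) \<noteq> 0"
proof
  assume "(2 :: 'k) = 0"
  then have "of_nat 2 = (0 :: 'k)" by simp
  then have "CHAR('k) dvd 2" by (simp only: of_nat_eq_0_iff_char_dvd)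
  then have "CHAR('k) = 1"
    using assms by (metis prime_nat_iff two_is_prime_nat)
  then show False by simp
qed

section \<open>The automorphism group\<close>

context H4n_data
begin

text \<open>The condition \<open>\<omega>\<^sup>l = \<omega>\<close> belongs to automorphisms with \<open>c \<mapsto> c\<^sup>l\<close>, and \<open>\<omega>\<^sup>l = -\<omega>\<close> to those with \<open>c \<mapsto> g c\<^sup>l\<close>. For \<open>s\<close> false this is
\<open>U\<^sub>t\<close>, for \<open>s\<close> true it is \<open>U\<^sub>t \<union> V\<^sub>t\<close>.\<close>

definition scaling_classes :: "bool \<Rightarrow> int set set" where
  "scaling_classes s = {residue_class n (int l) | l. coprime l n \<and> (\<omega> ^ l = \<omega> \<or> s \<and> \<omega> ^ l = - \<omega>)}"

lemma residue_class_scaling_iff: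
  "residue_class n (int l) \<in> scaling_classes s \<longleftrightarrow> coprime l n \<and> (\<omega> ^ l = \<omega> \<or> s \<and> \<omega> ^ l = - \<omega>)"
proof
  assume "residue_class n (int l) \<in> scaling_classes s"
  then obtain l' where l': "residue_class n (int l) = residue_class n (int l')"
    and *: "coprime l' n" "\<omega> ^ l' = \<omega> \<or> s \<and> \<omega> ^ l' = - \<omega>"
    by (auto simp: scaling_classes_def)
  then have mod: "l mod n = l' mod n"
    by (simp add: residue_class_eq_iff flip: zmod_int)
  then have "coprime l n" using *(1) by (metis coprime_mod_left_iff n_pos less_numeral_extra(3))
  then show "coprime l n \<and> (\<omega> ^ l = \<omega> \<or> s \<and> \<omega> ^ l = - \<omega>)"
    using * omega_pow_cong[OF mod] by simp
qed (auto simp: scaling_classes_def)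

lemma scaling_classes_subset: "scaling_classes s \<subseteq> carrier (Zn_units n)"
  by (auto simp: scaling_classes_def residue_class_Zn_units_iff)

text \<open>If \<open>\<omega>\<^sup>l = \<epsilon> \<omega>\<close> with a sign \<open>\<epsilon>\<close>, then raising to the power \<open>l'\<close> gives \<open>\<omega>\<close> to the power \<open>l l'\<close>
as a signed \<open>l'\<close>-th power of \<open>\<omega>\<close>. This yields closure under products, and under inverses when \<open>l l' \<equiv> 1\<close> modulo \<open>n\<close>.\<close>

lemma scaling_classes_subgroup: "subgroup (scaling_classes s) (Zn_units n)"
proof -
  interpret Z: cring "ZFact (int n)" by (rule ZFact_is_cring)
  interpret U: group "Zn_units n" by (rule Z.units_group)
  have sgn: "\<epsilon> ^ l = 1 \<or> s \<and> \<epsilon> ^ l = -1" if "\<epsilon> = 1 \<or> s \<and> \<epsilon> = -1" for \<epsilon> :: 'k and l :: nat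
    using that by (auto simp: minus_one_power_iff)
  have scaling: "\<omega> ^ l = \<omega> \<or> s \<and> \<omega> ^ l = - \<omega> \<longleftrightarrow> (\<exists>\<epsilon>. (\<epsilon> = 1 \<or> s \<and> \<epsilon> = -1) \<and> \<omega> ^ l = \<epsilon> * \<omega>)" for l
    by auto
  show ?thesis
  proof (rule U.subgroupI[OF scaling_classes_subset])
    have "residue_class n (int 1) \<in> scaling_classes s"
      unfolding residue_class_scaling_iff by simp
    then show "scaling_classes s \<noteq> {}" by blast
  next
    fix C assume "C \<in> scaling_classes s"
    then obtain l where C: "C = residue_class n (int l)" and l: "coprime l n"
      and \<omega>l: "\<omega> ^ l = \<omega> \<or> s \<and> \<omega> ^ l = - \<omega>"
      by (auto simp: scaling_classes_def)
    obtain l' where ll': "(l * l') mod n = 1 mod n" by (rule inverse_mod_exists[OF l])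
    have l': "coprime l' n"
    proof (rule coprimeI)
      fix d assume "d dvd l'" "d dvd n"
      then have "d dvd (l * l') mod n" by (simp add: dvd_mod)
      then show "is_unit d" using \<open>d dvd n\<close> ll' by (metis dvd_mod_iff)
    qed
    obtain \<epsilon> where \<epsilon>: "\<epsilon> = 1 \<or> s \<and> \<epsilon> = -1" and "\<omega> ^ l = \<epsilon> * \<omega>"
      using \<omega>l scaling by blast
    then have "\<omega> ^ (l * l') = \<epsilon> ^ l' * \<omega> ^ l'" by (simp add: power_mult power_mult_distrib)
    then have "\<omega> = \<epsilon> ^ l' * \<omega> ^ l'" using omega_pow_cong[OF ll'] by simp
    moreover have "\<epsilon> ^ l' * \<epsilon> ^ l' = 1" using sgn[OF \<epsilon>, of l'] by auto
    ultimately have "\<epsilon> ^ l' * \<omega> = \<omega> ^ l'" by (metis mult.assoc mult_1)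
    then have "\<omega> ^ l' = \<omega> \<or> s \<and> \<omega> ^ l' = - \<omega>" using sgn[OF \<epsilon>, of l'] by auto
    then have C': "residue_class n (int l') \<in> scaling_classes s"
      using l' by (simp add: residue_class_scaling_iff)
    have "(int l' * int l) mod int n = 1 mod int n"
      using arg_cong[OF ll', of int] by (simp only: zmod_int of_nat_mult of_nat_1 mult.commute)
    then have "residue_class n (int l') \<otimes>\<^bsub>Zn_units n\<^esub> C = \<one>\<^bsub>Zn_units n\<^esub>"
      by (simp add: units_of_def C residue_class_mult ZFact_one_residue_class residue_class_eq_iff)
    then have "inv\<^bsub>Zn_units n\<^esub> C = residue_class n (int l')"
      using C' scaling_classes_subset \<open>C \<in> scaling_classes s\<close> by (intro U.inv_equality) auto
    then show "inv\<^bsub>Zn_units n\<^esub> C \<in> scaling_classes s" using C' by simp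
  next
    fix C D assume "C \<in> scaling_classes s" "D \<in> scaling_classes s"
    then obtain l l' where CD: "C = residue_class n (int l)" "D = residue_class n (int l')"
      and cop: "coprime l n" "coprime l' n"
      and \<omega>l: "\<omega> ^ l = \<omega> \<or> s \<and> \<omega> ^ l = - \<omega>" "\<omega> ^ l' = \<omega> \<or> s \<and> \<omega> ^ l' = - \<omega>"
      unfolding scaling_classes_def by blast
    obtain \<epsilon> where \<epsilon>: "\<epsilon> = 1 \<or> s \<and> \<epsilon> = -1" and "\<omega> ^ l = \<epsilon> * \<omega>"
      using \<omega>l(1) scaling by blast
    then have "\<omega> ^ (l * l') = \<epsilon> ^ l' * \<omega> ^ l'" by (simp add: power_mult power_mult_distrib)
    then have "\<omega> ^ (l * l') = \<omega> \<or> s \<and> \<omega> ^ (l * l') = - \<omega>"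
      using sgn[OF \<epsilon>, of l'] \<omega>l(2) by auto
    then have "residue_class n (int (l * l')) \<in> scaling_classes s"
      using cop by (simp add: residue_class_scaling_iff del: of_nat_mult)
    then show "C \<otimes>\<^bsub>Zn_units n\<^esub> D \<in> scaling_classes s"
      by (simp add: units_of_def CD residue_class_mult)
  qed
qed

text \<open>The isomorphism sends the automorphism with data \<open>(\<alpha>, e, l)\<close> to \<open>(\<alpha>, [l])\<close>. It is injective as \<open>e\<close> is determined by \<open>l\<close>
through \<open>(-1)\<^sup>e \<omega>\<^sup>l = \<omega>\<close>. The conditions on \<open>s\<close> express that the case \<open>e = 1\<close>, which requires \<open>n\<close> to be even and \<open>\<omega>\<^sup>l = -\<omega>\<close>,
is covered by \<open>s\<close>.\<close>

lemma hopf_automorphism_group: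
  assumes two: "(2 :: 'k) \<noteq> 0"
    and s: "s \<Longrightarrow> even n" "\<And>l. \<lbrakk>even n; \<omega> ^ l = - \<omega>\<rbrakk> \<Longrightarrow> s"
  shows "HopfAutGroup (H4n n \<omega>) \<cong> (k_units :: 'k monoid) \<times>\<times> (Zn_units n)\<lparr>carrier := scaling_classes s\<rparr>"
proof -
  let ?G = "HopfAutGroup (H4n n \<omega>)"
  let ?P = "(k_units :: 'k monoid) \<times>\<times> (Zn_units n)\<lparr>carrier := scaling_classes s\<rparr>"
  \<comment> \<open>the data of \<open>\<phi>\<close> are unique only up to congruence of \<open>e\<close> and \<open>l\<close>, but the pair is well defined\<close>
  define \<Theta> where "\<Theta> \<phi> = (SOME p. \<exists>\<alpha> e l. acts_by \<phi> \<alpha> e l \<and> p = (\<alpha>, residue_class n (int l)))" for \<phi>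
  have \<Theta>: "\<Theta> \<phi> = (\<alpha>, residue_class n (int l))" if "acts_by \<phi> \<alpha> e l" for \<phi> \<alpha> e l
  proof -
    have "\<exists>p \<alpha> e l. acts_by \<phi> \<alpha> e l \<and> p = (\<alpha>, residue_class n (int l))" using that by blast
    then have "\<exists>\<alpha> e l. acts_by \<phi> \<alpha> e l \<and> \<Theta> \<phi> = (\<alpha>, residue_class n (int l))"
      unfolding \<Theta>_def by (rule someI_ex)
    then obtain \<alpha>' e' l' where *: "acts_by \<phi> \<alpha>' e' l'" and \<Theta>': "\<Theta> \<phi> = (\<alpha>', residue_class n (int l'))"
      by blast
    have "int l' mod int n = int l mod int n"
      using acts_by_unique(3)[OF that *] by (simp flip: zmod_int)
    then show ?thesis
      using acts_by_unique(1)[OF that *] \<Theta>' by (simp add: residue_class_eq_iff)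
  qed
  have carrier_G: "carrier ?G = hopf_auto (H4n n \<omega>)"
    by (simp add: HopfAutGroup_def)
  have carrier_P: "carrier ?P = {\<alpha>. \<alpha> \<noteq> 0} \<times> scaling_classes s"
    by (simp add: k_units_simps)
  have one_ne: "(-1 :: 'k) \<noteq> 1" using two by (metis add.left_inverse one_add_one)
  have classes: "residue_class n (int l) \<in> scaling_classes s"
    if "e < 2" "coprime l n" "even (e * n)" "(-1) ^ e * \<omega> ^ l = \<omega>" for e l
  proof (cases "e = 0")
    case True
    then show ?thesis using that by (simp add: residue_class_scaling_iff)
  next
    case False
    then have e: "e = 1" using that(1) by simp
    then have "even n" "\<omega> ^ l = - \<omega>" using that(3,4) by (auto simp: minus_equation_iff[of _ \<omega>])
    then show ?thesis using s(2) that(2) by (auto simp: residue_class_scaling_iff)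
  qed
  have "\<Theta> \<in> hom ?G ?P"
  proof (rule homI)
    fix \<phi> assume "\<phi> \<in> carrier ?G"
    then obtain \<alpha> e l where "\<alpha> \<noteq> 0" "e < 2" "acts_by \<phi> \<alpha> e l" "coprime l n" "even (e * n)" "(-1) ^ e * \<omega> ^ l = \<omega>"
      using automorphism_classification[OF two] carrier_G by metis
    then show "\<Theta> \<phi> \<in> carrier ?P"
      using classes[of e l] by (simp add: k_units_simps \<Theta>)
  next
    fix \<phi> \<psi> assume \<phi>\<psi>: "\<phi> \<in> carrier ?G" "\<psi> \<in> carrier ?G"
    obtain \<alpha> e l where \<phi>: "acts_by \<phi> \<alpha> e l"
      using automorphism_classification[OF two] \<phi>\<psi>(1) carrier_G by metis
    obtain \<beta> e' l' where \<psi>: "acts_by \<psi> \<beta> e' l'"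
      using automorphism_classification[OF two] \<phi>\<psi>(2) carrier_G by metis
    have Bij: "\<phi> \<in> Bij (carrier A)" "\<psi> \<in> Bij (carrier A)" and \<phi>_hom: "\<phi> \<in> alg_hom A A"
      using \<phi>\<psi> by (auto simp: carrier_G hopf_auto_H4n_iff)
    then have "\<phi> \<otimes>\<^bsub>?G\<^esub> \<psi> = compose (carrier A) \<phi> \<psi>"
      by (simp add: HopfAutGroup_def BijGroup_def H4n_simps)
    moreover have "acts_by (compose (carrier A) \<phi> \<psi>) (\<alpha> * \<beta>) (e' + e * l') (l * l')"
      using acts_by_comp[OF \<phi>_hom \<phi> \<psi>] by (simp add: acts_by_def compose_def)
    ultimately have "\<Theta> (\<phi> \<otimes>\<^bsub>?G\<^esub> \<psi>) = (\<alpha> * \<beta>, residue_class n (int l * int l'))"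
      using \<Theta> by simp
    then show "\<Theta> (\<phi> \<otimes>\<^bsub>?G\<^esub> \<psi>) = \<Theta> \<phi> \<otimes>\<^bsub>?P\<^esub> \<Theta> \<psi>"
      by (simp add: \<Theta>[OF \<phi>] \<Theta>[OF \<psi>] k_units_simps residue_class_mult units_of_def[of "ZFact (int n)"])
  qed
  moreover have "inj_on \<Theta> (carrier ?G)"
  proof (rule inj_onI)
    fix \<phi> \<psi> assume \<phi>\<psi>: "\<phi> \<in> carrier ?G" "\<psi> \<in> carrier ?G" and eq: "\<Theta> \<phi> = \<Theta> \<psi>"
    obtain \<alpha> e l where \<phi>: "e < 2" "acts_by \<phi> \<alpha> e l" "(-1) ^ e * \<omega> ^ l = \<omega>"
      using automorphism_classification[OF two] \<phi>\<psi>(1) carrier_G by metis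
    obtain \<beta> e' l' where \<psi>: "e' < 2" "acts_by \<psi> \<beta> e' l'" "(-1) ^ e' * \<omega> ^ l' = \<omega>"
      using automorphism_classification[OF two] \<phi>\<psi>(2) carrier_G by metis
    have \<alpha>: "\<alpha> = \<beta>" and l: "l mod n = l' mod n"
      using eq \<Theta>[OF \<phi>(2)] \<Theta>[OF \<psi>(2)] by (simp_all add: residue_class_eq_iff flip: zmod_int)
    have "(-1) ^ e * \<omega> ^ l = (-1) ^ e' * \<omega> ^ l"
      using \<phi>(3) \<psi>(3) omega_pow_cong[OF l] by simp
    then have "(-1) ^ e = ((-1) ^ e' :: 'k)" using \<omega>_nonzero by simp
    then have e: "e = e'" using \<phi>(1) \<psi>(1) one_ne by (auto simp: less_2_cases_iff)
    show "\<phi> = \<psi>"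
    proof (rule extensionalityI)
      show "\<phi> \<in> extensional (carrier A)" "\<psi> \<in> extensional (carrier A)"
        using \<phi>\<psi> by (auto simp: carrier_G hopf_auto_H4n_iff Bij_def)
      show "\<phi> a = \<psi> a" if "a \<in> carrier A" for a
        using acts_by_determines[OF _ _ \<phi>(2) \<psi>(2)[folded \<alpha>] _ l that] e \<phi>\<psi>
        by (auto simp: carrier_G hopf_auto_H4n_iff)
    qed
  qed
  moreover have "carrier ?P \<subseteq> \<Theta> ` carrier ?G"
  proof
    fix p assume "p \<in> carrier ?P"
    then obtain \<alpha> l where p: "p = (\<alpha>, residue_class n (int l))" and \<alpha>: "\<alpha> \<noteq> 0"
      and l: "coprime l n" "\<omega> ^ l = \<omega> \<or> s \<and> \<omega> ^ l = - \<omega>"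
      by (auto simp: k_units_simps scaling_classes_def)
    define e :: nat where "e = (if \<omega> ^ l = \<omega> then 0 else 1)"
    have "even (e * n)" "(-1) ^ e * \<omega> ^ l = \<omega>"
      using l(2) s(1) by (auto simp: e_def)
    then obtain \<phi> where "\<phi> \<in> hopf_auto (H4n n \<omega>)" "acts_by \<phi> \<alpha> e l"
      using automorphism_exists[OF \<alpha> l(1)] by blast
    then show "p \<in> \<Theta> ` carrier ?G"
      using \<Theta> p carrier_G by (metis imageI)
  qed
  ultimately have "\<Theta> \<in> iso ?G ?P"
    unfolding iso_def bij_betw_def using hom_carrier by blast
  then show ?thesis unfolding is_iso_def by blast
qed

end

text \<open>Both sides express that \<open>(\<xi>\<^sup>t)\<close> to the power \<open>l - 1\<close> is 1 or \<open>-1\<close>. For the second equivalence: being \<open>-1\<close> means that the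
square is 1 but the power itself is not, so \<open>\<nu>\<close> divides \<open>2 t (l - 1)\<close> with a quotient that is not even.\<close>

lemma scaling_conditions:
  fixes \<xi> :: "'k::field" and n t :: nat
  defines "\<nu> \<equiv> nu TYPE('k) n"
  assumes two: "(2 :: 'k) \<noteq> 0" and \<xi>: "\<xi> \<noteq> 0" and ord: "\<And>m. \<xi> ^ m = 1 \<longleftrightarrow> \<nu> dvd m" and \<nu>: "\<nu> > 0"
  shows scaling_condition_plus: "(\<xi> ^ t) ^ l = \<xi> ^ t \<longleftrightarrow> int \<nu> dvd int t * (int l - 1)"
    and scaling_condition_minus:
      "(\<xi> ^ t) ^ l = - (\<xi> ^ t) \<longleftrightarrow> (\<exists>q. odd q \<and> 2 * int t * (int l - 1) = int \<nu> * q)"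
proof -
  have le: "\<xi> ^ a = \<xi> ^ b \<longleftrightarrow> int \<nu> dvd int a - int b" if "b \<le> a" for a b
  proof -
    have "\<xi> ^ a = \<xi> ^ b * \<xi> ^ (a - b)" using that by (simp flip: power_add)
    then have "\<xi> ^ a = \<xi> ^ b \<longleftrightarrow> \<xi> ^ (a - b) = 1" using \<xi> by simp
    then show ?thesis using that ord by (simp add: of_nat_diff flip: int_dvd_int_iff)
  qed
  have eq: "\<xi> ^ a = \<xi> ^ b \<longleftrightarrow> int \<nu> dvd int a - int b" for a b
  proof (cases "b \<le> a")
    case False
    then have "\<xi> ^ b = \<xi> ^ a \<longleftrightarrow> int \<nu> dvd int b - int a" by (intro le) simp
    then show ?thesis by (metis dvd_diff_commute)
  qed (rule le)
  have plus: "(\<xi> ^ t) ^ l = \<xi> ^ t \<longleftrightarrow> int \<nu> dvd int t * (int l - 1)" for l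
    using eq[of "t * l" t] by (simp add: power_mult right_diff_distrib)
  then show "(\<xi> ^ t) ^ l = \<xi> ^ t \<longleftrightarrow> int \<nu> dvd int t * (int l - 1)" .
  have sq: "((\<xi> ^ t) ^ l)\<^sup>2 = (\<xi> ^ t)\<^sup>2 \<longleftrightarrow> int \<nu> dvd 2 * int t * (int l - 1)"
  proof -
    have "((\<xi> ^ t) ^ l)\<^sup>2 = \<xi> ^ (t * l * 2)" "(\<xi> ^ t)\<^sup>2 = \<xi> ^ (t * 2)"
      by (simp_all only: power_mult)
    moreover have "int (t * l * 2) - int (t * 2) = 2 * int t * (int l - 1)"
      by (simp add: algebra_simps)
    ultimately show ?thesis using eq by simp
  qed
  have ne: "\<xi> ^ t \<noteq> - (\<xi> ^ t)"
  proof
    assume "\<xi> ^ t = - (\<xi> ^ t)"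
    then have "2 * \<xi> ^ t = 0" by (metis add.right_inverse mult_2)
    then show False using two \<xi> by simp
  qed
  have odd: "\<not> int \<nu> dvd int t * (int l - 1) \<longleftrightarrow> odd q" if "2 * int t * (int l - 1) = int \<nu> * q" for q
  proof
    assume "\<not> int \<nu> dvd int t * (int l - 1)"
    moreover have "int \<nu> dvd int t * (int l - 1)" if "q = 2 * r" for r
      using \<open>2 * int t * (int l - 1) = int \<nu> * q\<close> that by (intro dvdI[of _ _ r]) simp
    ultimately show "odd q" by (metis evenE)
  next
    assume q: "odd q"
    show "\<not> int \<nu> dvd int t * (int l - 1)"
    proof
      assume "int \<nu> dvd int t * (int l - 1)"
      then obtain r where "int t * (int l - 1) = int \<nu> * r" by (elim dvdE)
      then have "int \<nu> * q = int \<nu> * (2 * r)" by (simp only: that[symmetric] mult.assoc mult.left_commute)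
      then have "q = 2 * r" using \<nu> by simp
      then show False using q by simp
    qed
  qed
  have "(\<xi> ^ t) ^ l = - (\<xi> ^ t) \<longleftrightarrow> ((\<xi> ^ t) ^ l)\<^sup>2 = (\<xi> ^ t)\<^sup>2 \<and> (\<xi> ^ t) ^ l \<noteq> \<xi> ^ t"
    using ne by (auto simp: power2_eq_iff)
  also have "\<dots> \<longleftrightarrow> (\<exists>q. odd q \<and> 2 * int t * (int l - 1) = int \<nu> * q)"
    unfolding sq plus using odd by (auto elim!: dvdE)
  finally show "(\<xi> ^ t) ^ l = - (\<xi> ^ t) \<longleftrightarrow> (\<exists>q. odd q \<and> 2 * int t * (int l - 1) = int \<nu> * q)" .
qed

theorem corollary4p12:
  fixes \<xi> :: "'k::field" and n t :: nat
  assumes "CHAR('k) \<noteq> 2"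
    and "n > 0"
    and "\<xi> \<in> roots_of_unity n"
    and "generate k_units {\<xi>} = roots_of_unity n"
    and "t \<in> {0..<nu TYPE('k) n}"
  shows "subgroup (U_sub TYPE('k) n t) (Zn_units n)
    \<and> subgroup (U_tilde TYPE('k) n t) (Zn_units n)
    \<and> (even n \<and> even (nu TYPE('k) n) \<longrightarrow>
        HopfAutGroup (H4n n (\<xi> ^ t))
          \<cong> (k_units :: 'k monoid) \<times>\<times> (Zn_units n)\<lparr>carrier := U_tilde TYPE('k) n t\<rparr>)
    \<and> (\<not> (even n \<and> even (nu TYPE('k) n)) \<longrightarrow>
        HopfAutGroup (H4n n (\<xi> ^ t))
          \<cong> (k_units :: 'k monoid) \<times>\<times> (Zn_units n)\<lparr>carrier := U_sub TYPE('k) n t\<rparr>)"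
proof -
  let ?\<nu> = "nu TYPE('k) n" and ?\<omega> = "\<xi> ^ t"
  have two: "(2 :: 'k) \<noteq> 0" using assms(1) by (rule two_nonzero)
  have \<xi>n: "\<xi> ^ n = 1" using assms(3) by (simp add: roots_of_unity_def)
  then have \<xi>: "\<xi> \<noteq> 0" using assms(2) by (metis power_0_left less_numeral_extra(3) zero_neq_one)
  have \<nu>: "?\<nu> > 0" using assms(5) by auto
  note ord = power_eq_1_iff_nu_dvd[OF assms(4) \<xi>]
  have \<nu>n: "?\<nu> dvd n" using ord \<xi>n by blast
  interpret H4n_data n ?\<omega>
    by unfold_locales (use assms(2) \<xi>n in \<open>simp_all add: power_commutes flip: power_mult, simp add: mult.commute power_mult\<close>)
  note plus = scaling_condition_plus[OF two \<xi> ord \<nu>, where t = t]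
  note minus = scaling_condition_minus[OF two \<xi> ord \<nu>, where t = t]
  obtain m where m: "n = ?\<nu> * m" using \<nu>n by (elim dvdE)
  \<comment> \<open>representatives may be taken in the natural numbers; the change is a multiple of \<open>n\<close>, hence of \<open>\<nu>\<close>\<close>
  have rep: "\<exists>l. residue_class n s = residue_class n (int l) \<and> (\<exists>k. s = int l + int ?\<nu> * k)" for s
  proof (intro exI conjI)
    have "int (nat (s mod int n)) = s mod int n" using assms(2) by simp
    then show "residue_class n s = residue_class n (int (nat (s mod int n)))"
      by (simp add: residue_class_eq_iff)
    have "int n = int ?\<nu> * int m" by (metis m of_nat_mult)
    then have "s = s mod int n + int ?\<nu> * (int m * (s div int n))"
      by (metis mod_mult_div_eq mult.assoc)
    then show "s = int (nat (s mod int n)) + int ?\<nu> * (int m * (s div int n))"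
      using assms(2) by simp
  qed
  have U_sub: "U_sub TYPE('k) n t = scaling_classes False"
  proof (intro subset_antisym subsetI)
    fix C assume "C \<in> U_sub TYPE('k) n t"
    then obtain s where C: "C = residue_class n s" "C \<in> carrier (Zn_units n)" and s: "int ?\<nu> dvd int t * (s - 1)"
      by (auto simp: U_sub_def)
    obtain l k where l: "residue_class n s = residue_class n (int l)" and k: "s = int l + int ?\<nu> * k"
      using rep by blast
    have "int t * (int l - 1) = int t * (s - 1) - int ?\<nu> * (int t * k)"
      by (simp add: k algebra_simps)
    then have "int ?\<nu> dvd int t * (int l - 1)" using s by (simp only: dvd_diff dvd_triv_left)
    then show "C \<in> scaling_classes False"
      using C by (simp add: l residue_class_scaling_iff residue_class_Zn_units_iff plus)
  qed (force simp: scaling_classes_def U_sub_def residue_class_Zn_units_iff plus)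
  have U_tilde: "U_tilde TYPE('k) n t = scaling_classes True"
  proof (intro subset_antisym subsetI)
    fix C assume "C \<in> U_tilde TYPE('k) n t"
    then consider "C \<in> scaling_classes False" | "C \<in> V_set TYPE('k) n t"
      by (auto simp: U_tilde_def U_sub)
    then show "C \<in> scaling_classes True"
    proof cases
      case 2
      then obtain s q where C: "C = residue_class n s" "C \<in> carrier (Zn_units n)" 
        and q: "odd q" "2 * int t * (s - 1) = int ?\<nu> * q"
        by (auto simp: V_set_def)
      obtain l k where l: "residue_class n s = residue_class n (int l)" and k: "s = int l + int ?\<nu> * k"
        using rep by blast
      have "2 * int t * (int l - 1) = 2 * int t * (s - 1) - int ?\<nu> * (2 * int t * k)"
        by (simp add: k algebra_simps)
      also have "\<dots> = int ?\<nu> * (q - 2 * int t * k)" unfolding q(2) by (simp only: right_diff_distrib)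
      finally have "2 * int t * (int l - 1) = int ?\<nu> * (q - 2 * int t * k)" .
      moreover have "odd (q - 2 * int t * k)" using q(1) by simp
      ultimately have "?\<omega> ^ l = - ?\<omega>" unfolding minus by blast
      then show ?thesis
        using C by (simp add: l residue_class_scaling_iff residue_class_Zn_units_iff)
    qed (auto simp: scaling_classes_def)
  next
    fix C assume "C \<in> scaling_classes True"
    then obtain l where C: "C = residue_class n (int l)" "coprime l n" and l: "?\<omega> ^ l = ?\<omega> \<or> ?\<omega> ^ l = - ?\<omega>"
      by (auto simp: scaling_classes_def)
    then have "C \<in> carrier (Zn_units n)" by (simp add: residue_class_Zn_units_iff)
    then show "C \<in> U_tilde TYPE('k) n t"
      using l unfolding plus minus U_tilde_def U_sub_def V_set_def C(1) by blast
  qed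
  \<comment> \<open>raising \<open>\<omega>\<^sup>l = -\<omega>\<close> to an odd power \<open>\<nu>\<close> would give \<open>1 = -1\<close>\<close>
  have even_\<nu>: "even ?\<nu>" if "?\<omega> ^ l = - ?\<omega>" for l
  proof (rule ccontr)
    assume "odd ?\<nu>"
    have "?\<omega> ^ ?\<nu> = 1" using ord by (simp flip: power_mult)
    moreover have "(?\<omega> ^ l) ^ ?\<nu> = (?\<omega> ^ ?\<nu>) ^ l" by (simp add: mult_ac flip: power_mult)
    moreover have "(- ?\<omega>) ^ ?\<nu> = - (?\<omega> ^ ?\<nu>)" using \<open>odd ?\<nu>\<close> by simp
    ultimately have "(1 :: 'k) = -1" using that by simp
    then have "(2 :: 'k) = 0" by (metis add.right_inverse one_add_one)
    then show False using two by simp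
  qed
  show ?thesis
    unfolding U_sub U_tilde
    using scaling_classes_subgroup[of False] scaling_classes_subgroup[of True]
      hopf_automorphism_group[OF two, of "even n \<and> even ?\<nu>"] even_\<nu>
    by (cases "even n \<and> even ?\<nu>") (simp_all, blast)
qed

end
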